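(* Let $k:(0,\infty)\times(0,\infty)\to\mathbb{R}$ be Borel-measurable and homogeneous of degree $\beta-1$ for some $\beta\in(0,2)$ (i.e. $k(t,ts)=t^{\beta-1}k(1,s)$ for $t>0$, $s\in(0,1)$), with $k(1,\cdot)\in L^{1+\varepsilon}((0,1))$ for some $\varepsilon>0$. Let $\hat\Phi(\lambda)=\sum_{n\ge0}\hat c_n\lambda^n$ with $\hat c_0=1$, $\hat c_n=\hat c_{n-1}\int_0^1k(1,s)s^{\beta(n-1)}ds$, and suppose $x\mapsto\hat\Phi(-x)$ is completely monotone on $(0,\infty)$. Then: (i) Let $\gamma\in(\beta,2]$ and $\delta\in[\gamma,2]\setminus\{\gamma/\beta\}$. If $A_{\gamma/\delta}$ is a nonnegative random variable with Laplace transform $x\mapsto\hat\Phi(-x^{\gamma/\delta})$ and $(Y^{(\delta,0,\beta/\gamma)}_t)_{t\ge0}$ is a symmetric linear fractional stable motion independent of $A_{\gamma/\delta}$, then $(A_{\gamma/\delta}^{1/\delta}Y^{(\delta,0,\beta/\gamma)}_t)_{t\ge0}$ provides a stochastic solution to $$u(t,x)=u_0(x)+\int_0^tk(t,s)\Delta^{\gamma/2}u(s,x)ds\ (t>0,x\in\mathbb{R}),\qquad \lim_{t\searrow0}u(t,x)=u_0(x)\ (x\in\mathbb{R}).$$ (ii) Let $\beta\ne1$, $\delta\in(\beta,2]\setminus\{1\}$ and $\rho\in[-1,1]$. If $A$ is a nonnegative random variable with Laplace transform $\hat\Phi(-\cdot)$ and $(Y^{(\delta,\rho,\beta/\delta)}_t)_{t\ge0}$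 is a linear fractional stable motion independent of $A$, then $(A^{1/\delta}Y^{(\delta,\rho,\beta/\delta)}_t)_{t\ge0}$ provides a stochastic solution to $$u(t,x)=u_0(x)+\int_0^tk(t,s)L_{\delta,\rho_0}u(s,x)ds\ (t>0,x\in\mathbb{R}),\qquad \lim_{t\searrow0}u(t,x)=u_0(x)\ (x\in\mathbb{R}),$$ where $\rho_0=\rho$ if $\beta\in(1,2)$, and if $\beta\in(0,1)$, $$\rho_0=\rho\,\frac{\frac1\beta-\int_0^\infty\big(x^{(\beta-1)/\delta}-(1+x)^{(\beta-1)/\delta}\big)^\delta dx}{\frac1\beta+\int_0^\infty\big(x^{(\beta-1)/\delta}-(1+x)^{(\beta-1)/\delta}\big)^\delta dx}.$$
   Context: Dimension $d=1$. For $\delta\in(0,2]$ and $\rho\in[-1,1]$ (with $\rho=0$ if $\delta=1$), $\psi_{\delta,\rho}(p)=|p|^\delta(1-i\rho\,\mathrm{sign}(p)\tan(\pi\delta/2))$, and $L_{\delta,\rho}$ is the pseudo-differential operator $L_{\delta,\rho}\varphi=\mathfrak{F}^{-1}[(-\psi_{\delta,\rho})\mathfrak{F}\varphi]$ on the Schwartz space $S(\mathbb{R})$ ($\mathfrak{F}\varphi(p)=(2\pi)^{-1/2}\int e^{-ipx}\varphi(x)dx$), closed in $C_\infty(\mathbb{R})$; $\Delta^{\delta/2}:=L_{\delta,0}$ (symbol $-|p|^\delta$). A stable random measure $M_{\delta,\rho}$ is a $\sigma$-additive map from the Borel sets of $\mathbb{R}$ to real random variables with independent values on pairwise disjoint sets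 and $\mathbb{E}[e^{ipM_{\delta,\rho}(A)}]=e^{-\mathrm{Leb}(A)\psi_{\delta,\rho}(p)}$. For $H\in(0,1)\setminus\{1/\delta\}$, the linear fractional stable motion is $Y^{(\delta,\rho,H)}_t=\frac1{K_{\delta,H}}\int_{\mathbb{R}}\big((t-x)_+^{H-1/\delta}-(-x)_+^{H-1/\delta}\big)M_{\delta,\rho}(dx)$, $t\ge0$, with $K_{\delta,H}=\big(\int_0^\infty|(1+x)^{H-1/\delta}-x^{H-1/\delta}|^\delta dx+\frac1{\delta H}\big)^{1/\delta}$; "symmetric" means $\rho=0$. A real-valued process $(X_t)_{t\ge0}$ with $X_0=0$ a.s. provides a stochastic solution to an equation of the displayed form if for every $u_0\in S(\mathbb{R})$ the function $u(t,x)=\mathbb{E}[u_0(x+X_t)]$ solves it. *)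

theory Defs
  imports "HOL-Probability.Probability"
begin

fun chat :: "(real \<Rightarrow> real \<Rightarrow> real) \<Rightarrow> real \<Rightarrow> nat \<Rightarrow> real" where
  "chat k \<beta> 0 = 1"
| "chat k \<beta> (Suc n) = chat k \<beta> n * (\<integral>s\<in>{0<..<1}. k 1 s * s powr (\<beta> * real n) \<partial>lborel)"

definition Phihat :: "(real \<Rightarrow> real \<Rightarrow> real) \<Rightarrow> real \<Rightarrow> real \<Rightarrow> real" where
  "Phihat k \<beta> y = (\<Sum>n. chat k \<beta> n * y ^ n)"

definition completely_monotone_on :: "real set \<Rightarrow> (real \<Rightarrow> real) \<Rightarrow> bool" where
  "completely_monotone_on S f \<longleftrightarrow>
     (\<forall>n. \<forall>x\<in>S. ((deriv ^^ n) f) differentiable (at x)) \<and>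
     (\<forall>n. \<forall>x\<in>S. 0 \<le> (-1) ^ n * (deriv ^^ n) f x)"

definition psi :: "real \<Rightarrow> real \<Rightarrow> real \<Rightarrow> complex" where
  "psi \<delta> \<rho> p = complex_of_real (\<bar>p\<bar> powr \<delta>) *
      (1 - \<i> * complex_of_real (\<rho> * sgn p * tan (pi * \<delta> / 2)))"

definition fourier :: "(real \<Rightarrow> complex) \<Rightarrow> real \<Rightarrow> complex" where
  "fourier \<phi> p = complex_of_real (1 / sqrt (2 * pi)) * (\<integral>x. cis (- (p * x)) * \<phi> x \<partial>lborel)"

definition inv_fourier :: "(real \<Rightarrow> complex) \<Rightarrow> real \<Rightarrow> complex" where
  "inv_fourier g x = complex_of_real (1 / sqrt (2 * pi)) * (\<integral>p. cis (p * x) * g p \<partial>lborel)"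

definition Lpsd :: "real \<Rightarrow> real \<Rightarrow> (real \<Rightarrow> complex) \<Rightarrow> real \<Rightarrow> complex" where
  "Lpsd \<delta> \<rho> \<phi> = inv_fourier (\<lambda>p. - psi \<delta> \<rho> p * fourier \<phi> p)"

definition Dn :: "nat \<Rightarrow> (real \<Rightarrow> complex) \<Rightarrow> real \<Rightarrow> complex" where
  "Dn n \<phi> = ((\<lambda>f x. vector_derivative f (at x)) ^^ n) \<phi>"

definition schwartz :: "(real \<Rightarrow> complex) \<Rightarrow> bool" where
  "schwartz \<phi> \<longleftrightarrow> (\<forall>n x. Dn n \<phi> differentiable (at x)) \<and>
     (\<forall>m n. \<exists>C. \<forall>x. \<bar>x\<bar> ^ m * norm (Dn n \<phi> x) \<le> C)"

definition C_inf :: "(real \<Rightarrow> complex) \<Rightarrow> bool" where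
  "C_inf f \<longleftrightarrow> continuous_on UNIV f \<and> (f \<longlongrightarrow> 0) at_infinity"

text \<open>Graph of the closure in C_infinity of L_{delta,rho} restricted to the Schwartz space:
  Lgraph delta rho f g means f is in the domain of the closed operator and L f = g.\<close>
definition Lgraph :: "real \<Rightarrow> real \<Rightarrow> (real \<Rightarrow> complex) \<Rightarrow> (real \<Rightarrow> complex) \<Rightarrow> bool" where
  "Lgraph \<delta> \<rho> f g \<longleftrightarrow> C_inf f \<and> C_inf g \<and>
     (\<exists>\<phi>::nat \<Rightarrow> real \<Rightarrow> complex. (\<forall>n. schwartz (\<phi> n)) \<and>
        uniform_limit UNIV \<phi> f sequentially \<and>
        uniform_limit UNIV (\<lambda>n. Lpsd \<delta> \<rho> (\<phi> n)) g sequentially)"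

definition solves_eq ::
  "(real \<Rightarrow> real \<Rightarrow> real) \<Rightarrow> ((real \<Rightarrow> complex) \<Rightarrow> (real \<Rightarrow> complex) \<Rightarrow> bool) \<Rightarrow>
   (real \<Rightarrow> complex) \<Rightarrow> (real \<Rightarrow> real \<Rightarrow> complex) \<Rightarrow> bool" where
  "solves_eq k G u0 u \<longleftrightarrow>
     (\<exists>g::real \<Rightarrow> real \<Rightarrow> complex.
        (\<forall>s>0. G (u s) (g s)) \<and>
        (\<forall>t>0. \<forall>x. set_integrable lborel {0<..<t} (\<lambda>s. k t s *\<^sub>R g s x) \<and>
                   u t x = u0 x + (\<integral>s\<in>{0<..<t}. k t s *\<^sub>R g s x \<partial>lborel)) \<and>
        (\<forall>x. ((\<lambda>t. u t x) \<longlongrightarrow> u0 x) (at_right 0)))"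

definition provides_stochastic_solution ::
  "'a measure \<Rightarrow> (real \<Rightarrow> 'a \<Rightarrow> real) \<Rightarrow> (real \<Rightarrow> real \<Rightarrow> real) \<Rightarrow>
   ((real \<Rightarrow> complex) \<Rightarrow> (real \<Rightarrow> complex) \<Rightarrow> bool) \<Rightarrow> bool" where
  "provides_stochastic_solution M X k G \<longleftrightarrow>
     (\<forall>t\<ge>0. X t \<in> borel_measurable M) \<and> (AE \<omega> in M. X 0 \<omega> = 0) \<and>
     (\<forall>u0. schwartz u0 \<longrightarrow> solves_eq k G u0 (\<lambda>t x. \<integral>\<omega>. u0 (x + X t \<omega>) \<partial>M))"

text \<open>Defined on Borel sets of finite Lebesgue measure (the only ones for which the
  prescribed characteristic function makes sense).\<close>
definition stable_random_measure ::
  "'a measure \<Rightarrow> real \<Rightarrow> real \<Rightarrow> (real set \<Rightarrow> 'a \<Rightarrow> real) \<Rightarrow> bool" where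
  "stable_random_measure M \<delta> \<rho> Z \<longleftrightarrow>
     (\<forall>A\<in>sets borel. emeasure lborel A < \<infinity> \<longrightarrow> Z A \<in> borel_measurable M) \<and>
     (\<forall>A\<in>sets borel. emeasure lborel A < \<infinity> \<longrightarrow>
        (\<forall>p. (\<integral>\<omega>. cis (p * Z A \<omega>) \<partial>M) =
              exp (- complex_of_real (measure lborel A) * psi \<delta> \<rho> p))) \<and>
     (\<forall>\<A>. (\<forall>A\<in>\<A>. A \<in> sets borel \<and> emeasure lborel A < \<infinity>) \<and> disjoint \<A> \<longrightarrow>
        prob_space.indep_vars M (\<lambda>_. borel) Z \<A>) \<and>
     (\<forall>F::nat \<Rightarrow> real set. range F \<subseteq> sets borel \<and> disjoint_family F \<and>
        emeasure lborel (\<Union>i. F i) < \<infinity> \<longrightarrow>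
        (AE \<omega> in M. (\<lambda>i. Z (F i) \<omega>) sums Z (\<Union>i. F i) \<omega>))"

definition simple_rep :: "nat \<Rightarrow> (nat \<Rightarrow> real set) \<Rightarrow> bool" where
  "simple_rep n B \<longleftrightarrow> (\<forall>i<n. B i \<in> sets borel \<and> emeasure lborel (B i) < \<infinity>) \<and>
     disjoint_family_on B {..<n}"

definition is_stable_integral ::
  "'a measure \<Rightarrow> (real set \<Rightarrow> 'a \<Rightarrow> real) \<Rightarrow> real \<Rightarrow> (real \<Rightarrow> real) \<Rightarrow> ('a \<Rightarrow> real) \<Rightarrow> bool" where
  "is_stable_integral M Z \<delta> f X \<longleftrightarrow> X \<in> borel_measurable M \<and>
     (\<exists>(N::nat \<Rightarrow> nat) (a::nat \<Rightarrow> nat \<Rightarrow> real) (B::nat \<Rightarrow> nat \<Rightarrow> real set).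
        (\<forall>j. simple_rep (N j) (B j)) \<and>
        ((\<lambda>j. \<integral>\<^sup>+x. ennreal (\<bar>f x - (\<Sum>i<N j. a j i * indicator (B j i) x)\<bar> powr \<delta>) \<partial>lborel)
            \<longlonglongrightarrow> 0) \<and>
        (\<forall>e>0. (\<lambda>j. measure M {\<omega>\<in>space M. e < \<bar>X \<omega> - (\<Sum>i<N j. a j i * Z (B j i) \<omega>)\<bar>})
            \<longlonglongrightarrow> 0))"

definition pospow :: "real \<Rightarrow> real \<Rightarrow> real" where
  "pospow y a = (if y > 0 then y powr a else 0)"

definition lfsm_kernel :: "real \<Rightarrow> real \<Rightarrow> real \<Rightarrow> real \<Rightarrow> real" where
  "lfsm_kernel \<delta> H t x = pospow (t - x) (H - 1 / \<delta>) - pospow (- x) (H - 1 / \<delta>)"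

definition K_const :: "real \<Rightarrow> real \<Rightarrow> real" where
  "K_const \<delta> H = ((\<integral>x\<in>{0<..}. \<bar>(1 + x) powr (H - 1 / \<delta>) - x powr (H - 1 / \<delta>)\<bar> powr \<delta> \<partial>lborel)
                   + 1 / (\<delta> * H)) powr (1 / \<delta>)"

definition is_lfsm :: "'a measure \<Rightarrow> real \<Rightarrow> real \<Rightarrow> real \<Rightarrow> (real \<Rightarrow> 'a \<Rightarrow> real) \<Rightarrow> bool" where
  "is_lfsm M \<delta> \<rho> H Y \<longleftrightarrow>
     (\<exists>Z. stable_random_measure M \<delta> \<rho> Z \<and>
        (\<forall>t\<ge>0. is_stable_integral M Z \<delta> (lfsm_kernel \<delta> H t) (\<lambda>\<omega>. K_const \<delta> H * Y t \<omega>)))"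

definition indep_of_process :: "'a measure \<Rightarrow> ('a \<Rightarrow> real) \<Rightarrow> (real \<Rightarrow> 'a \<Rightarrow> real) \<Rightarrow> bool" where
  "indep_of_process M A Y \<longleftrightarrow>
     A \<in> borel_measurable M \<and>
     (\<lambda>\<omega>. \<lambda>t\<in>{0..}. Y t \<omega>) \<in> measurable M (Pi\<^sub>M {0..} (\<lambda>_. borel)) \<and>
     prob_space.indep_set M
       (sigma_sets (space M) {A -` C \<inter> space M | C. C \<in> sets borel})
       (sigma_sets (space M) {(\<lambda>\<omega>. \<lambda>t\<in>{0..}. Y t \<omega>) -` C \<inter> space M | C. C \<in> sets (Pi\<^sub>M {0..} (\<lambda>_. borel))})"

definition rho0 :: "real \<Rightarrow> real \<Rightarrow> real \<Rightarrow> real" where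
  "rho0 \<beta> \<delta> \<rho> =
    (if 1 < \<beta> then \<rho>
     else (let I = (\<integral>x\<in>{0<..}. (x powr ((\<beta> - 1) / \<delta>) - (1 + x) powr ((\<beta> - 1) / \<delta>)) powr \<delta> \<partial>lborel)
           in \<rho> * (1 / \<beta> - I) / (1 / \<beta> + I)))"

end

theory Submission
  imports Defs "HOL-Complex_Analysis.Complex_Analysis"
begin

text \<open>
  Self-similarity of the kernel of linear fractional stable motion gives
  \<open>E exp(ipY\<^sub>t) = exp(- t\<^bsup>\<delta>H\<^esup> \<psi>(p))\<close>, where \<open>\<psi>\<close> is the stable symbol with the skewness
  changed by the sign of the kernel. Conditioning on the independent factor \<open>A\<close> turns this into
  the Laplace transform of \<open>A\<close>, so the scaled process has characteristic function
  \<open>\<Phi>(- t\<^sup>\<beta> \<psi>(p))\<close>; for complex \<open>\<psi>(p)\<close> this uses that \<open>\<Phi>\<close> is entire and the identity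
  theorem. The recursion for the coefficients of \<open>\<Phi>\<close> and the homogeneity of \<open>k\<close> say exactly that
  \<open>\<Phi>(- t\<^sup>\<beta> w) - 1 = - w \<integral>\<^sub>0\<^sup>t k(t,s) \<Phi>(- s\<^sup>\<beta> w) ds\<close>. Integrating against the Fourier transform of
  the initial datum gives the equation.
\<close>

section \<open>Functions with quadratic decay\<close>

text \<open>Three obstacles shape the details. The closed operator is reached only through Schwartz
  functions, whereas the expectation of \<open>u (x + X)\<close> is in general not Schwartz in
  \<open>x\<close>: the laws involved may have heavy tails, and \<open>psi\<close> is in general not
  smooth at 0. Bounded random shifts do preserve the Schwartz space, and they serve as
  approximations. Next, a stable integral is given only as a limit in probability along some simple
  approximations of the integrand, so its characteristic function requires continuity of the
  exponent in that sense; integrability of the kernel is a by-product of the mere existence of the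
  integral. Finally, the power series offers no convenient bound on \<open>Phi\<close> at
  \<open>- t powr \<beta> * psi p\<close>, where its terms cancel heavily. The bound 1 that
  dominates all interchanges of integrals holds because these values form a characteristic function.
  Analytic continuation serves statement (ii) only: in (i) the symbol is real, and the passage from
  exponent \<delta> to exponent \<gamma> is a choice of the real argument of the Laplace
  transform.\<close>

lemma borel_measurable_cis [measurable]: "cis \<in> borel_measurable borel"
  by (intro borel_measurable_continuous_onI continuous_intros)

lemma integrable_inverse_square_bound:
  "integrable lborel (\<lambda>p::real. C / (1 + p\<^sup>2))"
proof -
  have "integrable lborel (\<lambda>p::real. inverse (1 + p\<^sup>2))"
    using integrable_inverse_1_plus_square by (simp add: set_integrable_def einterval_def)
  then have "integrable lborel (\<lambda>p::real. C * inverse (1 + p\<^sup>2))"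
    by simp
  then show ?thesis by (simp add: divide_inverse)
qed

lemma integrable_quadratic_decay:
  fixes g :: "real \<Rightarrow> complex"
  assumes "g \<in> borel_measurable borel" "\<And>p. norm (g p) \<le> C / (1 + p\<^sup>2)"
  shows "integrable lborel g"
proof (rule Bochner_Integration.integrable_bound[OF integrable_inverse_square_bound[of C]])
  show "AE x in lborel. norm (g x) \<le> norm (C / (1 + x\<^sup>2))"
    using assms(2) by (intro AE_I2) (metis abs_ge_self order_trans real_norm_def)
qed (use assms in auto)

text \<open>The parallelogram identity for \<open>p + h\<close> and \<open>h\<close>, with the
  square of \<open>p + 2 * h\<close> dropped. It supplies one integrable majorant for all small
  translates of a function with quadratic decay.\<close>

lemma shifted_quadratic_bound:
  fixes p h :: real
  assumes "\<bar>h\<bar> \<le> 1"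
  shows "1 / (1 + (p + h)\<^sup>2) \<le> 3 / (1 + p\<^sup>2)"
proof -
  have "h\<^sup>2 \<le> 1" using assms by (simp add: abs_square_le_1)
  moreover have "p\<^sup>2 + (p + 2 * h)\<^sup>2 = (p + h)\<^sup>2 * 2 + 2 * h\<^sup>2"
    by (simp add: power2_eq_square algebra_simps)
  ultimately have "1 + p\<^sup>2 \<le> 3 * (1 + (p + h)\<^sup>2)"
    using zero_le_power2[of "p + h"] zero_le_power2[of "p + 2 * h"] by argo
  then show ?thesis by (simp add: field_simps add_pos_nonneg)
qed

section \<open>Inverse Fourier transforms of functions with quadratic decay\<close>

lemma norm_inv_fourier_le:
  fixes g :: "real \<Rightarrow> complex"
  shows "norm (inv_fourier g x) \<le> (\<integral>p. norm (g p) \<partial>lborel) / sqrt (2 * pi)"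
proof -
  have "norm (\<integral>p. cis (p * x) * g p \<partial>lborel) \<le> (\<integral>p. norm (cis (p * x) * g p) \<partial>lborel)"
    by (rule integral_norm_bound)
  then show ?thesis
    by (simp add: inv_fourier_def norm_mult norm_divide divide_right_mono)
qed

lemma integrable_cis_mult:
  fixes g :: "real \<Rightarrow> complex"
  assumes "integrable lborel g"
  shows "integrable lborel (\<lambda>p. cis (p * x) * g p)"
proof (rule Bochner_Integration.integrable_bound[OF assms])
  have [measurable]: "g \<in> borel_measurable borel" using assms by simp
  show "(\<lambda>p. cis (p * x) * g p) \<in> borel_measurable lborel" by measurable
qed (simp add: norm_mult)

lemma inv_fourier_diff:
  assumes "integrable lborel f" "integrable lborel g"
  shows "inv_fourier f x - inv_fourier g x = inv_fourier (\<lambda>p. f p - g p) x"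
  using integrable_cis_mult[OF assms(1)] integrable_cis_mult[OF assms(2)]
  by (simp add: inv_fourier_def right_diff_distrib)

lemma continuous_inv_fourier:
  assumes "integrable lborel g"
  shows "continuous_on UNIV (inv_fourier g)"
proof (rule continuous_at_imp_continuous_on, intro ballI)
  fix x :: real
  have [measurable]: "g \<in> borel_measurable borel" using assms by simp
  have "isCont (\<lambda>x. \<integral>p. cis (p * x) * g p \<partial>lborel) x"
    unfolding continuous_at_sequentially
  proof (intro allI impI)
    fix y assume y: "y \<longlonglongrightarrow> x"
    show "((\<lambda>x. \<integral>p. cis (p * x) * g p \<partial>lborel) \<circ> y) \<longlonglongrightarrow> (\<integral>p. cis (p * x) * g p \<partial>lborel)"
      unfolding comp_def
    proof (rule integral_dominated_convergence[where w="\<lambda>p. norm (g p)"])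
      show "AE p in lborel. (\<lambda>n. cis (p * y n) * g p) \<longlonglongrightarrow> cis (p * x) * g p"
        by (intro AE_I2 tendsto_intros y)
    qed (use assms in \<open>auto simp: norm_mult\<close>)
  qed
  then show "isCont (inv_fourier g) x"
    unfolding inv_fourier_def[abs_def] by (intro continuous_intros)
qed

text \<open>Riemann--Lebesgue: shifting the integration variable by \<open>\<pi>/x\<close> flips the sign of the
  exponential, so the transform is half the transform of \<open>g(p) - g(p + \<pi>/x)\<close>.\<close>

lemma inv_fourier_tendsto_0:
  fixes g :: "real \<Rightarrow> complex"
  assumes cont: "continuous_on UNIV g" and decay: "\<And>p. norm (g p) \<le> C / (1 + p\<^sup>2)"
  shows "(inv_fourier g \<longlongrightarrow> 0) at_infinity"
proof -
  have [measurable]: "g \<in> borel_measurable borel"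
    using cont by (rule borel_measurable_continuous_onI)
  have int: "integrable lborel g" by (rule integrable_quadratic_decay[OF _ decay]) simp
  define D where "D h = (\<integral>p. norm (g p - g (p + h)) \<partial>lborel)" for h :: real
  have C0: "C \<ge> 0" using order_trans[OF norm_ge_zero decay[of 0]] by simp
  \<comment> \<open>Translation is continuous in L1. For continuous \<open>g\<close> with quadratic
    decay this is dominated convergence with majorant constant \<open>4 * C\<close>, namely
    \<open>C\<close> for \<open>g\<close> itself and \<open>3 * C\<close> for its translate; the
    latter requires \<open>\<bar>h\<bar> \<le> 1\<close>, hence the shift of the sequence by
    \<open>N\<close>.\<close>
  have D0: "(D \<longlongrightarrow> 0) (at 0)"
    unfolding tendsto_at_iff_sequentially
  proof (intro allI impI)
    fix h :: "nat \<Rightarrow> real" assume "\<forall>i. h i \<in> UNIV - {0}" and h: "h \<longlonglongrightarrow> 0"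
    from h have "eventually (\<lambda>n. \<bar>h n\<bar> < 1) sequentially"
      by (auto dest!: tendstoD[where e=1] simp: dist_real_def)
    then obtain N where N: "\<And>n. n \<ge> N \<Longrightarrow> \<bar>h n\<bar> < 1" by (auto simp: eventually_sequentially)
    have "(\<lambda>n. D (h (n + N))) \<longlonglongrightarrow> (\<integral>p. 0 \<partial>(lborel :: real measure))"
      unfolding D_def
    proof (rule integral_dominated_convergence[where w="\<lambda>p. (4 * C) / (1 + p\<^sup>2)"])
      show "AE p in lborel. (\<lambda>n. norm (g p - g (p + h (n + N)))) \<longlonglongrightarrow> 0"
      proof (rule AE_I2)
        fix p :: real
        have "(\<lambda>n. p + h (n + N)) \<longlonglongrightarrow> p + 0"
          by (intro tendsto_intros LIMSEQ_ignore_initial_segment h)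
        moreover have "isCont g p" using cont by (simp add: continuous_on_eq_continuous_at)
        ultimately have "(\<lambda>n. g (p + h (n + N))) \<longlonglongrightarrow> g p"
          using isCont_tendsto_compose[of p g "\<lambda>n. p + h (n + N)" sequentially] by simp
        then have "(\<lambda>n. norm (g p - g (p + h (n + N)))) \<longlonglongrightarrow> norm (g p - g p)"
          by (intro tendsto_intros)
        then show "(\<lambda>n. norm (g p - g (p + h (n + N)))) \<longlonglongrightarrow> 0" by simp
      qed
      fix n
      show "AE p in lborel. norm (norm (g p - g (p + h (n + N)))) \<le> 4 * C / (1 + p\<^sup>2)"
      proof (rule AE_I2)
        fix p :: real
        have "norm (g p - g (p + h (n + N))) \<le> norm (g p) + norm (g (p + h (n + N)))"
          by (rule norm_triangle_ineq4)
        also have "\<dots> \<le> C / (1 + p\<^sup>2) + C / (1 + (p + h (n + N))\<^sup>2)"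
          by (intro add_mono decay)
        also have "C / (1 + (p + h (n + N))\<^sup>2) \<le> C * (3 / (1 + p\<^sup>2))"
          using mult_left_mono[OF shifted_quadratic_bound C0] N[of "n + N"] by (simp add: less_imp_le)
        finally show "norm (norm (g p - g (p + h (n + N)))) \<le> 4 * C / (1 + p\<^sup>2)"
          by (simp add: field_simps)
      qed
    qed (use integrable_inverse_square_bound in auto)
    then have "(\<lambda>n. D (h (n + N))) \<longlonglongrightarrow> 0" by simp
    then show "(D \<circ> h) \<longlonglongrightarrow> 0"
      by (simp add: LIMSEQ_offset comp_def)
  qed
  have bound: "norm (inv_fourier g x) \<le> D (pi / x)" if "x \<noteq> 0" for x
  proof -
    have ints: "integrable lborel (\<lambda>p. g (p + pi / x))"
      using lborel_integrable_real_affine[OF int, of 1 "pi / x"] by (simp add: add.commute)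
    have "inv_fourier g x = complex_of_real (1 / sqrt (2 * pi)) *
        (\<integral>p. cis ((pi / x + 1 * p) * x) * g (pi / x + 1 * p) \<partial>lborel)"
      unfolding inv_fourier_def
      by (subst lborel_integral_real_affine[where c=1 and t="pi / x"]) simp_all
    also have "(\<lambda>p. cis ((pi / x + 1 * p) * x) * g (pi / x + 1 * p)) = (\<lambda>p. - (cis (p * x) * g (p + pi / x)))"
    proof
      fix p
      have "(pi / x + 1 * p) * x = pi + p * x" using that by (simp add: field_simps)
      moreover have "cis (pi + p * x) = - cis (p * x)" by (simp add: complex_eq_iff)
      ultimately show "cis ((pi / x + 1 * p) * x) * g (pi / x + 1 * p) = - (cis (p * x) * g (p + pi / x))"
        by (simp add: add.commute)
    qed
    finally have "inv_fourier g x = - inv_fourier (\<lambda>p. g (p + pi / x)) x"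
      by (simp add: inv_fourier_def)
    then have "2 * inv_fourier g x = inv_fourier g x - inv_fourier (\<lambda>p. g (p + pi / x)) x"
      by simp
    also have "\<dots> = inv_fourier (\<lambda>p. g p - g (p + pi / x)) x"
      by (rule inv_fourier_diff[OF int ints])
    finally have "norm (2 * inv_fourier g x) = norm (inv_fourier (\<lambda>p. g p - g (p + pi / x)) x)"
      by (rule arg_cong)
    then have "2 * norm (inv_fourier g x) \<le> D (pi / x) / sqrt (2 * pi)"
      using norm_inv_fourier_le[of "\<lambda>p. g p - g (p + pi / x)" x]
      unfolding D_def by (simp add: norm_mult)
    also have "\<dots> \<le> D (pi / x) / 1"
      using pi_ge_two by (intro divide_left_mono) (auto simp: D_def)
    finally show ?thesis using norm_ge_zero[of "inv_fourier g x"] unfolding div_by_1 by linarith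
  qed
  have "((\<lambda>x. pi / x) \<longlongrightarrow> 0) (at_infinity :: real filter)"
    by (intro tendsto_divide_0[OF tendsto_const] filterlim_ident)
  moreover have "eventually (\<lambda>x::real. pi / x \<noteq> 0) at_infinity"
    using eventually_not_equal_at_infinity[of 0] by eventually_elim simp
  ultimately have "filterlim (\<lambda>x::real. pi / x) (at 0) at_infinity"
    by (simp add: filterlim_at)
  from filterlim_compose[OF D0 this] have "((\<lambda>x. D (pi / x)) \<longlongrightarrow> 0) at_infinity" .
  then show ?thesis
  proof (rule Lim_null_comparison[rotated])
    show "eventually (\<lambda>x. norm (inv_fourier g x) \<le> D (pi / x)) at_infinity"
      using eventually_not_equal_at_infinity[of 0] by eventually_elim (rule bound)
  qed
qed

lemma C_inf_inv_fourier:
  assumes "continuous_on UNIV g" "\<And>p. norm (g p) \<le> C / (1 + p\<^sup>2)"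
  shows "C_inf (inv_fourier g)"
  unfolding C_inf_def
proof
  have "integrable lborel g"
    by (rule integrable_quadratic_decay[OF borel_measurable_continuous_onI assms(2)]) (rule assms)
  then show "continuous_on UNIV (inv_fourier g)" by (rule continuous_inv_fourier)
qed (rule inv_fourier_tendsto_0[OF assms])

section \<open>Schwartz functions\<close>

lemma schwartz_has_vector_derivative:
  assumes "schwartz u"
  shows "(Dn n u has_vector_derivative Dn (Suc n) u x) (at x)"
  using assms vector_derivative_works[of "Dn n u" "at x"]
  by (simp add: schwartz_def Dn_def)

lemma schwartz_continuous:
  assumes "schwartz u"
  shows "continuous_on UNIV (Dn n u)"
  using schwartz_has_vector_derivative[OF assms, of n]
  by (auto intro!: continuous_at_imp_continuous_on has_vector_derivative_continuous)

lemma schwartz_measurable: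
  assumes "schwartz u"
  shows "Dn n u \<in> borel_measurable borel"
  using schwartz_continuous[OF assms] by (rule borel_measurable_continuous_onI)

lemma schwartz_quadratic_decay:
  assumes "schwartz u"
  obtains C where "\<And>x. norm (Dn n u x) \<le> C / (1 + x\<^sup>2)"
proof -
  obtain C0 where C0: "\<And>x. \<bar>x\<bar> ^ 0 * norm (Dn n u x) \<le> C0"
    using assms unfolding schwartz_def by blast
  obtain C2 where C2: "\<And>x. \<bar>x\<bar> ^ 2 * norm (Dn n u x) \<le> C2"
    using assms unfolding schwartz_def by blast
  have "norm (Dn n u x) \<le> (C0 + C2) / (1 + x\<^sup>2)" for x
    using C0[of x] C2[of x] by (simp add: field_simps add_pos_nonneg)
  then show ?thesis by (rule that)
qed

lemma schwartz_bounded: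
  assumes "schwartz u"
  obtains C where "\<And>x. norm (Dn n u x) \<le> C"
proof -
  obtain C0 where C0: "\<And>x. \<bar>x\<bar> ^ 0 * norm (Dn n u x) \<le> C0"
    using assms unfolding schwartz_def by blast
  show ?thesis by (rule that[of C0]) (use C0 in simp)
qed

lemma schwartz_integrable:
  assumes "schwartz u"
  shows "integrable lborel (Dn n u)"
proof -
  obtain C where "\<And>x. norm (Dn n u x) \<le> C / (1 + x\<^sup>2)"
    using schwartz_quadratic_decay[OF assms] by blast
  then show ?thesis by (rule integrable_quadratic_decay[OF schwartz_measurable[OF assms]])
qed

lemma Dn_0 [simp]: "Dn 0 u = u"
  by (simp add: Dn_def)

lemma schwartz_tendsto_0:
  assumes "schwartz u"
  shows "(Dn n u \<longlongrightarrow> 0) at_infinity"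
proof -
  obtain C where C: "\<And>x. \<bar>x\<bar> ^ 1 * norm (Dn n u x) \<le> C"
    using assms unfolding schwartz_def by blast
  have "((\<lambda>x. C / x) \<longlongrightarrow> 0) (at_infinity :: real filter)"
    by (intro tendsto_divide_0[OF tendsto_const] filterlim_ident)
  then have "((\<lambda>x. \<bar>C / x\<bar>) \<longlongrightarrow> 0) (at_infinity :: real filter)"
    by (rule tendsto_rabs_zero)
  then show ?thesis
  proof (rule Lim_null_comparison[rotated])
    show "eventually (\<lambda>x. norm (Dn n u x) \<le> \<bar>C / x\<bar>) at_infinity"
      using eventually_not_equal_at_infinity[of 0]
    proof eventually_elim
      case (elim x)
      have "norm (Dn n u x) \<le> C / \<bar>x\<bar>"
        using C[of x] elim by (simp add: field_simps)
      also have "\<dots> \<le> \<bar>C / x\<bar>" by (simp add: divide_right_mono)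
      finally show ?case .
    qed
  qed
qed

text \<open>Integration by parts on the whole line is used in this form: both boundary terms vanish,
  so a total derivative integrates to zero.\<close>

lemma integral_derivative_eq_0:
  fixes F f :: "real \<Rightarrow> complex"
  assumes F: "\<And>x. (F has_vector_derivative f x) (at x)" and f: "continuous_on UNIV f"
    and int: "integrable lborel f" and lim: "(F \<longlongrightarrow> 0) at_infinity"
  shows "(\<integral>x. f x \<partial>lborel) = 0"
proof -
  have "(LBINT x=-\<infinity>..\<infinity>. f x) = 0 - 0"
  proof (rule interval_integral_FTC_integrable[where F=F])
    show "isCont f x" for x using f by (simp add: continuous_on_eq_continuous_at)
    show "set_integrable lborel (einterval (- \<infinity>) \<infinity>) f"
      using int by (simp add: set_integrable_def einterval_def)
    have "(F \<longlongrightarrow> 0) at_top" "(F \<longlongrightarrow> 0) at_bot"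
      using lim at_top_le_at_infinity at_bot_le_at_infinity by (auto intro: tendsto_mono)
    then show "((F \<circ> real_of_ereal) \<longlongrightarrow> 0) (at_right (- \<infinity>))" "((F \<circ> real_of_ereal) \<longlongrightarrow> 0) (at_left \<infinity>)"
      by (simp_all add: ereal_tendsto_simps)
  qed (use F in auto)
  then show ?thesis
    by (simp add: interval_lebesgue_integral_def einterval_def set_lebesgue_integral_def)
qed

text \<open>The two terms in the derivative of \<open>cis (- (p * x)) * Dn n u x\<close> are, after
  integration, the two sides of the claim up to the normalising factor.\<close>

lemma fourier_Dn_Suc:
  assumes "schwartz u"
  shows "fourier (Dn (Suc n) u) p = \<i> * complex_of_real p * fourier (Dn n u) p"
proof -
  let ?F = "\<lambda>x. cis (- (p * x)) * Dn n u x"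
  let ?f = "\<lambda>x. cis (- (p * x)) * Dn (Suc n) u x - \<i> * complex_of_real p * (cis (- (p * x)) * Dn n u x)"
  have i1: "integrable lborel (\<lambda>x. cis (- (p * x)) * Dn m u x)" for m
    using integrable_cis_mult[OF schwartz_integrable[OF assms], of "- p" m] by (simp add: mult.commute)
  have "(\<integral>x. ?f x \<partial>lborel) = 0"
  proof (rule integral_derivative_eq_0[where F="?F"])
    fix x :: real
    have "((\<lambda>x. cis (- (p * x))) has_vector_derivative (- p) *\<^sub>R (\<i> * cis (- (p * x)))) (at x)"
      unfolding cis_conv_exp
      by (auto intro!: derivative_eq_intros has_vector_derivative_real_field simp: scaleR_conv_of_real)
    from has_vector_derivative_mult[OF this schwartz_has_vector_derivative[OF assms, of n]]
    show "(?F has_vector_derivative ?f x) (at x)"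
      by (rule has_vector_derivative_eq_rhs) (simp add: scaleR_conv_of_real algebra_simps)
  next
    show "continuous_on UNIV ?f"
      by (intro continuous_intros schwartz_continuous[OF assms])
    show "integrable lborel ?f"
      by (intro Bochner_Integration.integrable_diff i1 integrable_mult_right)
    have "((\<lambda>x. norm (Dn n u x)) \<longlongrightarrow> 0) at_infinity"
      using schwartz_tendsto_0[OF assms] by (rule tendsto_norm_zero)
    then show "(?F \<longlongrightarrow> 0) at_infinity"
      by (rule Lim_null_comparison[rotated]) (simp add: norm_mult)
  qed
  moreover have "(\<integral>x. ?f x \<partial>lborel) = (\<integral>x. cis (- (p * x)) * Dn (Suc n) u x \<partial>lborel)
      - \<i> * complex_of_real p * (\<integral>x. cis (- (p * x)) * Dn n u x \<partial>lborel)"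
    by (subst Bochner_Integration.integral_diff) (auto intro!: i1)
  ultimately show ?thesis by (simp add: fourier_def)
qed

lemma fourier_Dn:
  assumes "schwartz u"
  shows "fourier (Dn n u) p = (\<i> * complex_of_real p) ^ n * fourier u p"
  by (induction n) (simp_all add: fourier_Dn_Suc[OF assms])

lemma fourier_eq_inv_fourier: "fourier u p = inv_fourier u (- p)"
  by (simp add: fourier_def inv_fourier_def mult.commute)

lemma continuous_fourier:
  assumes "integrable lborel u"
  shows "continuous_on UNIV (fourier u)"
proof -
  have "continuous_on UNIV (\<lambda>p. inv_fourier u (- p))"
    by (intro continuous_on_compose2[OF continuous_inv_fourier[OF assms]] continuous_intros) auto
  then show ?thesis by (simp add: fourier_eq_inv_fourier[abs_def])
qed

text \<open>Each derivative of \<open>u\<close> is integrable, and its transform, bounded by the L1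
  norm, carries a power of \<open>p\<close>. The case \<open>n = 2\<close> gives integrability of
  the transform; \<open>n = 4\<close> leaves quadratic decay after multiplication by a symbol of
  order at most 2.\<close>

lemma schwartz_fourier_decay:
  assumes "schwartz u"
  obtains C where "\<And>p. (1 + \<bar>p\<bar> ^ n) * norm (fourier u p) \<le> C"
proof -
  define B where "B m = (\<integral>p. norm (Dn m u p) \<partial>lborel) / sqrt (2 * pi)" for m
  have B: "norm (fourier (Dn m u) p) \<le> B m" for m p
    unfolding B_def fourier_eq_inv_fourier by (rule norm_inv_fourier_le)
  have "(1 + \<bar>p\<bar> ^ n) * norm (fourier u p) \<le> B 0 + B n" for p
    using B[of 0 p] B[of n p] by (simp add: fourier_Dn[OF assms] norm_mult norm_power algebra_simps)
  then show ?thesis by (rule that)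
qed

section \<open>Fourier inversion by Gaussian regularisation\<close>

lemma integral_cis_gaussian:
  assumes e: "e > 0"
  shows "(\<integral>p. cis (p * a) * complex_of_real (exp (- (e * p)\<^sup>2 / 2)) \<partial>lborel)
    = complex_of_real (sqrt (2 * pi) / e * exp (- (a / e)\<^sup>2 / 2))"
proof -
  have "complex_of_real (exp (- ((a / e)\<^sup>2) / 2)) = char std_normal_distribution (a / e)"
    by (simp add: char_std_normal_distribution)
  also have "\<dots> = (\<integral>q. std_normal_density q *\<^sub>R cis (a / e * q) \<partial>lborel)"
    unfolding char_def by (subst integral_density) (auto simp: cis_conv_exp)
  also have "\<dots> = (\<integral>q. complex_of_real (1 / sqrt (2 * pi)) *
      (cis (q / e * a) * complex_of_real (exp (- (e * (q / e))\<^sup>2 / 2))) \<partial>lborel)"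
    using e by (intro Bochner_Integration.integral_cong)
      (auto simp: std_normal_density_def scaleR_conv_of_real field_simps)
  also have "\<dots> = complex_of_real (1 / sqrt (2 * pi)) *
      (\<integral>q. cis (q / e * a) * complex_of_real (exp (- (e * (q / e))\<^sup>2 / 2)) \<partial>lborel)"
    by (rule integral_mult_right_zero)
  finally have *: "(\<integral>q. cis (q / e * a) * complex_of_real (exp (- (e * (q / e))\<^sup>2 / 2)) \<partial>lborel)
      = complex_of_real (sqrt (2 * pi) * exp (- ((a / e)\<^sup>2) / 2))"
    by (simp add: field_simps)
  have "(\<integral>p. cis (p * a) * complex_of_real (exp (- (e * p)\<^sup>2 / 2)) \<partial>lborel)
    = \<bar>1 / e\<bar> *\<^sub>R (\<integral>q. cis ((0 + 1 / e * q) * a) * complex_of_real (exp (- (e * (0 + 1 / e * q))\<^sup>2 / 2)) \<partial>lborel)"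
    using e by (intro lborel_integral_real_affine) auto
  also have "(\<lambda>q. cis ((0 + 1 / e * q) * a) * complex_of_real (exp (- (e * (0 + 1 / e * q))\<^sup>2 / 2)))
      = (\<lambda>q. cis (q / e * a) * complex_of_real (exp (- (e * (q / e))\<^sup>2 / 2)))"
    by (intro ext) simp
  finally show ?thesis unfolding * using e by (simp add: scaleR_conv_of_real)
qed

lemma integrable_std_normal_density: "integrable lborel (std_normal_density)"
  using integrable_normal_density[of 1 0] by simp

lemma integrable_gaussian:
  fixes e :: real
  assumes e: "e > 0"
  shows "integrable lborel (\<lambda>p. exp (- (e * p)\<^sup>2 / 2))"
proof -
  have "integrable lborel (\<lambda>p. sqrt (2 * pi) * std_normal_density (0 + e * p))"
    using e lborel_integrable_real_affine[OF integrable_std_normal_density, of e 0] by simp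
  then show ?thesis by (simp add: std_normal_density_def)
qed

text \<open>Only the modulus of \<open>h\<close> has to factor. This admits phases such as
  \<open>cis (p * (x - y))\<close>, which couple the variables.\<close>

lemma integrable_product:
  fixes f g :: "real \<Rightarrow> complex" and h :: "real \<times> real \<Rightarrow> complex"
  assumes f: "integrable lborel f" and g: "integrable lborel g"
    and [measurable]: "h \<in> borel_measurable (lborel \<Otimes>\<^sub>M lborel)"
    and h: "\<And>x y. norm (h (x, y)) = norm (f x) * norm (g y)"
  shows "integrable (lborel \<Otimes>\<^sub>M lborel) h"
proof (rule lborel_pair.Fubini_integrable)
  show "integrable lborel (\<lambda>x. \<integral>y. norm (h (x, y)) \<partial>lborel)"
    using f by (simp add: h)
  show "AE x in lborel. integrable lborel (\<lambda>y. h (x, y))"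
  proof (rule AE_I2)
    fix x
    have "integrable lborel (\<lambda>y. norm (f x) * norm (g y))" using g by simp
    then show "integrable lborel (\<lambda>y. h (x, y))"
      by (rule Bochner_Integration.integrable_bound) (auto simp: h)
  qed
qed simp

text \<open>The Gaussian damping makes the double integral over \<open>p\<close> and
  \<open>y\<close> absolutely convergent. After the interchange the inner integral is again
  Gaussian, and \<open>y = x + e * z\<close> exhibits the result as \<open>u\<close> averaged over a
  centred normal shift of standard deviation \<open>e\<close>.\<close>

lemma inv_fourier_gaussian_regularisation:
  assumes u: "integrable lborel u" and e: "e > 0"
  shows "inv_fourier (\<lambda>p. complex_of_real (exp (- (e * p)\<^sup>2 / 2)) * fourier u p) x
    = (\<integral>z. std_normal_density z *\<^sub>R u (x + e * z) \<partial>lborel)"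
proof -
  let ?c = "complex_of_real (1 / sqrt (2 * pi))"
  let ?G = "\<lambda>p. complex_of_real (exp (- (e * p)\<^sup>2 / 2))"
  have [measurable]: "u \<in> borel_measurable borel" using u by simp
  have int: "integrable (lborel \<Otimes>\<^sub>M lborel) (\<lambda>(p, y). cis (p * (x - y)) * ?G p * u y)"
    by (rule integrable_product[where f="?G" and g=u])
      (use integrable_gaussian[OF e] u in \<open>auto simp: norm_mult\<close>)
  have "inv_fourier (\<lambda>p. ?G p * fourier u p) x
      = ?c * (?c * (\<integral>p. (\<integral>y. cis (p * (x - y)) * ?G p * u y \<partial>lborel) \<partial>lborel))"
  proof -
    have "cis (p * x) * (?G p * fourier u p) = ?c * (\<integral>y. cis (p * (x - y)) * ?G p * u y \<partial>lborel)" for p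
    proof -
      have "cis (p * (x - y)) * ?G p * u y = (cis (p * x) * ?G p) * (cis (- (p * y)) * u y)" for y
      proof -
        have "cis (p * (x - y)) = cis (p * x) * cis (- (p * y))"
          by (simp add: cis_mult right_diff_distrib)
        then show ?thesis by (simp only: mult_ac)
      qed
      then have "(\<integral>y. cis (p * (x - y)) * ?G p * u y \<partial>lborel)
          = (cis (p * x) * ?G p) * (\<integral>y. cis (- (p * y)) * u y \<partial>lborel)"
        by (simp only: integral_mult_right_zero)
      then show ?thesis by (simp add: fourier_def mult_ac)
    qed
    then show ?thesis unfolding inv_fourier_def by simp
  qed
  also have "(\<integral>p. (\<integral>y. cis (p * (x - y)) * ?G p * u y \<partial>lborel) \<partial>lborel)
      = (\<integral>y. (\<integral>p. cis (p * (x - y)) * ?G p * u y \<partial>lborel) \<partial>lborel)"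
    using lborel_pair.Fubini_integral[OF int] by simp
  also have "(\<lambda>y. \<integral>p. cis (p * (x - y)) * ?G p * u y \<partial>lborel)
      = (\<lambda>y. complex_of_real (sqrt (2 * pi) / e * exp (- ((x - y) / e)\<^sup>2 / 2)) * u y)"
    using integral_cis_gaussian[OF e] by simp
  also have "(\<integral>y. complex_of_real (sqrt (2 * pi) / e * exp (- ((x - y) / e)\<^sup>2 / 2)) * u y \<partial>lborel)
      = \<bar>e\<bar> *\<^sub>R (\<integral>z. complex_of_real (sqrt (2 * pi) / e * exp (- ((x - (x + e * z)) / e)\<^sup>2 / 2)) * u (x + e * z) \<partial>lborel)"
    using e by (intro lborel_integral_real_affine) auto
  also have "(\<lambda>z. complex_of_real (sqrt (2 * pi) / e * exp (- ((x - (x + e * z)) / e)\<^sup>2 / 2)) * u (x + e * z))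
      = (\<lambda>z. complex_of_real (2 * pi / e) * (std_normal_density z *\<^sub>R u (x + e * z)))"
    using e by (auto simp: std_normal_density_def scaleR_conv_of_real field_simps simp flip: of_real_mult)
  finally show ?thesis
    using e by (simp add: scaleR_conv_of_real flip: of_real_mult)
qed

lemma schwartz_fourier_integrable:
  assumes "schwartz u"
  shows "integrable lborel (fourier u)"
proof -
  obtain C where C: "\<And>p. (1 + \<bar>p\<bar> ^ 2) * norm (fourier u p) \<le> C"
    using schwartz_fourier_decay[OF assms] by blast
  have "norm (fourier u p) \<le> C / (1 + p\<^sup>2)" for p
    using C[of p] by (simp add: field_simps add_pos_nonneg)
  moreover have "fourier u \<in> borel_measurable borel"
    using schwartz_integrable[OF assms, of 0]
    by (intro borel_measurable_continuous_onI continuous_fourier) simp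
  ultimately show ?thesis by (intro integrable_quadratic_decay)
qed

text \<open>Let \<open>e\<close> tend to 0 in the regularised identity. The left side is dominated
  by the integrable \<open>norm (fourier u p)\<close>; on the right, \<open>u\<close> is bounded and
  continuous, so the averages tend to \<open>u x\<close>.\<close>

theorem fourier_inversion:
  assumes "schwartz u"
  shows "inv_fourier (fourier u) x = u x"
proof -
  have int: "integrable lborel u" using schwartz_integrable[OF assms, of 0] by simp
  have [measurable]: "u \<in> borel_measurable borel" using int by simp
  note intF = schwartz_fourier_integrable[OF assms]
  have [measurable]: "fourier u \<in> borel_measurable borel" using intF by simp
  obtain B where B: "\<And>x. norm (u x) \<le> B" using schwartz_bounded[OF assms, of 0] by auto
  have cont: "isCont u y" for y
    using schwartz_continuous[OF assms, of 0] by (simp add: continuous_on_eq_continuous_at)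
  define e where "e n = 1 / real (Suc n)" for n
  have e: "e n > 0" "e \<longlonglongrightarrow> 0" for n
    unfolding e_def using LIMSEQ_inverse_real_of_nat by (auto simp: divide_inverse)
  let ?G = "\<lambda>n p. complex_of_real (exp (- (e n * p)\<^sup>2 / 2))"
  have 1: "(\<lambda>n. inv_fourier (\<lambda>p. ?G n p * fourier u p) x) \<longlonglongrightarrow> inv_fourier (fourier u) x"
    unfolding inv_fourier_def
  proof (intro tendsto_intros integral_dominated_convergence[where w="\<lambda>p. norm (fourier u p)"])
    show "AE p in lborel. (\<lambda>n. cis (p * x) * (?G n p * fourier u p)) \<longlonglongrightarrow> cis (p * x) * fourier u p"
    proof (rule AE_I2)
      fix p
      have "(\<lambda>n. cis (p * x) * (?G n p * fourier u p))
          \<longlonglongrightarrow> cis (p * x) * (complex_of_real (exp (- (0 * p)\<^sup>2 / 2)) * fourier u p)"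
        by (intro tendsto_intros e) auto
      then show "(\<lambda>n. cis (p * x) * (?G n p * fourier u p)) \<longlonglongrightarrow> cis (p * x) * fourier u p" by simp
    qed
    show "AE p in lborel. norm (cis (p * x) * (?G n p * fourier u p)) \<le> norm (fourier u p)" for n
      by (intro AE_I2) (auto simp: norm_mult intro!: mult_left_le_one_le)
  qed (use intF in auto)
  have 2: "(\<lambda>n. \<integral>z. std_normal_density z *\<^sub>R u (x + e n * z) \<partial>lborel)
      \<longlonglongrightarrow> (\<integral>z. std_normal_density z *\<^sub>R u x \<partial>lborel)"
  proof (rule integral_dominated_convergence[where w="\<lambda>z. std_normal_density z * B"])
    show "AE z in lborel. (\<lambda>n. std_normal_density z *\<^sub>R u (x + e n * z)) \<longlonglongrightarrow> std_normal_density z *\<^sub>R u x"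
    proof (rule AE_I2)
      fix z
      have "(\<lambda>n. x + e n * z) \<longlonglongrightarrow> x + 0 * z" by (intro tendsto_intros e)
      then have "(\<lambda>n. u (x + e n * z)) \<longlonglongrightarrow> u x"
        using isCont_tendsto_compose[OF cont[of x]] by simp
      then show "(\<lambda>n. std_normal_density z *\<^sub>R u (x + e n * z)) \<longlonglongrightarrow> std_normal_density z *\<^sub>R u x"
        by (intro tendsto_intros)
    qed
    show "AE z in lborel. norm (std_normal_density z *\<^sub>R u (x + e n * z)) \<le> std_normal_density z * B" for n
      by (intro AE_I2) (auto intro!: mult_left_mono B)
  qed (use integrable_std_normal_density in auto)
  have "(\<integral>z. std_normal_density z *\<^sub>R u x \<partial>lborel) = u x"
    using integral_normal_density[of 1 0] integrable_std_normal_density by simp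
  with 2 have "(\<lambda>n. inv_fourier (\<lambda>p. ?G n p * fourier u p) x) \<longlonglongrightarrow> u x"
    using inv_fourier_gaussian_regularisation[OF int e(1)] by simp
  with 1 show ?thesis by (rule LIMSEQ_unique)
qed

section \<open>Expectations of shifted functions\<close>

context prob_space
begin

lemma norm_expectation_cis_le: "norm (expectation (\<lambda>\<omega>. cis (p * X \<omega>))) \<le> 1"
proof -
  have "norm (expectation (\<lambda>\<omega>. cis (p * X \<omega>))) \<le> expectation (\<lambda>\<omega>. norm (cis (p * X \<omega>)))"
    by (rule integral_norm_bound)
  then show ?thesis by (simp add: prob_space)
qed

lemma continuous_expectation_cis:
  assumes [measurable]: "X \<in> borel_measurable M"
  shows "continuous_on UNIV (\<lambda>p. expectation (\<lambda>\<omega>. cis (p * X \<omega>)))"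
proof (rule continuous_at_imp_continuous_on, intro ballI)
  fix p :: real
  show "isCont (\<lambda>p. expectation (\<lambda>\<omega>. cis (p * X \<omega>))) p"
    unfolding continuous_at_sequentially
  proof (intro allI impI)
    fix y assume y: "y \<longlonglongrightarrow> p"
    show "((\<lambda>p. expectation (\<lambda>\<omega>. cis (p * X \<omega>))) \<circ> y) \<longlonglongrightarrow> expectation (\<lambda>\<omega>. cis (p * X \<omega>))"
      unfolding comp_def
    proof (rule integral_dominated_convergence[where w="\<lambda>_. 1"])
      show "AE \<omega> in M. (\<lambda>n. cis (y n * X \<omega>)) \<longlonglongrightarrow> cis (p * X \<omega>)"
        by (intro AE_I2 tendsto_intros y)
    qed auto
  qed
qed

text \<open>A random shift is a Fourier multiplier, the multiplier being the characteristic function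
  of \<open>X\<close>: the exponential of the sum factors, and Fubini averages the random
  factor.\<close>

lemma expectation_inv_fourier_shift:
  assumes [measurable]: "X \<in> borel_measurable M" and g: "integrable lborel g"
  shows "expectation (\<lambda>\<omega>. inv_fourier g (x + X \<omega>))
    = inv_fourier (\<lambda>p. expectation (\<lambda>\<omega>. cis (p * X \<omega>)) * g p) x"
proof -
  interpret P: pair_sigma_finite M lborel ..
  have [measurable]: "g \<in> borel_measurable borel" using g by simp
  have int: "integrable (M \<Otimes>\<^sub>M lborel) (\<lambda>(\<omega>, p). cis (p * (x + X \<omega>)) * g p)"
  proof (rule P.Fubini_integrable)
    show "integrable M (\<lambda>\<omega>. \<integral>p. norm (case (\<omega>, p) of (\<omega>, p) \<Rightarrow> cis (p * (x + X \<omega>)) * g p) \<partial>lborel)"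
      by (simp add: norm_mult)
    show "AE \<omega> in M. integrable lborel (\<lambda>p. case (\<omega>, p) of (\<omega>, p) \<Rightarrow> cis (p * (x + X \<omega>)) * g p)"
      using integrable_cis_mult[OF g] by simp
  qed simp
  have "expectation (\<lambda>\<omega>. \<integral>p. cis (p * (x + X \<omega>)) * g p \<partial>lborel)
      = (\<integral>p. expectation (\<lambda>\<omega>. cis (p * (x + X \<omega>)) * g p) \<partial>lborel)"
    using P.Fubini_integral[OF int] by simp
  also have "(\<lambda>p. expectation (\<lambda>\<omega>. cis (p * (x + X \<omega>)) * g p))
      = (\<lambda>p. cis (p * x) * (expectation (\<lambda>\<omega>. cis (p * X \<omega>)) * g p))"
  proof
    fix p
    have "(\<lambda>\<omega>. cis (p * (x + X \<omega>)) * g p) = (\<lambda>\<omega>. (cis (p * x) * g p) * cis (p * X \<omega>))"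
      by (intro ext) (simp add: distrib_left flip: cis_mult)
    then show "expectation (\<lambda>\<omega>. cis (p * (x + X \<omega>)) * g p)
        = cis (p * x) * (expectation (\<lambda>\<omega>. cis (p * X \<omega>)) * g p)"
      by (simp add: mult_ac)
  qed
  finally show ?thesis by (simp add: inv_fourier_def)
qed

text \<open>The multiplier rule on the side of the direct transform. It is needed because
  \<open>Lpsd\<close> acts through \<open>fourier\<close>, and the function to be transformed there
  is the averaged one. Translation invariance of Lebesgue measure moves the shift into the
  exponential.\<close>

lemma fourier_expectation_shift:
  assumes [measurable]: "X \<in> borel_measurable M" and u: "integrable lborel u"
  shows "fourier (\<lambda>x. expectation (\<lambda>\<omega>. u (x + X \<omega>))) p
    = expectation (\<lambda>\<omega>. cis (p * X \<omega>)) * fourier u p"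
proof -
  interpret P: pair_sigma_finite M lborel ..
  have [measurable]: "u \<in> borel_measurable borel" using u by simp
  have aff: "integrable lborel (\<lambda>x. u (x + a))" for a
    using lborel_integrable_real_affine[OF u, of 1 a] by (simp add: add.commute)
  have affi: "(\<integral>x. f (x + a) \<partial>lborel) = (\<integral>x. f x \<partial>lborel)" for a and f :: "real \<Rightarrow> 'c :: {banach, second_countable_topology}"
    using lborel_integral_real_affine[of 1 f a] by (simp add: add.commute)
  have int: "integrable (M \<Otimes>\<^sub>M lborel) (\<lambda>(\<omega>, x). cis (- (p * x)) * u (x + X \<omega>))"
  proof (rule P.Fubini_integrable)
    show "integrable M (\<lambda>\<omega>. \<integral>x. norm (case (\<omega>, x) of (\<omega>, x) \<Rightarrow> cis (- (p * x)) * u (x + X \<omega>)) \<partial>lborel)"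
      by (simp add: norm_mult affi[of "\<lambda>x. norm (u x)"])
    show "AE \<omega> in M. integrable lborel (\<lambda>x. case (\<omega>, x) of (\<omega>, x) \<Rightarrow> cis (- (p * x)) * u (x + X \<omega>))"
    proof (rule AE_I2)
      fix \<omega>
      have "(\<lambda>x. case (\<omega>, x) of (\<omega>, x) \<Rightarrow> cis (- (p * x)) * u (x + X \<omega>)) = (\<lambda>x. cis (x * - p) * u (x + X \<omega>))"
        by (simp add: mult.commute)
      then show "integrable lborel (\<lambda>x. case (\<omega>, x) of (\<omega>, x) \<Rightarrow> cis (- (p * x)) * u (x + X \<omega>))"
        using integrable_cis_mult[OF aff[of "X \<omega>"], of "- p"] by (simp only:)
    qed
  qed simp
  have "(\<integral>x. expectation (\<lambda>\<omega>. cis (- (p * x)) * u (x + X \<omega>)) \<partial>lborel)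
      = expectation (\<lambda>\<omega>. \<integral>x. cis (- (p * x)) * u (x + X \<omega>) \<partial>lborel)"
    using P.Fubini_integral[OF int] by simp
  also have "(\<lambda>\<omega>. \<integral>x. cis (- (p * x)) * u (x + X \<omega>) \<partial>lborel)
      = (\<lambda>\<omega>. cis (p * X \<omega>) * (\<integral>x. cis (- (p * x)) * u x \<partial>lborel))"
  proof
    fix \<omega>
    have "cis (- (p * x)) * u (x + X \<omega>) = cis (p * X \<omega>) * (cis (- (p * (x + X \<omega>))) * u (x + X \<omega>))" for x
    proof -
      have "cis (- (p * x)) = cis (p * X \<omega>) * cis (- (p * (x + X \<omega>)))"
        by (simp add: cis_mult algebra_simps)
      then show ?thesis by simp
    qed
    then show "(\<integral>x. cis (- (p * x)) * u (x + X \<omega>) \<partial>lborel)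
        = cis (p * X \<omega>) * (\<integral>x. cis (- (p * x)) * u x \<partial>lborel)"
      using affi[of "\<lambda>x. cis (- (p * x)) * u x" "X \<omega>"] by (simp only: integral_mult_right_zero)
  qed
  finally show ?thesis
    by (simp add: fourier_def mult_ac)
qed

section \<open>Differentiation under the expectation and bounded random shifts\<close>

lemma schwartz_shift_integrable:
  assumes [measurable]: "X \<in> borel_measurable M" and u: "schwartz u"
  shows "integrable M (\<lambda>\<omega>. Dn n u (x + X \<omega>))"
proof -
  note schwartz_measurable[OF u, measurable]
  obtain B where "\<And>y. norm (Dn n u y) \<le> B" using schwartz_bounded[OF u] by blast
  then show ?thesis by (intro integrable_const_bound[where B=B]) auto
qed

text \<open>A bound \<open>B\<close> on the derivative of order \<open>n + 2\<close> controls the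
  Taylor remainder of \<open>Dn n u\<close> quadratically, with the same constant at every base
  point. The expectation of the remainder obeys the same bound, which makes the error of the
  difference quotient at most \<open>B * \<bar>y - x\<bar>\<close>.\<close>

lemma expectation_shift_has_vector_derivative:
  assumes X [measurable]: "X \<in> borel_measurable M" and u: "schwartz u"
  shows "((\<lambda>x. expectation (\<lambda>\<omega>. Dn n u (x + X \<omega>))) has_vector_derivative
    expectation (\<lambda>\<omega>. Dn (Suc n) u (x + X \<omega>))) (at x)"
proof -
  obtain B where B: "\<And>y. norm (Dn (Suc (Suc n)) u y) \<le> B" using schwartz_bounded[OF u] by blast
  have B0: "B \<ge> 0" using order_trans[OF norm_ge_zero B] .
  have lip: "norm (Dn (Suc n) u z - Dn (Suc n) u y) \<le> B * \<bar>z - y\<bar>" for y z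
  proof -
    have "norm (Dn (Suc n) u z - Dn (Suc n) u y) \<le> B * norm (z - y)"
    proof (rule differentiable_bound[where S=UNIV])
      show "(Dn (Suc n) u has_derivative (\<lambda>h. h *\<^sub>R Dn (Suc (Suc n)) u x)) (at x within UNIV)" for x
        using schwartz_has_vector_derivative[OF u] by (simp add: has_vector_derivative_def)
      show "onorm (\<lambda>h. h *\<^sub>R Dn (Suc (Suc n)) u x) \<le> B" for x
        using B by (intro onorm_le) (simp add: mult.commute[of B] mult_left_mono)
    qed auto
    then show ?thesis by simp
  qed
  have taylor: "norm (Dn n u z - Dn n u y - (z - y) *\<^sub>R Dn (Suc n) u y) \<le> \<bar>z - y\<bar> * (B * \<bar>z - y\<bar>)" for y z
  proof -
    have "norm (Dn n u z - Dn n u y - (z - y) *\<^sub>R Dn (Suc n) u y) \<le> norm (z - y) * (B * \<bar>z - y\<bar>)"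
    proof (rule vector_differentiable_bound_linearization[where S="closed_segment y z"])
      fix w assume "w \<in> closed_segment y z"
      then have "\<bar>w - y\<bar> \<le> \<bar>z - y\<bar>" by (auto simp: closed_segment_eq_real_ivl split: if_splits)
      then show "norm (Dn (Suc n) u w - Dn (Suc n) u y) \<le> B * \<bar>z - y\<bar>"
        using lip[of w y] mult_left_mono[OF _ B0, of "\<bar>w - y\<bar>" "\<bar>z - y\<bar>"] by simp
    qed (auto intro: has_vector_derivative_at_within schwartz_has_vector_derivative[OF u])
    then show ?thesis by simp
  qed
  have taylor_shift: "norm (Dn n u (y + w) - Dn n u (x + w) - (y - x) *\<^sub>R Dn (Suc n) u (x + w))
      \<le> \<bar>y - x\<bar> * (B * \<bar>y - x\<bar>)" for y w
    using taylor[of "y + w" "x + w"] by (simp only: add_diff_cancel_right)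
  note int = schwartz_shift_integrable[OF X u]
  let ?E = "\<lambda>n x. expectation (\<lambda>\<omega>. Dn n u (x + X \<omega>))"
  have bound: "norm (?E n y - ?E n x - (y - x) *\<^sub>R ?E (Suc n) x) \<le> \<bar>y - x\<bar> * (B * \<bar>y - x\<bar>)" for y
  proof -
    have eq: "?E n y - ?E n x - (y - x) *\<^sub>R ?E (Suc n) x
        = expectation (\<lambda>\<omega>. Dn n u (y + X \<omega>) - Dn n u (x + X \<omega>) - (y - x) *\<^sub>R Dn (Suc n) u (x + X \<omega>))"
      by (simp only: int Bochner_Integration.integral_diff Bochner_Integration.integrable_diff
        integrable_scaleR_right integral_scaleR_right)
    have "norm (?E n y - ?E n x - (y - x) *\<^sub>R ?E (Suc n) x)
        \<le> expectation (\<lambda>\<omega>. norm (Dn n u (y + X \<omega>) - Dn n u (x + X \<omega>) - (y - x) *\<^sub>R Dn (Suc n) u (x + X \<omega>)))"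
      unfolding eq by (rule integral_norm_bound)
    also have "\<dots> \<le> expectation (\<lambda>\<omega>. \<bar>y - x\<bar> * (B * \<bar>y - x\<bar>))"
    proof (rule integral_mono)
      show "integrable M (\<lambda>\<omega>. norm (Dn n u (y + X \<omega>) - Dn n u (x + X \<omega>) - (y - x) *\<^sub>R Dn (Suc n) u (x + X \<omega>)))"
        by (intro integrable_norm Bochner_Integration.integrable_diff integrable_scaleR_right int)
      show "integrable M (\<lambda>\<omega>. \<bar>y - x\<bar> * (B * \<bar>y - x\<bar>))" by (rule integrable_const)
    qed (rule taylor_shift)
    also have "\<dots> = \<bar>y - x\<bar> * (B * \<bar>y - x\<bar>)" by (simp add: prob_space)
    finally show ?thesis .
  qed
  have "((\<lambda>y. B * \<bar>y - x\<bar>) \<longlongrightarrow> B * \<bar>x - x\<bar>) (at x)"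
    by (intro tendsto_intros)
  then have "((\<lambda>y. B * \<bar>y - x\<bar>) \<longlongrightarrow> 0) (at x)" by simp
  then have "((\<lambda>y. (1 / norm (y - x)) *\<^sub>R (?E n y - (?E n x + (y - x) *\<^sub>R ?E (Suc n) x))) \<longlongrightarrow> 0) (at x)"
  proof (rule Lim_null_comparison[rotated])
    show "eventually (\<lambda>y. norm ((1 / norm (y - x)) *\<^sub>R (?E n y - (?E n x + (y - x) *\<^sub>R ?E (Suc n) x))) \<le> B * \<bar>y - x\<bar>) (at x)"
      using eventually_neq_at_within[of x]
    proof eventually_elim
      case (elim y)
      then have "norm (?E n y - (?E n x + (y - x) *\<^sub>R ?E (Suc n) x)) / \<bar>y - x\<bar> \<le> B * \<bar>y - x\<bar>"
        using bound[of y] by (simp add: pos_divide_le_eq diff_diff_eq mult.commute)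
      then show ?case by simp
    qed
  qed
  then show ?thesis
    unfolding has_vector_derivative_def
    unfolding has_derivative_at2 by (simp add: bounded_linear_scaleR_left)
qed

lemma Dn_expectation_shift:
  assumes X: "X \<in> borel_measurable M" and u: "schwartz u"
  shows "Dn n (\<lambda>x. expectation (\<lambda>\<omega>. u (x + X \<omega>))) = (\<lambda>x. expectation (\<lambda>\<omega>. Dn n u (x + X \<omega>)))"
proof (induction n)
  case (Suc n)
  have "Dn (Suc n) (\<lambda>x. expectation (\<lambda>\<omega>. u (x + X \<omega>)))
      = (\<lambda>x. vector_derivative (Dn n (\<lambda>x. expectation (\<lambda>\<omega>. u (x + X \<omega>)))) (at x))"
    by (simp add: Dn_def)
  also have "\<dots> = (\<lambda>x. expectation (\<lambda>\<omega>. Dn (Suc n) u (x + X \<omega>)))"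
    unfolding Suc.IH
    by (intro ext vector_derivative_at expectation_shift_has_vector_derivative X u)
  finally show ?case .
qed simp

text \<open>Boundedness of \<open>X\<close> preserves rapid decay: \<open>\<bar>x\<bar>\<close> is
  at most twice the maximum of \<open>\<bar>x + w\<bar>\<close> and \<open>N\<close>, so a
  polynomial weight at \<open>x\<close> is controlled by the weight at the shifted point plus a
  constant.\<close>

lemma schwartz_expectation_shift:
  assumes X [measurable]: "X \<in> borel_measurable M" and u: "schwartz u" and N: "\<And>\<omega>. \<bar>X \<omega>\<bar> \<le> N"
  shows "schwartz (\<lambda>x. expectation (\<lambda>\<omega>. u (x + X \<omega>)))"
  unfolding schwartz_def Dn_expectation_shift[OF X u]
proof (intro conjI allI)
  fix n x
  show "(\<lambda>x. expectation (\<lambda>\<omega>. Dn n u (x + X \<omega>))) differentiable at x"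
    using expectation_shift_has_vector_derivative[OF X u] by (blast intro: differentiableI_vector)
next
  fix m n
  obtain C0 where C0: "\<And>x. norm (Dn n u x) \<le> C0" using schwartz_bounded[OF u] by blast
  obtain C where C: "\<And>x. \<bar>x\<bar> ^ m * norm (Dn n u x) \<le> C"
    using u unfolding schwartz_def by blast
  have N0: "N \<ge> 0" using order_trans[OF abs_ge_zero N] .
  have pw: "\<bar>x\<bar> ^ m * norm (Dn n u (x + w)) \<le> 2 ^ m * (C + N ^ m * C0)" if "\<bar>w\<bar> \<le> N" for x w
  proof -
    have "\<bar>x\<bar> \<le> \<bar>x + w\<bar> + N" using that by linarith
    then have "\<bar>x\<bar> \<le> 2 * max \<bar>x + w\<bar> N" by (simp add: max_def)
    then have "\<bar>x\<bar> ^ m \<le> (2 * max \<bar>x + w\<bar> N) ^ m" by (intro power_mono) auto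
    also have "\<dots> = 2 ^ m * (max \<bar>x + w\<bar> N) ^ m" by (simp add: power_mult_distrib)
    also have "(max \<bar>x + w\<bar> N) ^ m \<le> \<bar>x + w\<bar> ^ m + N ^ m"
      using N0 by (auto simp: max_def)
    finally have "\<bar>x\<bar> ^ m * norm (Dn n u (x + w)) \<le> 2 ^ m * (\<bar>x + w\<bar> ^ m + N ^ m) * norm (Dn n u (x + w))"
      by (intro mult_right_mono) auto
    also have "\<dots> = 2 ^ m * (\<bar>x + w\<bar> ^ m * norm (Dn n u (x + w)) + N ^ m * norm (Dn n u (x + w)))"
      by (simp add: algebra_simps)
    also have "\<dots> \<le> 2 ^ m * (C + N ^ m * C0)"
      using N0 by (intro mult_left_mono add_mono C C0) auto
    finally show ?thesis .
  qed
  have "\<bar>x\<bar> ^ m * norm (expectation (\<lambda>\<omega>. Dn n u (x + X \<omega>))) \<le> 2 ^ m * (C + N ^ m * C0)" for x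
  proof -
    have "\<bar>x\<bar> ^ m * norm (expectation (\<lambda>\<omega>. Dn n u (x + X \<omega>)))
        \<le> \<bar>x\<bar> ^ m * expectation (\<lambda>\<omega>. norm (Dn n u (x + X \<omega>)))"
      by (intro mult_left_mono integral_norm_bound) auto
    also have "\<dots> = expectation (\<lambda>\<omega>. \<bar>x\<bar> ^ m * norm (Dn n u (x + X \<omega>)))" by simp
    also have "\<dots> \<le> expectation (\<lambda>\<omega>. 2 ^ m * (C + N ^ m * C0))"
      using pw[OF N] schwartz_shift_integrable[OF X u] by (intro integral_mono) auto
    finally show ?thesis by (simp add: prob_space)
  qed
  then show "\<exists>C. \<forall>x. \<bar>x\<bar> ^ m * norm (expectation (\<lambda>\<omega>. Dn n u (x + X \<omega>))) \<le> C" by blast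
qed

end

section \<open>The stable symbol\<close>

lemma psi_0 [simp]: "psi \<delta> \<rho> 0 = 0"
  by (simp add: psi_def)

text \<open>Restricted to nonnegative factors, since a negative one would also conjugate the
  symbol.\<close>

lemma psi_mult:
  assumes "c \<ge> 0"
  shows "psi \<delta> \<rho> (c * p) = complex_of_real (c powr \<delta>) * psi \<delta> \<rho> p"
proof (cases "c = 0")
  case False
  with assms have "c > 0" by simp
  then show ?thesis by (simp add: psi_def abs_mult powr_mult sgn_mult)
qed simp

lemma psi_symmetric: "psi \<delta> 0 p = complex_of_real (\<bar>p\<bar> powr \<delta>)"
  by (simp add: psi_def)

lemma Re_psi [simp]: "Re (psi \<delta> \<rho> p) = \<bar>p\<bar> powr \<delta>"
  by (simp add: psi_def)

text \<open>A bound, independent of \<open>p\<close>, for the second factor of the symbol. At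
  \<delta> = 1 the value \<open>tan (pi / 2)\<close> is 0 by the convention on division by zero, so
  the symbol is then \<open>\<bar>p\<bar>\<close>.\<close>

definition psi_bound :: "real \<Rightarrow> real \<Rightarrow> real" where
  "psi_bound \<delta> \<rho> = 1 + \<bar>\<rho> * tan (pi * \<delta> / 2)\<bar>"

lemma psi_bound_ge_1: "psi_bound \<delta> \<rho> \<ge> 1"
  by (simp add: psi_bound_def)

lemma norm_psi_le: "norm (psi \<delta> \<rho> p) \<le> psi_bound \<delta> \<rho> * \<bar>p\<bar> powr \<delta>"
proof -
  have "norm (1 - \<i> * complex_of_real (\<rho> * sgn p * tan (pi * \<delta> / 2)))
      \<le> norm (1::complex) + norm (\<i> * complex_of_real (\<rho> * sgn p * tan (pi * \<delta> / 2)))"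
    by (rule norm_triangle_ineq4)
  also have "\<dots> = 1 + \<bar>\<rho> * tan (pi * \<delta> / 2)\<bar> * \<bar>sgn p\<bar>"
    by (simp add: norm_mult abs_mult del: of_real_mult)
  also have "\<dots> \<le> psi_bound \<delta> \<rho>"
    by (simp add: psi_bound_def abs_sgn_eq)
  finally show ?thesis
    unfolding psi_def norm_mult by (subst mult.commute) (intro mult_mono, auto)
qed

text \<open>The only jump of \<open>sgn\<close> is at 0, where the factor
  \<open>\<bar>p\<bar> powr \<delta>\<close> suppresses it.\<close>

lemma continuous_psi:
  assumes "\<delta> > 0"
  shows "isCont (psi \<delta> \<rho>) p"
proof (cases "p = 0")
  case True
  have "((\<lambda>q. psi_bound \<delta> \<rho> * \<bar>q\<bar> powr \<delta>) \<longlongrightarrow> psi_bound \<delta> \<rho> * \<bar>0\<bar> powr \<delta>) (at (0::real))"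
    using assms by (intro tendsto_intros) auto
  then have "((\<lambda>q. psi_bound \<delta> \<rho> * \<bar>q\<bar> powr \<delta>) \<longlongrightarrow> 0) (at 0)" by simp
  then have "(psi \<delta> \<rho> \<longlongrightarrow> 0) (at 0)"
    by (rule Lim_null_comparison[rotated]) (simp add: norm_psi_le)
  with True show ?thesis by (simp add: isCont_def)
next
  case False
  then show ?thesis
    unfolding isCont_def psi_def[abs_def] by (intro tendsto_intros) auto
qed

lemma borel_measurable_psi [measurable]: "psi \<delta> \<rho> \<in> borel_measurable borel"
  unfolding psi_def[abs_def] by measurable

text \<open>By homogeneity the increment estimate reduces to \<open>\<bar>b\<bar> = 1\<close>, where it is continuity near
  \<open>b\<close> and growth away from \<open>b\<close>. It makes \<open>f \<mapsto> \<integral>\<psi>(f)\<close> continuous along \<open>L\<^sup>\<delta>\<close> convergence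
  even for \<open>\<delta> < 1\<close>, where there is no Minkowski inequality.\<close>

lemma psi_increment_bound:
  assumes \<delta>: "\<delta> > 0" and e: "e > 0"
  obtains C where "C \<ge> 0"
    "\<And>a b. norm (psi \<delta> \<rho> a - psi \<delta> \<rho> b) \<le> e * \<bar>b\<bar> powr \<delta> + C * \<bar>a - b\<bar> powr \<delta>"
proof -
  let ?T = "psi_bound \<delta> \<rho>"
  have T: "?T \<ge> 0" using psi_bound_ge_1[of \<delta> \<rho>] by simp
  have "\<exists>\<eta>>0. \<forall>a. \<bar>a - b\<bar> < \<eta> \<longrightarrow> norm (psi \<delta> \<rho> a - psi \<delta> \<rho> b) < e" for b
    using continuous_psi[OF \<delta>, where \<rho>=\<rho> and p=b, unfolded continuous_at_eps_delta] e
    by (simp add: dist_norm dist_real_def)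
  then obtain \<eta> where \<eta>: "\<And>b. \<eta> b > 0"
    "\<And>a b. \<bar>a - b\<bar> < \<eta> b \<Longrightarrow> norm (psi \<delta> \<rho> a - psi \<delta> \<rho> b) < e" by metis
  define r where "r = min (\<eta> 1) (\<eta> (-1))"
  have r: "r > 0" using \<eta>(1) by (simp add: r_def)
  \<comment> \<open>The first two summands cover the far case with
    \<open>d = \<bar>a - b\<bar> \<ge> r\<close>: there
    \<open>\<bar>a\<bar> \<le> (1 + 1 / r) * d\<close> and
    \<open>\<bar>b\<bar> = 1 \<le> d / r\<close>. The last summand covers \<open>b = 0\<close>, to
    which the scaling argument does not apply.\<close>
  define C where "C = ?T * (1 + 1 / r) powr \<delta> + ?T * (1 / r) powr \<delta> + ?T"
  have unit: "norm (psi \<delta> \<rho> a - psi \<delta> \<rho> b) \<le> e + C * \<bar>a - b\<bar> powr \<delta>" if b: "\<bar>b\<bar> = 1" for a b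
  proof (cases "\<bar>a - b\<bar> < r")
    case True
    moreover have "b = 1 \<or> b = -1" using b by linarith
    ultimately have "norm (psi \<delta> \<rho> a - psi \<delta> \<rho> b) < e"
      using \<eta>(2)[of a b] by (auto simp: r_def)
    moreover have "C * \<bar>a - b\<bar> powr \<delta> \<ge> 0" using T by (simp add: C_def)
    ultimately show ?thesis by linarith
  next
    case False
    define d where "d = \<bar>a - b\<bar>"
    have d: "1 \<le> 1 / r * d" using False r by (simp add: d_def)
    have d0: "d \<ge> 0" by (simp add: d_def)
    have "norm (psi \<delta> \<rho> a - psi \<delta> \<rho> b) \<le> norm (psi \<delta> \<rho> a) + norm (psi \<delta> \<rho> b)"
      by (rule norm_triangle_ineq4)
    also have "\<dots> \<le> ?T * \<bar>a\<bar> powr \<delta> + ?T * \<bar>b\<bar> powr \<delta>"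
      by (intro add_mono norm_psi_le)
    also have "\<dots> \<le> ?T * ((1 + 1 / r) * d) powr \<delta> + ?T * (1 / r * d) powr \<delta>"
    proof (intro add_mono mult_left_mono powr_mono2 T)
      have "\<bar>a\<bar> \<le> d + 1" using b unfolding d_def by linarith
      then show "\<bar>a\<bar> \<le> (1 + 1 / r) * d" using d unfolding distrib_right by simp
    qed (use \<delta> d b in auto)
    also have "\<dots> = ?T * (1 + 1 / r) powr \<delta> * d powr \<delta> + ?T * (1 / r) powr \<delta> * d powr \<delta>"
      using r d0 by (simp only: powr_mult mult.assoc)
    also have "\<dots> \<le> C * d powr \<delta>"
      using T by (simp add: C_def distrib_right)
    finally show ?thesis using e unfolding d_def by linarith
  qed
  show ?thesis
  proof (rule that[of C])
    show "C \<ge> 0" using T by (simp add: C_def)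
    fix a b
    show "norm (psi \<delta> \<rho> a - psi \<delta> \<rho> b) \<le> e * \<bar>b\<bar> powr \<delta> + C * \<bar>a - b\<bar> powr \<delta>"
    proof (cases "b = 0")
      case True
      have "?T * \<bar>a\<bar> powr \<delta> \<le> C * \<bar>a\<bar> powr \<delta>"
        using T by (intro mult_right_mono) (auto simp: C_def)
      then show ?thesis using norm_psi_le[of \<delta> \<rho> a] True by simp
    next
      case False
      define s where "s = \<bar>b\<bar>"
      have s: "s > 0" using False by (simp add: s_def)
      have "norm (psi \<delta> \<rho> a - psi \<delta> \<rho> b) = norm (psi \<delta> \<rho> (s * (a / s)) - psi \<delta> \<rho> (s * (b / s)))"
        using s by simp
      also have "\<dots> = s powr \<delta> * norm (psi \<delta> \<rho> (a / s) - psi \<delta> \<rho> (b / s))"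
        using s unfolding psi_mult[OF less_imp_le[OF s]] right_diff_distrib[symmetric] norm_mult by simp
      also have "\<dots> \<le> s powr \<delta> * (e + C * \<bar>a / s - b / s\<bar> powr \<delta>)"
        using False by (intro mult_left_mono unit) (auto simp: s_def abs_divide)
      also have "\<dots> = e * s powr \<delta> + C * (s powr \<delta> * \<bar>a / s - b / s\<bar> powr \<delta>)"
        by (simp add: algebra_simps)
      also have "s powr \<delta> * \<bar>a / s - b / s\<bar> powr \<delta> = \<bar>a - b\<bar> powr \<delta>"
        using s by (simp add: abs_divide powr_divide flip: diff_divide_distrib)
      finally show ?thesis by (simp add: s_def)
    qed
  qed
qed

section \<open>Stable integrals of simple functions\<close>

text \<open>Disjointness leaves at most one nonzero term, so the nonlinear symbol passes through the
  sum; off all the sets both sides vanish because \<open>psi \<delta> \<rho> 0 = 0\<close>.\<close>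

lemma psi_simple_function:
  fixes n :: nat
  assumes B: "disjoint_family_on B {..<n}"
  shows "psi \<delta> \<rho> (p * (\<Sum>i<n. a i * indicator (B i) x))
    = (\<Sum>i<n. indicator (B i) x *\<^sub>R psi \<delta> \<rho> (p * a i))"
proof (cases "\<exists>j<n. x \<in> B j")
  case True
  then obtain j where j: "j < n" "x \<in> B j" by blast
  have ind: "indicator (B i) x = (if i = j then 1 else 0 :: real)" if "i < n" for i
    using disjoint_family_onD[OF B, of i j] that j by (auto simp: indicator_def)
  have "(\<Sum>i<n. a i * indicator (B i) x) = (\<Sum>i<n. if i = j then a j else 0)"
    by (intro sum.cong) (auto simp: ind)
  also have "\<dots> = a j" using j by simp
  finally have "(\<Sum>i<n. a i * indicator (B i) x) = a j" .
  moreover have "(\<Sum>i<n. indicator (B i) x *\<^sub>R psi \<delta> \<rho> (p * a i)) = (\<Sum>i<n. if i = j then psi \<delta> \<rho> (p * a j) else 0)"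
    by (intro sum.cong) (auto simp: ind)
  moreover have "\<dots> = psi \<delta> \<rho> (p * a j)" using j by simp
  ultimately show ?thesis by simp
next
  case False
  then have "indicator (B i) x = (0 :: real)" if "i < n" for i using that by (auto simp: indicator_def)
  then show ?thesis by simp
qed

lemma
  assumes "simple_rep n B"
  shows integrable_psi_simple_function:
      "integrable lborel (\<lambda>x. psi \<delta> \<rho> (p * (\<Sum>i<n. a i * indicator (B i) x)))" (is ?int)
    and integral_psi_simple_function:
      "(\<integral>x. psi \<delta> \<rho> (p * (\<Sum>i<n. a i * indicator (B i) x)) \<partial>lborel)
        = (\<Sum>i<n. complex_of_real (measure lborel (B i)) * psi \<delta> \<rho> (p * a i))" (is ?eq)
proof -
  have B: "disjoint_family_on B {..<n}" "\<And>i. i < n \<Longrightarrow> B i \<in> sets borel"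
    "\<And>i. i < n \<Longrightarrow> emeasure lborel (B i) < \<infinity>"
    using assms by (auto simp: simple_rep_def)
  have int: "integrable lborel (\<lambda>x. indicator (B i) x *\<^sub>R psi \<delta> \<rho> (p * a i))" if "i < n" for i
    using B(2,3)[OF that] by (intro integrable_scaleR_left) auto
  have eq: "(\<lambda>x. psi \<delta> \<rho> (p * (\<Sum>i<n. a i * indicator (B i) x)))
      = (\<lambda>x. \<Sum>i<n. indicator (B i) x *\<^sub>R psi \<delta> \<rho> (p * a i))"
    using psi_simple_function[OF B(1)] by (intro ext)
  show ?int unfolding eq by (intro Bochner_Integration.integrable_sum int) simp
  have "(\<integral>x. psi \<delta> \<rho> (p * (\<Sum>i<n. a i * indicator (B i) x)) \<partial>lborel)
      = (\<Sum>i<n. \<integral>x. indicator (B i) x *\<^sub>R psi \<delta> \<rho> (p * a i) \<partial>lborel)"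
    unfolding eq by (intro Bochner_Integration.integral_sum int) simp
  also have "\<dots> = (\<Sum>i<n. complex_of_real (measure lborel (B i)) * psi \<delta> \<rho> (p * a i))"
  proof (intro sum.cong refl)
    fix i assume "i \<in> {..<n}"
    then have [measurable]: "B i \<in> sets borel" using B by auto
    have "integrable lborel (indicator (B i) :: real \<Rightarrow> real)" using \<open>i \<in> _\<close> B by auto
    then show "(\<integral>x. indicator (B i) x *\<^sub>R psi \<delta> \<rho> (p * a i) \<partial>lborel) = complex_of_real (measure lborel (B i)) * psi \<delta> \<rho> (p * a i)"
      by (simp add: integral_scaleR_left scaleR_conv_of_real)
  qed
  finally show ?eq .
qed

context prob_space
begin

lemma stable_random_measureD:
  assumes "stable_random_measure M \<delta> \<rho> Z"
  shows "A \<in> sets borel \<Longrightarrow> emeasure lborel A < \<infinity> \<Longrightarrow> Z A \<in> borel_measurable M"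
    and "A \<in> sets borel \<Longrightarrow> emeasure lborel A < \<infinity> \<Longrightarrow>
      expectation (\<lambda>\<omega>. cis (p * Z A \<omega>)) = exp (- complex_of_real (measure lborel A) * psi \<delta> \<rho> p)"
    and "(\<And>A. A \<in> \<A> \<Longrightarrow> A \<in> sets borel) \<Longrightarrow> (\<And>A. A \<in> \<A> \<Longrightarrow> emeasure lborel A < \<infinity>) \<Longrightarrow>
      disjoint \<A> \<Longrightarrow> indep_vars (\<lambda>_. borel) Z \<A>"
  using assms unfolding stable_random_measure_def by simp_all

text \<open>Countable additivity for the constant sequence of empty sets makes a constant series
  convergent, which forces its term to be 0.\<close>

lemma stable_random_measure_empty:
  assumes "stable_random_measure M \<delta> \<rho> Z"
  shows "AE \<omega> in M. Z {} \<omega> = 0"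
proof -
  have "AE \<omega> in M. (\<lambda>i::nat. Z {} \<omega>) sums Z (\<Union>i::nat. {}) \<omega>"
    using assms unfolding stable_random_measure_def
    by (elim conjE allE[where x="\<lambda>_. {}"]) (simp add: disjoint_family_on_def)
  then show ?thesis
  proof eventually_elim
    case (elim \<omega>)
    then have "(\<lambda>i::nat. Z {} \<omega>) \<longlonglongrightarrow> 0" by (intro summable_LIMSEQ_zero) (auto simp: summable_def)
    then show ?case by (simp add: LIMSEQ_const_iff)
  qed
qed

text \<open>Independence is available for a collection of disjoint sets, while the representation is
  indexed by numbers and may list the empty set several times. Restricting to the indices
  \<open>J\<close> of nonempty blocks makes \<open>B\<close> injective, and \<open>b\<close> carries
  the coefficients over to the sets. The discarded blocks contribute nothing to either side: their
  random value is almost surely 0 and their Lebesgue measure is 0.\<close>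

lemma expectation_cis_simple_stable_integral:
  assumes Z: "stable_random_measure M \<delta> \<rho> Z" and B: "simple_rep n B"
  shows "expectation (\<lambda>\<omega>. cis (p * (\<Sum>i<n. a i * Z (B i) \<omega>)))
    = exp (- (\<integral>x. psi \<delta> \<rho> (p * (\<Sum>i<n. a i * indicator (B i) x)) \<partial>lborel))"
proof -
  define J where "J = {i. i < n \<and> B i \<noteq> {}}"
  have J: "finite J" "J \<subseteq> {..<n}" by (auto simp: J_def)
  have Bs: "B i \<in> sets borel" "emeasure lborel (B i) < \<infinity>" if "i < n" for i
    using B that by (auto simp: simple_rep_def)
  have dis: "disjoint_family_on B {..<n}" using B by (simp add: simple_rep_def)
  have inj: "inj_on B J"
    using disjoint_family_onD[OF dis] by (auto simp: inj_on_def J_def)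
  have disB: "disjoint (B ` J)"
    unfolding disjoint_def using disjoint_family_onD[OF dis] J(2) by blast
  define b where "b S = a (the_inv_into J B S)" for S
  have b: "b (B i) = a i" if "i \<in> J" for i
    using the_inv_into_f_f[OF inj that] by (simp add: b_def)
  have Zm: "Z S \<in> borel_measurable M" if "S \<in> B ` J" for S
    using that Bs J(2) by (auto intro!: stable_random_measureD(1)[OF Z])
  have ind: "indep_vars (\<lambda>_. borel) Z (B ` J)"
    using disB Bs J(2) by (intro stable_random_measureD(3)[OF Z]) auto
  then have "indep_vars (\<lambda>_. borel) (\<lambda>S \<omega>. cis (p * b S * Z S \<omega>)) (B ` J)"
    by (rule indep_vars_compose2) simp
  then have "expectation (\<lambda>\<omega>. \<Prod>S\<in>B ` J. cis (p * b S * Z S \<omega>))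
      = (\<Prod>S\<in>B ` J. expectation (\<lambda>\<omega>. cis (p * b S * Z S \<omega>)))"
  proof (rule indep_vars_lebesgue_integral[rotated])
    fix S assume "S \<in> B ` J"
    from Zm[OF this] show "integrable M (\<lambda>\<omega>. cis (p * b S * Z S \<omega>))"
      by (intro integrable_const_bound[where B=1]) auto
  qed (use J in auto)
  also have "\<dots> = (\<Prod>S\<in>B ` J. exp (- complex_of_real (measure lborel S) * psi \<delta> \<rho> (p * b S)))"
  proof (intro prod.cong refl)
    fix S assume S: "S \<in> B ` J"
    then have "S \<in> sets borel" "emeasure lborel S < \<infinity>" using Bs J(2) by auto
    then show "expectation (\<lambda>\<omega>. cis (p * b S * Z S \<omega>)) = exp (- complex_of_real (measure lborel S) * psi \<delta> \<rho> (p * b S))"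
      by (rule stable_random_measureD(2)[OF Z])
  qed
  also have "\<dots> = (\<Prod>i\<in>J. exp (- complex_of_real (measure lborel (B i)) * psi \<delta> \<rho> (p * a i)))"
    by (simp add: prod.reindex[OF inj] b)
  also have "\<dots> = exp (\<Sum>i\<in>J. - complex_of_real (measure lborel (B i)) * psi \<delta> \<rho> (p * a i))"
    using J by (simp add: exp_sum)
  also have "(\<Sum>i\<in>J. - complex_of_real (measure lborel (B i)) * psi \<delta> \<rho> (p * a i))
      = (\<Sum>i<n. - complex_of_real (measure lborel (B i)) * psi \<delta> \<rho> (p * a i))"
    by (intro sum.mono_neutral_left) (auto simp: J_def)
  also have "\<dots> = - (\<integral>x. psi \<delta> \<rho> (p * (\<Sum>i<n. a i * indicator (B i) x)) \<partial>lborel)"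
    unfolding integral_psi_simple_function[OF B] by (simp add: sum_negf)
  finally have *: "expectation (\<lambda>\<omega>. \<Prod>S\<in>B ` J. cis (p * b S * Z S \<omega>))
    = exp (- (\<integral>x. psi \<delta> \<rho> (p * (\<Sum>i<n. a i * indicator (B i) x)) \<partial>lborel))" .
  have Zm': "Z (B i) \<in> borel_measurable M" if "i < n" for i
    using Bs[OF that] by (rule stable_random_measureD(1)[OF Z])
  have "expectation (\<lambda>\<omega>. cis (p * (\<Sum>i<n. a i * Z (B i) \<omega>)))
      = expectation (\<lambda>\<omega>. \<Prod>S\<in>B ` J. cis (p * b S * Z S \<omega>))"
  proof (rule integral_cong_AE)
    have "(\<lambda>\<omega>. \<Sum>i<n. a i * Z (B i) \<omega>) \<in> borel_measurable M"
      by (intro borel_measurable_sum borel_measurable_times Zm') auto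
    then show "(\<lambda>\<omega>. cis (p * (\<Sum>i<n. a i * Z (B i) \<omega>))) \<in> borel_measurable M" by measurable
    have "(\<lambda>\<omega>. cis (p * b S * Z S \<omega>)) \<in> borel_measurable M" if "S \<in> B ` J" for S
      using Zm[OF that] by measurable
    then show "(\<lambda>\<omega>. \<Prod>S\<in>B ` J. cis (p * b S * Z S \<omega>)) \<in> borel_measurable M"
      by (intro borel_measurable_prod) auto
    show "AE \<omega> in M. cis (p * (\<Sum>i<n. a i * Z (B i) \<omega>)) = (\<Prod>S\<in>B ` J. cis (p * b S * Z S \<omega>))"
      using stable_random_measure_empty[OF Z]
    proof eventually_elim
      case (elim \<omega>)
      have "(\<Sum>i<n. a i * Z (B i) \<omega>) = (\<Sum>i\<in>J. a i * Z (B i) \<omega>)"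
        using elim by (intro sum.mono_neutral_right) (auto simp: J_def)
      moreover have "(\<Prod>S\<in>B ` J. cis (p * b S * Z S \<omega>)) = (\<Prod>i\<in>J. cis (p * a i * Z (B i) \<omega>))"
        by (simp add: prod.reindex[OF inj] b)
      moreover have "\<dots> = cis (\<Sum>i\<in>J. p * a i * Z (B i) \<omega>)"
        using J(1) by (simp add: cis_conv_exp sum_distrib_left exp_sum)
      ultimately show ?case by (simp add: sum_distrib_left mult.assoc)
    qed
  qed
  with * show ?thesis by simp
qed

text \<open>Off the event \<open>e < \<bar>X - S j\<bar>\<close> the exponentials differ by at most
  \<open>\<bar>p\<bar> * e\<close>, by the Lipschitz property of \<open>cis\<close>; on that event
  they differ by at most 2.\<close>

lemma expectation_cis_tendsto:
  assumes [measurable]: "X \<in> borel_measurable M" "\<And>j. S j \<in> borel_measurable M"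
    and conv: "\<And>e. e > 0 \<Longrightarrow> (\<lambda>j::nat. prob {\<omega>\<in>space M. e < \<bar>X \<omega> - S j \<omega>\<bar>}) \<longlonglongrightarrow> 0"
  shows "(\<lambda>j. expectation (\<lambda>\<omega>. cis (p * S j \<omega>))) \<longlonglongrightarrow> expectation (\<lambda>\<omega>. cis (p * X \<omega>))"
proof (rule LIMSEQ_I)
  fix r :: real assume r: "r > 0"
  \<comment> \<open>Half of \<open>r\<close> is allotted to the Lipschitz part, the other half to
    twice a probability below \<open>r / 4\<close>. The summand 1 keeps the denominator positive for
    \<open>p = 0\<close>.\<close>
  define e where "e = r / (2 * (1 + \<bar>p\<bar>))"
  have e: "e > 0" using r by (simp add: e_def add_pos_nonneg)
  have pe: "\<bar>p\<bar> * e \<le> r / 2"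
  proof -
    have "\<bar>p\<bar> * e \<le> (1 + \<bar>p\<bar>) * e" using e by (intro mult_right_mono) auto
    also have "\<dots> = r / 2" unfolding e_def by (simp add: field_simps add_pos_nonneg)
    finally show ?thesis .
  qed
  from LIMSEQ_D[OF conv[OF e], of "r / 4"] r
  obtain N where N: "\<And>j. j \<ge> N \<Longrightarrow> prob {\<omega>\<in>space M. e < \<bar>X \<omega> - S j \<omega>\<bar>} < r / 4" by auto
  have "norm (expectation (\<lambda>\<omega>. cis (p * S j \<omega>)) - expectation (\<lambda>\<omega>. cis (p * X \<omega>))) < r" if j: "j \<ge> N" for j
  proof -
    let ?B = "{\<omega>\<in>space M. e < \<bar>X \<omega> - S j \<omega>\<bar>}"
    have i: "integrable M (\<lambda>\<omega>. cis (p * S j \<omega>))" "integrable M (\<lambda>\<omega>. cis (p * X \<omega>))"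
      by (auto intro!: integrable_const_bound[where B=1])
    have pw: "norm (cis (p * S j \<omega>) - cis (p * X \<omega>)) \<le> \<bar>p\<bar> * e + 2 * indicator ?B \<omega>" if "\<omega> \<in> space M" for \<omega>
    proof (cases "\<omega> \<in> ?B")
      case True
      have "norm (cis (p * S j \<omega>) - cis (p * X \<omega>)) \<le> norm (cis (p * S j \<omega>)) + norm (cis (p * X \<omega>))"
        by (rule norm_triangle_ineq4)
      then show ?thesis using True e by (simp add: add_increasing)
    next
      case False
      have "norm (cis (p * S j \<omega>) - cis (p * X \<omega>)) \<le> \<bar>p * S j \<omega> - p * X \<omega>\<bar>"
      proof -
        have "cis (p * S j \<omega>) - cis (p * X \<omega>) = cis (p * X \<omega>) * (cis (p * S j \<omega> - p * X \<omega>) - 1)"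
          by (simp add: right_diff_distrib cis_mult)
        then have "norm (cis (p * S j \<omega>) - cis (p * X \<omega>)) = norm (cis (p * S j \<omega> - p * X \<omega>) - 1)"
          by (simp add: norm_mult)
        also have "\<dots> \<le> \<bar>p * S j \<omega> - p * X \<omega>\<bar>"
          using iexp_approx1[of "p * S j \<omega> - p * X \<omega>" 0] by (simp add: cis_conv_exp)
        finally show ?thesis .
      qed
      also have "\<dots> = \<bar>p\<bar> * \<bar>X \<omega> - S j \<omega>\<bar>"
        by (simp add: abs_mult abs_minus_commute flip: right_diff_distrib)
      also have "\<dots> \<le> \<bar>p\<bar> * e" using False that by (intro mult_left_mono) auto
      also have "\<dots> \<le> \<bar>p\<bar> * e + 2 * indicator ?B \<omega>" by simp
      finally show ?thesis .
    qed
    have "norm (expectation (\<lambda>\<omega>. cis (p * S j \<omega>)) - expectation (\<lambda>\<omega>. cis (p * X \<omega>)))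
        = norm (expectation (\<lambda>\<omega>. cis (p * S j \<omega>) - cis (p * X \<omega>)))"
      using i by simp
    also have "\<dots> \<le> expectation (\<lambda>\<omega>. norm (cis (p * S j \<omega>) - cis (p * X \<omega>)))"
      by (rule integral_norm_bound)
    also have "\<dots> \<le> expectation (\<lambda>\<omega>. \<bar>p\<bar> * e + 2 * indicator ?B \<omega>)"
    proof (rule integral_mono)
      show "integrable M (\<lambda>\<omega>. norm (cis (p * S j \<omega>) - cis (p * X \<omega>)))" using i by simp
    qed (use pw in \<open>auto simp: less_top[symmetric]\<close>)
    also have "\<dots> = \<bar>p\<bar> * e + 2 * prob ?B"
      by (simp add: prob_space less_top[symmetric])
    also have "\<dots> < r" using N[OF j] pe by linarith
    finally show ?thesis .
  qed
  then show "\<exists>N. \<forall>j\<ge>N. norm (expectation (\<lambda>\<omega>. cis (p * S j \<omega>)) - expectation (\<lambda>\<omega>. cis (p * X \<omega>))) < r"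
    by blast
qed

end

section \<open>Characteristic functions of stable integrals\<close>

lemma integrable_psi_comp:
  assumes [measurable]: "f \<in> borel_measurable borel" and f: "integrable lborel (\<lambda>x. \<bar>f x\<bar> powr \<delta>)"
  shows "integrable lborel (\<lambda>x. psi \<delta> \<rho> (p * f x))"
proof (rule Bochner_Integration.integrable_bound)
  show "integrable lborel (\<lambda>x. psi_bound \<delta> \<rho> * (\<bar>p\<bar> powr \<delta> * \<bar>f x\<bar> powr \<delta>))"
    using f by simp
  show "AE x in lborel. norm (psi \<delta> \<rho> (p * f x)) \<le> norm (psi_bound \<delta> \<rho> * (\<bar>p\<bar> powr \<delta> * \<bar>f x\<bar> powr \<delta>))"
    using norm_psi_le[of \<delta> \<rho> "p * f _"] psi_bound_ge_1[of \<delta> \<rho>]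
    by (intro AE_I2) (simp add: abs_mult powr_mult)
qed simp

text \<open>Both claims rest on \<open>psi_increment_bound\<close>, which puts a small multiple of
  the size of the limit and a large multiple of the distance on the right. The distances tend to 0,
  so the large constant does no harm. They may be infinite for small \<open>j\<close>, hence the
  threshold \<open>N\<close>.\<close>

lemma
  fixes f :: "real \<Rightarrow> real" and F :: "nat \<Rightarrow> real \<Rightarrow> real"
  assumes \<delta>: "\<delta> > 0" and f [measurable]: "f \<in> borel_measurable borel"
    and F [measurable]: "\<And>j. F j \<in> borel_measurable borel"
    and F_int: "\<And>j. integrable lborel (\<lambda>x. \<bar>F j x\<bar> powr \<delta>)"
    and conv: "(\<lambda>j. \<integral>\<^sup>+x. ennreal (\<bar>f x - F j x\<bar> powr \<delta>) \<partial>lborel) \<longlonglongrightarrow> 0"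
  shows integrable_powr_of_approx: "integrable lborel (\<lambda>x. \<bar>f x\<bar> powr \<delta>)"
    and integral_psi_tendsto:
      "(\<lambda>j. \<integral>x. psi \<delta> \<rho> (p * F j x) \<partial>lborel) \<longlonglongrightarrow> (\<integral>x. psi \<delta> \<rho> (p * f x) \<partial>lborel)"
proof -
  have "eventually (\<lambda>j. (\<integral>\<^sup>+x. ennreal (\<bar>f x - F j x\<bar> powr \<delta>) \<partial>lborel) < 1) sequentially"
    using order_tendstoD(2)[OF conv, of 1] by simp
  then obtain N where N: "\<And>j. j \<ge> N \<Longrightarrow> (\<integral>\<^sup>+x. ennreal (\<bar>f x - F j x\<bar> powr \<delta>) \<partial>lborel) < 1"
    by (auto simp: eventually_sequentially)
  have d_int: "integrable lborel (\<lambda>x. \<bar>f x - F j x\<bar> powr \<delta>)" if "j \<ge> N" for j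
    using N[OF that] by (intro integrableI_nonneg) (auto intro: order.strict_trans)
  show f_int: "integrable lborel (\<lambda>x. \<bar>f x\<bar> powr \<delta>)"
  proof -
    \<comment> \<open>For \<rho> = 0 the symbol is the power itself, and the increment bound with
      \<open>e = 1\<close> becomes a quasi-triangle inequality valid for every \<delta> > 0.\<close>
    obtain C where C: "C \<ge> 0"
      "\<And>a b. norm (psi \<delta> 0 a - psi \<delta> 0 b) \<le> 1 * \<bar>b\<bar> powr \<delta> + C * \<bar>a - b\<bar> powr \<delta>"
      using psi_increment_bound[OF \<delta>, of 1 0] by auto
    have pw: "\<bar>a\<bar> powr \<delta> \<le> 2 * \<bar>b\<bar> powr \<delta> + C * \<bar>a - b\<bar> powr \<delta>" for a b
    proof -
      have "\<bar>\<bar>a\<bar> powr \<delta> - \<bar>b\<bar> powr \<delta>\<bar> \<le> \<bar>b\<bar> powr \<delta> + C * \<bar>a - b\<bar> powr \<delta>"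
        using C(2)[of a b] by (simp add: psi_symmetric flip: of_real_diff)
      then show ?thesis by linarith
    qed
    show ?thesis
    proof (rule Bochner_Integration.integrable_bound)
      show "integrable lborel (\<lambda>x. 2 * \<bar>F N x\<bar> powr \<delta> + C * \<bar>f x - F N x\<bar> powr \<delta>)"
        using F_int[of N] d_int[of N] by simp
      show "AE x in lborel. norm (\<bar>f x\<bar> powr \<delta>) \<le> norm (2 * \<bar>F N x\<bar> powr \<delta> + C * \<bar>f x - F N x\<bar> powr \<delta>)"
        using pw C(1) by (intro AE_I2) simp
    qed simp
  qed
  define r where "r j = (\<integral>x. \<bar>f x - F j x\<bar> powr \<delta> \<partial>lborel)" for j
  have r: "r \<longlonglongrightarrow> 0"
  proof -
    have "(\<lambda>j. enn2real (\<integral>\<^sup>+x. ennreal (\<bar>f x - F j x\<bar> powr \<delta>) \<partial>lborel)) \<longlonglongrightarrow> 0"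
      using conv by (intro tendsto_enn2real) simp_all
    moreover have "r = (\<lambda>j. enn2real (\<integral>\<^sup>+x. ennreal (\<bar>f x - F j x\<bar> powr \<delta>) \<partial>lborel))"
      unfolding r_def by (intro ext integral_eq_nn_integral) auto
    ultimately show ?thesis by simp
  qed
  define P where "P = (\<integral>x. \<bar>p * f x\<bar> powr \<delta> \<partial>lborel)"
  have P0: "P \<ge> 0" by (simp add: P_def)
  have pf_int: "integrable lborel (\<lambda>x. \<bar>p * f x\<bar> powr \<delta>)"
    using f_int by (simp add: abs_mult powr_mult)
  show "(\<lambda>j. \<integral>x. psi \<delta> \<rho> (p * F j x) \<partial>lborel) \<longlonglongrightarrow> (\<integral>x. psi \<delta> \<rho> (p * f x) \<partial>lborel)"
  proof (rule LIMSEQ_I)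
    fix s :: real assume s: "s > 0"
    \<comment> \<open>The constant \<open>C\<close> depends on \<open>e\<close>, so \<open>e\<close>
      is fixed by the size \<open>P\<close> of the limit before the index \<open>j\<close> is chosen
      to beat \<open>C\<close>.\<close>
    define e where "e = s / (2 * (1 + P))"
    have e: "e > 0" using s P0 by (simp add: e_def)
    have eP: "e * P \<le> s / 2"
    proof -
      have "e * P \<le> e * (1 + P)" using e by (intro mult_left_mono) auto
      also have "\<dots> = s / 2" using P0 by (simp add: e_def field_simps)
      finally show ?thesis .
    qed
    obtain C where C: "C \<ge> 0"
      "\<And>a b. norm (psi \<delta> \<rho> a - psi \<delta> \<rho> b) \<le> e * \<bar>b\<bar> powr \<delta> + C * \<bar>a - b\<bar> powr \<delta>"
      using psi_increment_bound[OF \<delta> e] by blast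
    have "(\<lambda>j. C * \<bar>p\<bar> powr \<delta> * r j) \<longlonglongrightarrow> C * \<bar>p\<bar> powr \<delta> * 0"
      by (intro tendsto_intros r)
    then have "eventually (\<lambda>j. C * \<bar>p\<bar> powr \<delta> * r j < s / 2) sequentially"
      using s by (intro order_tendstoD(2)) auto
    then obtain N' where N': "\<And>j. j \<ge> N' \<Longrightarrow> C * \<bar>p\<bar> powr \<delta> * r j < s / 2"
      by (auto simp: eventually_sequentially)
    have "norm ((\<integral>x. psi \<delta> \<rho> (p * F j x) \<partial>lborel) - (\<integral>x. psi \<delta> \<rho> (p * f x) \<partial>lborel)) < s"
      if j: "j \<ge> max N N'" for j
    proof -
      have i: "integrable lborel (\<lambda>x. psi \<delta> \<rho> (p * F j x))" "integrable lborel (\<lambda>x. psi \<delta> \<rho> (p * f x))"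
        using F_int f_int by (auto intro!: integrable_psi_comp)
      have dj: "integrable lborel (\<lambda>x. \<bar>f x - F j x\<bar> powr \<delta>)" using j by (intro d_int) simp
      have "norm ((\<integral>x. psi \<delta> \<rho> (p * F j x) \<partial>lborel) - (\<integral>x. psi \<delta> \<rho> (p * f x) \<partial>lborel))
          = norm (\<integral>x. psi \<delta> \<rho> (p * F j x) - psi \<delta> \<rho> (p * f x) \<partial>lborel)"
        using i by simp
      also have "\<dots> \<le> (\<integral>x. norm (psi \<delta> \<rho> (p * F j x) - psi \<delta> \<rho> (p * f x)) \<partial>lborel)"
        by (rule integral_norm_bound)
      also have "\<dots> \<le> (\<integral>x. e * \<bar>p * f x\<bar> powr \<delta> + C * \<bar>p\<bar> powr \<delta> * \<bar>f x - F j x\<bar> powr \<delta> \<partial>lborel)"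
      proof (rule integral_mono)
        show "integrable lborel (\<lambda>x. norm (psi \<delta> \<rho> (p * F j x) - psi \<delta> \<rho> (p * f x)))" using i by simp
        show "integrable lborel (\<lambda>x. e * \<bar>p * f x\<bar> powr \<delta> + C * \<bar>p\<bar> powr \<delta> * \<bar>f x - F j x\<bar> powr \<delta>)"
          using pf_int dj by simp
        fix x
        have "\<bar>p * F j x - p * f x\<bar> powr \<delta> = \<bar>p\<bar> powr \<delta> * \<bar>f x - F j x\<bar> powr \<delta>"
          by (simp add: abs_mult powr_mult abs_minus_commute flip: right_diff_distrib)
        then show "norm (psi \<delta> \<rho> (p * F j x) - psi \<delta> \<rho> (p * f x))
            \<le> e * \<bar>p * f x\<bar> powr \<delta> + C * \<bar>p\<bar> powr \<delta> * \<bar>f x - F j x\<bar> powr \<delta>"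
          using C(2)[of "p * F j x" "p * f x"] by (simp add: mult.assoc)
      qed
      also have "\<dots> = e * P + C * \<bar>p\<bar> powr \<delta> * r j"
        using pf_int dj by (simp add: P_def r_def)
      also have "\<dots> < s" using N'[of j] j eP by simp
      finally show ?thesis .
    qed
    then show "\<exists>N. \<forall>j\<ge>N. norm ((\<integral>x. psi \<delta> \<rho> (p * F j x) \<partial>lborel) - (\<integral>x. psi \<delta> \<rho> (p * f x) \<partial>lborel)) < s"
      by blast
  qed
qed

context prob_space
begin

text \<open>Along the simple approximations the exponents converge by
  \<open>integral_psi_tendsto\<close> and the characteristic functions by convergence in
  probability; the two limits are then compared. Finiteness of the \<delta>-integral of
  \<open>f\<close> is inherited from the approximations rather than computed.\<close>

lemma
  assumes \<delta>: "\<delta> > 0" and Z: "stable_random_measure M \<delta> \<rho> Z" and I: "is_stable_integral M Z \<delta> f X"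
    and f [measurable]: "f \<in> borel_measurable borel"
  shows stable_integral_integrable: "integrable lborel (\<lambda>x. \<bar>f x\<bar> powr \<delta>)"
    and expectation_cis_stable_integral:
      "expectation (\<lambda>\<omega>. cis (p * X \<omega>)) = exp (- (\<integral>x. psi \<delta> \<rho> (p * f x) \<partial>lborel))"
proof -
  from I obtain N :: "nat \<Rightarrow> nat" and a B where X: "X \<in> borel_measurable M"
    and B: "\<And>j. simple_rep (N j) (B j)"
    and conv: "(\<lambda>j. \<integral>\<^sup>+x. ennreal (\<bar>f x - (\<Sum>i<N j. a j i * indicator (B j i) x)\<bar> powr \<delta>) \<partial>lborel) \<longlonglongrightarrow> 0"
    and prob: "\<And>e. e > 0 \<Longrightarrow>
      (\<lambda>j. prob {\<omega>\<in>space M. e < \<bar>X \<omega> - (\<Sum>i<N j. a j i * Z (B j i) \<omega>)\<bar>}) \<longlonglongrightarrow> 0"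
    unfolding is_stable_integral_def by blast
  define F where "F j x = (\<Sum>i<N j. a j i * indicator (B j i) x)" for j x
  define S where "S j \<omega> = (\<Sum>i<N j. a j i * Z (B j i) \<omega>)" for j \<omega>
  have Bs: "B j i \<in> sets borel" "emeasure lborel (B j i) < \<infinity>" if "i < N j" for i j
    using B[of j] that by (auto simp: simple_rep_def)
  have F: "F j \<in> borel_measurable borel" for j
    unfolding F_def[abs_def] using Bs
    by (intro borel_measurable_sum borel_measurable_times borel_measurable_const borel_measurable_indicator) auto
  have S: "S j \<in> borel_measurable M" for j
    unfolding S_def[abs_def] using Bs
    by (intro borel_measurable_sum borel_measurable_times borel_measurable_const stable_random_measureD(1)[OF Z]) auto
  have F_int: "integrable lborel (\<lambda>x. \<bar>F j x\<bar> powr \<delta>)" for j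
  proof -
    have "integrable lborel (\<lambda>x. psi \<delta> 0 (1 * F j x))"
      unfolding F_def by (rule integrable_psi_simple_function[OF B])
    from integrable_Re[OF this] show ?thesis by simp
  qed
  note conv' = conv[folded F_def]
  show "integrable lborel (\<lambda>x. \<bar>f x\<bar> powr \<delta>)"
    by (rule integrable_powr_of_approx[OF \<delta> f F F_int conv'])
  have "(\<lambda>j. exp (- (\<integral>x. psi \<delta> \<rho> (p * F j x) \<partial>lborel))) \<longlonglongrightarrow> exp (- (\<integral>x. psi \<delta> \<rho> (p * f x) \<partial>lborel))"
    by (intro tendsto_intros integral_psi_tendsto[OF \<delta> f F F_int conv'])
  moreover have "expectation (\<lambda>\<omega>. cis (p * S j \<omega>)) = exp (- (\<integral>x. psi \<delta> \<rho> (p * F j x) \<partial>lborel))" for j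
    unfolding S_def F_def by (rule expectation_cis_simple_stable_integral[OF Z B])
  moreover have "(\<lambda>j. expectation (\<lambda>\<omega>. cis (p * S j \<omega>))) \<longlonglongrightarrow> expectation (\<lambda>\<omega>. cis (p * X \<omega>))"
    using prob by (intro expectation_cis_tendsto X S) (simp add: S_def)
  ultimately show "expectation (\<lambda>\<omega>. cis (p * X \<omega>)) = exp (- (\<integral>x. psi \<delta> \<rho> (p * f x) \<partial>lborel))"
    by (simp add: LIMSEQ_unique)
qed

end

section \<open>Linear fractional stable motion\<close>

lemma borel_measurable_pospow [measurable]:
  assumes [measurable]: "f \<in> borel_measurable M"
  shows "(\<lambda>x. pospow (f x) a) \<in> borel_measurable M"
  unfolding pospow_def by measurable

lemma borel_measurable_lfsm_kernel [measurable]: "lfsm_kernel \<delta> H t \<in> borel_measurable borel"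
  unfolding lfsm_kernel_def[abs_def] by measurable

lemma pospow_mult: "t > 0 \<Longrightarrow> pospow (t * y) a = t powr a * pospow y a"
  by (auto simp: pospow_def powr_mult zero_less_mult_iff)

lemma lfsm_kernel_scale:
  assumes "t > 0"
  shows "lfsm_kernel \<delta> H t (t * x) = t powr (H - 1 / \<delta>) * lfsm_kernel \<delta> H 1 x"
proof -
  have "pospow (t - t * x) (H - 1 / \<delta>) = t powr (H - 1 / \<delta>) * pospow (1 - x) (H - 1 / \<delta>)"
    using pospow_mult[OF assms, of "1 - x"] by (simp add: right_diff_distrib)
  moreover have "pospow (- (t * x)) (H - 1 / \<delta>) = t powr (H - 1 / \<delta>) * pospow (- x) (H - 1 / \<delta>)"
    using pospow_mult[OF assms, of "- x"] by simp
  ultimately show ?thesis by (simp add: lfsm_kernel_def right_diff_distrib)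
qed

lemma lfsm_kernel_0 [simp]: "lfsm_kernel \<delta> H 0 x = 0"
  by (simp add: lfsm_kernel_def)

text \<open>The substitution by \<open>t * x\<close> contributes a factor \<open>t\<close>, and
  homogeneity of kernel and symbol contributes \<open>t powr (\<delta> * H - 1)\<close>. At
  \<open>t = 0\<close> both sides vanish, since the kernel does and
  \<open>0 powr (\<delta> * H)\<close> is 0.\<close>

lemma integral_psi_lfsm_kernel_scale:
  assumes "\<delta> > 0" "H > 0" "t \<ge> 0"
  shows "(\<integral>x. psi \<delta> \<rho> (p * lfsm_kernel \<delta> H t x) \<partial>lborel)
    = complex_of_real (t powr (\<delta> * H)) * (\<integral>x. psi \<delta> \<rho> (p * lfsm_kernel \<delta> H 1 x) \<partial>lborel)"
proof (cases "t = 0")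
  case False
  with assms have t: "t > 0" by simp
  have "(\<integral>x. psi \<delta> \<rho> (p * lfsm_kernel \<delta> H t x) \<partial>lborel)
      = \<bar>t\<bar> *\<^sub>R (\<integral>x. psi \<delta> \<rho> (p * lfsm_kernel \<delta> H t (0 + t * x)) \<partial>lborel)"
    using t by (intro lborel_integral_real_affine) simp
  also have "(\<lambda>x. psi \<delta> \<rho> (p * lfsm_kernel \<delta> H t (0 + t * x)))
      = (\<lambda>x. complex_of_real ((t powr (H - 1 / \<delta>)) powr \<delta>) * psi \<delta> \<rho> (p * lfsm_kernel \<delta> H 1 x))"
  proof
    fix x
    have "p * lfsm_kernel \<delta> H t (0 + t * x) = t powr (H - 1 / \<delta>) * (p * lfsm_kernel \<delta> H 1 x)"
      using lfsm_kernel_scale[OF t] by (simp add: mult.left_commute)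
    then show "psi \<delta> \<rho> (p * lfsm_kernel \<delta> H t (0 + t * x))
        = complex_of_real ((t powr (H - 1 / \<delta>)) powr \<delta>) * psi \<delta> \<rho> (p * lfsm_kernel \<delta> H 1 x)"
      by (simp only: psi_mult powr_ge_zero)
  qed
  also have "\<bar>t\<bar> *\<^sub>R (\<integral>x. complex_of_real ((t powr (H - 1 / \<delta>)) powr \<delta>) * psi \<delta> \<rho> (p * lfsm_kernel \<delta> H 1 x) \<partial>lborel)
      = complex_of_real (t * (t powr (H - 1 / \<delta>)) powr \<delta>) * (\<integral>x. psi \<delta> \<rho> (p * lfsm_kernel \<delta> H 1 x) \<partial>lborel)"
    using t by (simp add: scaleR_conv_of_real)
  also have "t * (t powr (H - 1 / \<delta>)) powr \<delta> = t powr (\<delta> * H)"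
  proof -
    have "t * (t powr (H - 1 / \<delta>)) powr \<delta> = t powr 1 * t powr ((H - 1 / \<delta>) * \<delta>)"
      using t by (simp add: powr_powr)
    also have "\<dots> = t powr (1 + (H - 1 / \<delta>) * \<delta>)" by (simp only: powr_add)
    also have "1 + (H - 1 / \<delta>) * \<delta> = \<delta> * H" using assms by (simp add: field_simps)
    finally show ?thesis .
  qed
  finally show ?thesis .
qed (use assms in simp)

text \<open>The part of the \<delta>-integral of the time-1 kernel that comes from the negative
  half-line, reflected to the positive one. It is the integral inside
  \<open>K_const\<close>.\<close>

definition lfsm_tail :: "real \<Rightarrow> real \<Rightarrow> real" where
  "lfsm_tail \<delta> H = (\<integral>x\<in>{0<..}. \<bar>(1 + x) powr (H - 1 / \<delta>) - x powr (H - 1 / \<delta>)\<bar> powr \<delta> \<partial>lborel)"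

lemma lfsm_tail_nonneg: "lfsm_tail \<delta> H \<ge> 0"
  unfolding lfsm_tail_def set_lebesgue_integral_def by (intro integral_nonneg_AE) auto

text \<open>The ratio of \<open>\<integral>sgn(f)\<bar>f\<bar>\<^sup>\<delta>\<close> to \<open>\<integral>\<bar>f\<bar>\<^sup>\<delta>\<close> for the kernel \<open>f\<close> at time 1: it is the
  factor by which the kernel changes the skewness.\<close>

definition lfsm_skew :: "real \<Rightarrow> real \<Rightarrow> real" where
  "lfsm_skew \<delta> H = (1 / (\<delta> * H) + sgn (H - 1 / \<delta>) * lfsm_tail \<delta> H) / (1 / (\<delta> * H) + lfsm_tail \<delta> H)"

lemma K_const_pos:
  assumes "\<delta> > 0" "H > 0"
  shows "K_const \<delta> H > 0" "K_const \<delta> H powr \<delta> = 1 / (\<delta> * H) + lfsm_tail \<delta> H"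
proof -
  have "lfsm_tail \<delta> H + 1 / (\<delta> * H) > 0"
    using lfsm_tail_nonneg[of \<delta> H] assms by (intro add_nonneg_pos) auto
  then show "K_const \<delta> H > 0" "K_const \<delta> H powr \<delta> = 1 / (\<delta> * H) + lfsm_tail \<delta> H"
    unfolding K_const_def lfsm_tail_def[symmetric] using assms by (simp_all add: powr_powr add.commute)
qed

text \<open>One computation serves both functionals: \<open>\<bar>y\<bar> powr \<delta>\<close> with
  \<open>c = 1\<close>, and its product with \<open>sgn y\<close>, where \<open>c\<close> is the
  sign of the exponent. After reflection the line splits into three pieces: the past, where
  \<open>\<phi>\<close> of the kernel is \<open>c\<close> times the absolute power; a unit interval,
  where the kernel is a single positive power; and the rest, where it vanishes.\<close>

lemma integral_lfsm_kernel:
  fixes \<phi> :: "real \<Rightarrow> real"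
  assumes \<delta>: "\<delta> > 0" and H: "H > 0"
    and int: "integrable lborel (\<lambda>x. \<bar>lfsm_kernel \<delta> H 1 x\<bar> powr \<delta>)"
    and [measurable]: "\<phi> \<in> borel_measurable borel"
    and \<phi>0: "\<phi> 0 = 0" and \<phi>_pos: "\<And>y. y > 0 \<Longrightarrow> \<phi> y = y powr \<delta>"
    and \<phi>_tail: "\<And>x. x > 0 \<Longrightarrow> \<phi> ((1 + x) powr (H - 1 / \<delta>) - x powr (H - 1 / \<delta>))
        = c * \<bar>(1 + x) powr (H - 1 / \<delta>) - x powr (H - 1 / \<delta>)\<bar> powr \<delta>"
  shows "(\<integral>x. \<phi> (lfsm_kernel \<delta> H 1 x) \<partial>lborel) = 1 / (\<delta> * H) + c * lfsm_tail \<delta> H"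
proof -
  let ?a = "H - 1 / \<delta>"
  let ?g = "\<lambda>x. \<bar>(1 + x) powr ?a - x powr ?a\<bar> powr \<delta>"
  have int': "integrable lborel (\<lambda>x. \<bar>lfsm_kernel \<delta> H 1 (0 + (-1) * x)\<bar> powr \<delta>)"
    using int by (rule lborel_integrable_real_affine) simp
  have "integrable lborel (\<lambda>x. indicator {0<..} x *\<^sub>R \<bar>lfsm_kernel \<delta> H 1 (0 + (-1) * x)\<bar> powr \<delta>)"
    by (rule integrable_mult_indicator[OF _ int']) simp
  also have "(\<lambda>x. indicator {0<..} x *\<^sub>R \<bar>lfsm_kernel \<delta> H 1 (0 + (-1) * x)\<bar> powr \<delta>) = (\<lambda>x. indicator {0<..} x *\<^sub>R ?g x)"
    by (auto simp: lfsm_kernel_def pospow_def indicator_def)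
  finally have i1: "integrable lborel (\<lambda>x. indicator {0<..} x *\<^sub>R ?g x)" .
  have "integrable lborel (\<lambda>x. indicator {0..<1} x *\<^sub>R \<bar>lfsm_kernel \<delta> H 1 x\<bar> powr \<delta>)"
    by (rule integrable_mult_indicator[OF _ int]) simp
  also have "(\<lambda>x. indicator {0..<1} x *\<^sub>R \<bar>lfsm_kernel \<delta> H 1 x\<bar> powr \<delta>) = (\<lambda>x. indicator {0..<1} x *\<^sub>R (1 - x) powr (?a * \<delta>))"
    by (auto simp: lfsm_kernel_def pospow_def indicator_def powr_powr)
  finally have i2: "integrable lborel (\<lambda>x. indicator {0..<1} x *\<^sub>R (1 - x) powr (?a * \<delta>))" .
  from lborel_integrable_real_affine[OF this, of "-1" 1]
  have "integrable lborel (\<lambda>x. indicator {0..<1} (1 + -1 * x) *\<^sub>R (1 - (1 + -1 * x)) powr (?a * \<delta>))" by simp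
  also have "(\<lambda>x::real. indicator {0..<1} (1 + -1 * x) *\<^sub>R (1 - (1 + -1 * x)) powr (?a * \<delta>)) = (\<lambda>x. indicator {0<..1} x *\<^sub>R x powr (?a * \<delta>))"
    by (auto simp: indicator_def)
  finally have i3: "set_integrable lborel {0<..1} (\<lambda>x. x powr (?a * \<delta>))"
    by (simp add: set_integrable_def)
  \<comment> \<open>Positivity of \<open>\<delta> * H\<close> makes the singularity at the end of
    the unit interval integrable, and it produces the summand
    \<open>1 / (\<delta> * H)\<close>.\<close>
  have a1: "?a * \<delta> + 1 = \<delta> * H" using \<delta> by (simp add: field_simps)
  have "((\<lambda>x. x powr (?a * \<delta>)) has_integral (1 powr (?a * \<delta> + 1) / (?a * \<delta> + 1))) {0..1}"
    using a1 \<delta> H mult_pos_pos[OF \<delta> H] by (intro has_integral_powr_from_0) linarith+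
  then have "((\<lambda>x. x powr (?a * \<delta>)) has_integral (1 / (\<delta> * H))) {0..1}" unfolding a1 by simp
  moreover have "((\<lambda>x. x powr (?a * \<delta>)) has_integral (1 / (\<delta> * H))) {0<..1} \<longleftrightarrow>
      ((\<lambda>x. x powr (?a * \<delta>)) has_integral (1 / (\<delta> * H))) {0..1}"
    by (rule has_integral_spike_set_eq; rule negligible_subset[of "{0}"]) auto
  ultimately have "(\<integral>x\<in>{0<..1}. x powr (?a * \<delta>) \<partial>lborel) = 1 / (\<delta> * H)"
    using set_borel_integral_eq_integral(2)[OF i3] by (simp add: integral_unique)
  then have v3: "(\<integral>x. indicator {0<..1} x *\<^sub>R x powr (?a * \<delta>) \<partial>lborel) = 1 / (\<delta> * H)"
    by (simp add: set_lebesgue_integral_def)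
  have "(\<integral>x. indicator {0..<1} x *\<^sub>R (1 - x) powr (?a * \<delta>) \<partial>lborel)
     = \<bar>-1\<bar> *\<^sub>R (\<integral>x. indicator {0..<1} (1 + -1 * x) *\<^sub>R (1 - (1 + -1 * x)) powr (?a * \<delta>) \<partial>lborel)"
    by (intro lborel_integral_real_affine) simp
  also have "(\<lambda>x::real. indicator {0..<1} (1 + -1 * x) *\<^sub>R (1 - (1 + -1 * x)) powr (?a * \<delta>)) = (\<lambda>x. indicator {0<..1} x *\<^sub>R x powr (?a * \<delta>))"
    by (auto simp: indicator_def)
  finally have v2: "(\<integral>x. indicator {0..<1} x *\<^sub>R (1 - x) powr (?a * \<delta>) \<partial>lborel) = 1 / (\<delta> * H)"
    using v3 by simp
  have i2': "integrable lborel (\<lambda>x::real. indicator {0..<1} (- x) *\<^sub>R (1 - (- x)) powr (?a * \<delta>))"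
    using lborel_integrable_real_affine[OF i2, of "-1" 0] by simp
  have v2': "(\<integral>x. indicator {0..<1} (- x) *\<^sub>R (1 - (- x)) powr (?a * \<delta>) \<partial>(lborel :: real measure)) = 1 / (\<delta> * H)"
    using v2 lborel_integral_real_affine[of "-1" "\<lambda>x::real. indicator {0..<1} x *\<^sub>R (1 - x) powr (?a * \<delta>)" 0] by simp
  have "(\<integral>x. \<phi> (lfsm_kernel \<delta> H 1 x) \<partial>lborel) = \<bar>-1\<bar> *\<^sub>R (\<integral>x. \<phi> (lfsm_kernel \<delta> H 1 (0 + -1 * x)) \<partial>lborel)"
    by (intro lborel_integral_real_affine) simp
  also have "(\<lambda>x. \<phi> (lfsm_kernel \<delta> H 1 (0 + -1 * x)))
      = (\<lambda>x. indicator {0..<1} (- x) *\<^sub>R (1 - (- x)) powr (?a * \<delta>) + c * (indicator {0<..} x *\<^sub>R ?g x))"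
  proof
    fix x :: real
    consider "x > 0" | "x \<le> 0" "x > -1" | "x \<le> -1" by linarith
    then show "\<phi> (lfsm_kernel \<delta> H 1 (0 + -1 * x))
      = indicator {0..<1} (- x) *\<^sub>R (1 - (- x)) powr (?a * \<delta>) + c * (indicator {0<..} x *\<^sub>R ?g x)"
    proof cases
      case 1
      then show ?thesis using \<phi>_tail[OF 1] by (simp add: lfsm_kernel_def pospow_def)
    next
      case 2
      then have "lfsm_kernel \<delta> H 1 (0 + -1 * x) = (1 + x) powr ?a"
        by (simp add: lfsm_kernel_def pospow_def)
      then have "\<phi> (lfsm_kernel \<delta> H 1 (0 + -1 * x)) = ((1 + x) powr ?a) powr \<delta>"
        using 2 \<phi>_pos by simp
      then show ?thesis using 2 by (simp add: powr_powr)
    next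
      case 3
      then show ?thesis using \<phi>0 by (simp add: lfsm_kernel_def pospow_def)
    qed
  qed
  also have "(\<integral>x. indicator {0..<1} (- x) *\<^sub>R (1 - (- x)) powr (?a * \<delta>) + c * (indicator {0<..} x *\<^sub>R ?g x) \<partial>lborel)
     = 1 / (\<delta> * H) + c * lfsm_tail \<delta> H"
    unfolding lfsm_tail_def set_lebesgue_integral_def v2'[symmetric]
    by (subst Bochner_Integration.integral_add) (use i1 i2' in \<open>simp_all only: integrable_mult_right integral_mult_right_zero\<close>)
  finally show ?thesis by simp
qed

text \<open>The even part of the symbol integrates \<open>\<bar>f\<bar> powr \<delta>\<close>, the
  odd part the signed power. Dividing by \<open>K_const\<close> normalises the first integral to 1,
  so the second appears divided by the first, and that quotient multiplies the skewness.\<close>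

lemma integral_psi_lfsm_kernel:
  assumes \<delta>: "\<delta> > 0" and H: "H > 0"
    and int: "integrable lborel (\<lambda>x. \<bar>lfsm_kernel \<delta> H 1 x\<bar> powr \<delta>)"
    and skew: "\<rho> = 0 \<or> H \<noteq> 1 / \<delta>"
  shows "(\<integral>x. psi \<delta> \<rho> (p / K_const \<delta> H * lfsm_kernel \<delta> H 1 x) \<partial>lborel) = psi \<delta> (\<rho> * lfsm_skew \<delta> H) p"
proof -
  let ?f = "lfsm_kernel \<delta> H 1" and ?a = "H - 1 / \<delta>" and ?K = "K_const \<delta> H"
  let ?P = "1 / (\<delta> * H) + lfsm_tail \<delta> H" and ?S = "1 / (\<delta> * H) + sgn ?a * lfsm_tail \<delta> H"
  have P: "(\<integral>x. \<bar>?f x\<bar> powr \<delta> \<partial>lborel) = ?P"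
    using integral_lfsm_kernel[OF \<delta> H int, where \<phi>="\<lambda>y. \<bar>y\<bar> powr \<delta>" and c=1] by simp
  \<comment> \<open>Kept multiplied by \<rho>, so that the symmetric case asks nothing about the
    sign of the kernel. Otherwise the exponent is nonzero, powers are strictly monotone, and the
    kernel has one sign on the whole negative half-line.\<close>
  have S: "\<rho> * (\<integral>x. sgn (?f x) * \<bar>?f x\<bar> powr \<delta> \<partial>lborel) = \<rho> * ?S"
  proof (cases "\<rho> = 0")
    case False
    with skew have a: "?a \<noteq> 0" by simp
    have "(\<integral>x. sgn (?f x) * \<bar>?f x\<bar> powr \<delta> \<partial>lborel) = ?S"
    proof (rule integral_lfsm_kernel[OF \<delta> H int])
      fix x :: real assume x: "x > 0"
      have "sgn ((1 + x) powr ?a - x powr ?a) = sgn ?a"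
      proof (cases "?a > 0")
        case True
        then have "x powr ?a < (1 + x) powr ?a" using x by (intro powr_less_mono2) auto
        then show ?thesis using True by simp
      next
        case False
        with a have "?a < 0" by simp
        then have "(1 + x) powr ?a < x powr ?a" using x by (intro powr_less_mono2_neg) auto
        then show ?thesis using \<open>?a < 0\<close> by simp
      qed
      then show "sgn ((1 + x) powr ?a - x powr ?a) * \<bar>(1 + x) powr ?a - x powr ?a\<bar> powr \<delta>
          = sgn ?a * \<bar>(1 + x) powr ?a - x powr ?a\<bar> powr \<delta>" by simp
    qed auto
    then show ?thesis by simp
  qed simp
  have iS: "integrable lborel (\<lambda>x. sgn (?f x) * \<bar>?f x\<bar> powr \<delta>)"
    by (rule Bochner_Integration.integrable_bound[OF int]) (auto simp: abs_mult abs_sgn_eq)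
  have K: "?K > 0" "?K powr \<delta> = ?P" using K_const_pos[OF \<delta> H] by auto
  have Ppos: "?P > 0" using K by (metis powr_gt_zero less_irrefl)
  let ?T = "tan (pi * \<delta> / 2)" and ?q = "p / ?K"
  have "psi \<delta> \<rho> (?q * ?f x) = complex_of_real (\<bar>?q\<bar> powr \<delta>) * (complex_of_real (\<bar>?f x\<bar> powr \<delta>)
      - \<i> * complex_of_real (\<rho> * sgn ?q * ?T) * complex_of_real (sgn (?f x) * \<bar>?f x\<bar> powr \<delta>))" for x
    unfolding psi_def abs_mult sgn_mult powr_mult of_real_mult by (simp add: algebra_simps)
  then have "(\<integral>x. psi \<delta> \<rho> (?q * ?f x) \<partial>lborel)
      = complex_of_real (\<bar>?q\<bar> powr \<delta>) * ((\<integral>x. complex_of_real (\<bar>?f x\<bar> powr \<delta>) \<partial>lborel)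
      - (\<integral>x. \<i> * complex_of_real (\<rho> * sgn ?q * ?T) * complex_of_real (sgn (?f x) * \<bar>?f x\<bar> powr \<delta>) \<partial>lborel))"
    using int iS by (simp only: integral_mult_right_zero Bochner_Integration.integral_diff integrable_of_real integrable_mult_right)
  also have "\<dots> = complex_of_real (\<bar>?q\<bar> powr \<delta>) * (complex_of_real ?P
      - \<i> * complex_of_real (\<rho> * sgn ?q * ?T) * complex_of_real (\<integral>x. sgn (?f x) * \<bar>?f x\<bar> powr \<delta> \<partial>lborel))"
    by (simp only: integral_mult_right_zero integral_complex_of_real P)
  also have "\<dots> = complex_of_real (\<bar>p\<bar> powr \<delta> / ?P) *
      (complex_of_real ?P - \<i> * complex_of_real (\<rho> * ?S * sgn p * ?T))"
  proof -
    let ?I = "\<integral>x. sgn (?f x) * \<bar>?f x\<bar> powr \<delta> \<partial>lborel"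
    have sgn: "sgn ?q = sgn p" using K by (simp add: sgn_divide)
    have abs: "\<bar>?q\<bar> powr \<delta> = \<bar>p\<bar> powr \<delta> / ?P"
      using K by (simp add: abs_divide powr_divide)
    have "\<rho> * sgn p * ?T * ?I = (\<rho> * ?I) * sgn p * ?T" by simp
    also have "\<dots> = \<rho> * ?S * sgn p * ?T" by (simp only: S)
    finally show ?thesis
      unfolding sgn abs mult.assoc[of \<i>] of_real_mult[symmetric] by (simp only:)
  qed
  also have "\<dots> = psi \<delta> (\<rho> * lfsm_skew \<delta> H) p"
  proof -
    have "complex_of_real (u / P) * (complex_of_real P - \<i> * complex_of_real (\<rho> * S * s * T))
        = complex_of_real u * (1 - \<i> * complex_of_real (\<rho> * (S / P) * s * T))" if "P > 0" for u P S s T :: real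
      using that by (simp add: complex_eq_iff)
    from this[OF Ppos] show ?thesis unfolding psi_def lfsm_skew_def .
  qed
  finally show ?thesis .
qed

context prob_space
begin

lemma
  assumes \<delta>: "\<delta> > 0" and H: "H > 0" and Y: "is_lfsm M \<delta> \<rho> H Y" and t: "t \<ge> 0"
  shows lfsm_measurable: "Y t \<in> borel_measurable M"
    and expectation_cis_lfsm: "\<rho> = 0 \<or> H \<noteq> 1 / \<delta> \<Longrightarrow>
      expectation (\<lambda>\<omega>. cis (p * Y t \<omega>))
        = exp (- (complex_of_real (t powr (\<delta> * H)) * psi \<delta> (\<rho> * lfsm_skew \<delta> H) p))"
proof -
  obtain Z where Z: "stable_random_measure M \<delta> \<rho> Z"
    and I: "\<And>t. t \<ge> 0 \<Longrightarrow> is_stable_integral M Z \<delta> (lfsm_kernel \<delta> H t) (\<lambda>\<omega>. K_const \<delta> H * Y t \<omega>)"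
    using Y unfolding is_lfsm_def by blast
  have K: "K_const \<delta> H > 0" by (rule K_const_pos[OF \<delta> H])
  have "(\<lambda>\<omega>. K_const \<delta> H * Y t \<omega>) \<in> borel_measurable M"
    using I[OF t] unfolding is_stable_integral_def by simp
  then have "(\<lambda>\<omega>. (1 / K_const \<delta> H) * (K_const \<delta> H * Y t \<omega>)) \<in> borel_measurable M"
    by (rule borel_measurable_times[OF borel_measurable_const])
  also have "(\<lambda>\<omega>. (1 / K_const \<delta> H) * (K_const \<delta> H * Y t \<omega>)) = Y t" using K by auto
  finally show "Y t \<in> borel_measurable M" .
  assume skew: "\<rho> = 0 \<or> H \<noteq> 1 / \<delta>"
  have int: "integrable lborel (\<lambda>x. \<bar>lfsm_kernel \<delta> H 1 x\<bar> powr \<delta>)"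
    by (rule stable_integral_integrable[OF \<delta> Z I]) simp_all
  have "expectation (\<lambda>\<omega>. cis (p * Y t \<omega>)) = expectation (\<lambda>\<omega>. cis (p / K_const \<delta> H * (K_const \<delta> H * Y t \<omega>)))"
    using K by simp
  also have "\<dots> = exp (- (\<integral>x. psi \<delta> \<rho> (p / K_const \<delta> H * lfsm_kernel \<delta> H t x) \<partial>lborel))"
    by (rule expectation_cis_stable_integral[OF \<delta> Z I[OF t]]) simp
  also have "\<dots> = exp (- (complex_of_real (t powr (\<delta> * H)) * psi \<delta> (\<rho> * lfsm_skew \<delta> H) p))"
    unfolding integral_psi_lfsm_kernel_scale[OF \<delta> H t] integral_psi_lfsm_kernel[OF \<delta> H int skew] ..
  finally show "expectation (\<lambda>\<omega>. cis (p * Y t \<omega>))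
        = exp (- (complex_of_real (t powr (\<delta> * H)) * psi \<delta> (\<rho> * lfsm_skew \<delta> H) p))" .
qed

end

section \<open>Laplace transforms extending to entire functions\<close>

text \<open>The partial sums are below the full exponential, and the remaining factor
  \<open>exp (a * (b - x))\<close> is at most 1. The bound is independent of \<open>a\<close>, so no
  moments of a random variable put in place of \<open>a\<close> are required.\<close>

lemma exp_terms_sum_le:
  fixes a b :: real
  assumes "a \<ge> 0" "0 \<le> b" "b \<le> x"
  shows "(\<Sum>n<N. exp (- (x * a)) * ((a * b) ^ n /\<^sub>R fact n)) \<le> 1"
proof -
  have "(\<Sum>n<N. exp (- (x * a)) * ((a * b) ^ n /\<^sub>R fact n)) = exp (- (x * a)) * (\<Sum>n<N. (a * b) ^ n /\<^sub>R fact n)"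
    by (simp add: sum_distrib_left)
  also have "\<dots> \<le> exp (- (x * a)) * exp (a * b)"
  proof (rule mult_left_mono)
    show "(\<Sum>n<N. (a * b) ^ n /\<^sub>R fact n) \<le> exp (a * b)"
      using sum_le_suminf[OF summable_exp_generic[of "a * b"], of "{..<N}"] assms by (simp add: exp_def)
  qed simp
  also have "exp (- (x * a)) * exp (a * b) = exp (a * (b - x))" by (simp add: mult_exp_exp algebra_simps)
  also have "\<dots> \<le> 1" using assms by (simp add: mult_nonneg_nonpos)
  finally show ?thesis .
qed

context prob_space
begin

text \<open>Expand \<open>exp (- (w * A))\<close> about the real point \<open>x\<close>. On the disc
  of radius \<open>x\<close>, which touches the imaginary axis at 0, the absolute partial sums are
  at most 1 for every value of \<open>A\<close>, so expectation and series may be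
  interchanged.\<close>

lemma laplace_transform_holomorphic:
  assumes [measurable]: "A \<in> borel_measurable M" and A: "\<And>\<omega>. A \<omega> \<ge> 0" and x: "x > 0"
  shows "(\<lambda>w. expectation (\<lambda>\<omega>. exp (- (w * complex_of_real (A \<omega>))))) holomorphic_on ball (complex_of_real x) x"
proof (rule power_series_holomorphic)
  fix w :: complex assume "w \<in> ball (complex_of_real x) x"
  then have wx: "norm (w - complex_of_real x) \<le> x" by (simp add: dist_norm norm_minus_commute)
  let ?b = "norm (w - complex_of_real x)"
  let ?a = "\<lambda>n. expectation (\<lambda>\<omega>. complex_of_real (exp (- (x * A \<omega>))) * ((- complex_of_real (A \<omega>)) ^ n /\<^sub>R fact n))"
  define f where "f n \<omega> = complex_of_real (exp (- (x * A \<omega>))) * ((- (complex_of_real (A \<omega>) * (w - complex_of_real x))) ^ n /\<^sub>R fact n)" for n \<omega>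
  have [measurable]: "f n \<in> borel_measurable M" for n unfolding f_def[abs_def] by measurable
  have norm_f: "norm (f n \<omega>) = exp (- (x * A \<omega>)) * ((A \<omega> * ?b) ^ n /\<^sub>R fact n)" for n \<omega>
    using A[of \<omega>] by (simp add: f_def norm_mult norm_power)
  have partial: "(\<Sum>n<N. norm (f n \<omega>)) \<le> 1" for N \<omega>
    unfolding norm_f by (rule exp_terms_sum_le[OF A norm_ge_zero wx])
  have f_le: "norm (f n \<omega>) \<le> 1" for n \<omega>
    using partial[of \<omega> "Suc n"] sum_nonneg[of "{..<n}" "\<lambda>n. norm (f n \<omega>)"] by (simp add: algebra_simps)
  have int: "integrable M (f n)" for n
    using f_le by (intro integrable_const_bound[where B=1]) auto
  have "(\<lambda>n. expectation (f n)) sums expectation (\<lambda>\<omega>. \<Sum>n. f n \<omega>)"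
  proof (rule sums_integral[OF int])
    show "AE \<omega> in M. summable (\<lambda>n. norm (f n \<omega>))"
      using partial by (intro AE_I2 summableI_nonneg_bounded[where x=1]) auto
    show "summable (\<lambda>n. expectation (\<lambda>\<omega>. norm (f n \<omega>)))"
    proof (rule summableI_nonneg_bounded[where x=1])
      fix N
      have "(\<Sum>n<N. expectation (\<lambda>\<omega>. norm (f n \<omega>))) = expectation (\<lambda>\<omega>. \<Sum>n<N. norm (f n \<omega>))"
        using int by (intro Bochner_Integration.integral_sum[symmetric]) auto
      also have "\<dots> \<le> expectation (\<lambda>_. 1)"
        using int partial by (intro integral_mono) auto
      finally show "(\<Sum>n<N. expectation (\<lambda>\<omega>. norm (f n \<omega>))) \<le> 1" by (simp add: prob_space)
    qed simp
  qed
  moreover have "(\<Sum>n. f n \<omega>) = exp (- (w * complex_of_real (A \<omega>)))" for \<omega>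
  proof -
    have "(\<lambda>n. f n \<omega>) sums (complex_of_real (exp (- (x * A \<omega>))) * exp (- (complex_of_real (A \<omega>) * (w - complex_of_real x))))"
      unfolding f_def by (intro sums_mult exp_converges)
    moreover have "complex_of_real (exp (- (x * A \<omega>))) * exp (- (complex_of_real (A \<omega>) * (w - complex_of_real x)))
        = exp (- (w * complex_of_real (A \<omega>)))"
      unfolding exp_of_real[symmetric] mult_exp_exp by (simp add: algebra_simps)
    ultimately show ?thesis by (simp add: sums_iff)
  qed
  moreover have "expectation (f n) = ?a n * (w - complex_of_real x) ^ n" for n
  proof -
    have "f n = (\<lambda>\<omega>. (complex_of_real (exp (- (x * A \<omega>))) * ((- complex_of_real (A \<omega>)) ^ n /\<^sub>R fact n)) * (w - complex_of_real x) ^ n)"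
      unfolding f_def mult_minus_left[symmetric] power_mult_distrib by (simp add: mult.assoc)
    then show ?thesis by simp
  qed
  ultimately show "(\<lambda>n. ?a n * (w - complex_of_real x) ^ n) sums expectation (\<lambda>\<omega>. exp (- (w * complex_of_real (A \<omega>))))"
    by simp
qed

text \<open>The Laplace transform and the entire function agree on the positive real axis; the
  identity theorem extends this to a disc centred there. \<open>B\<close> replaces \<open>A\<close>
  by its positive part, because the expansion is stated for pointwise nonnegative variables.\<close>

lemma laplace_transform_entire:
  fixes c :: "nat \<Rightarrow> real"
  assumes [measurable]: "A \<in> borel_measurable M" and A: "AE \<omega> in M. 0 \<le> A \<omega>"
    and summ: "\<And>y::complex. summable (\<lambda>n. complex_of_real (c n) * y ^ n)"
    and laplace: "\<And>x. x \<ge> 0 \<Longrightarrow> expectation (\<lambda>\<omega>. exp (- (x * A \<omega>))) = (\<Sum>n. c n * (- x) ^ n)"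
    and z: "Re z > 0"
  shows "expectation (\<lambda>\<omega>. exp (- (z * complex_of_real (A \<omega>)))) = (\<Sum>n. complex_of_real (c n) * (- z) ^ n)"
proof -
  define B where "B \<omega> = max 0 (A \<omega>)" for \<omega>
  have [measurable]: "B \<in> borel_measurable M" unfolding B_def[abs_def] by measurable
  have AB: "AE \<omega> in M. A \<omega> = B \<omega>" using A by eventually_elim (simp add: B_def)
  have B: "B \<omega> \<ge> 0" for \<omega> by (simp add: B_def)
  define F where "F w = expectation (\<lambda>\<omega>. exp (- (w * complex_of_real (B \<omega>))))" for w
  define G where "G w = (\<Sum>n. complex_of_real (c n) * w ^ n)" for w :: complex
  \<comment> \<open>With this centre the squared distance from \<open>x\<close> to \<open>z\<close>
    is \<open>x\<^sup>2 - (norm z)\<^sup>2\<close>, so \<open>z\<close> lies in the disc of radius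
    \<open>x\<close>.\<close>
  define x where "x = (norm z)\<^sup>2 / Re z"
  have z0: "z \<noteq> 0" using z by auto
  have x: "x > 0" using z z0 by (simp add: x_def)
  have xz: "x * Re z = (norm z)\<^sup>2" using z by (simp add: x_def)
  let ?D = "ball (complex_of_real x) x"
  have zD: "z \<in> ?D"
  proof -
    have "(norm (complex_of_real x - z))\<^sup>2 = (x - Re z)\<^sup>2 + (Im z)\<^sup>2" by (simp add: cmod_power2)
    also have "\<dots> = x\<^sup>2 - 2 * (x * Re z) + (norm z)\<^sup>2" unfolding cmod_power2 by (simp add: power2_eq_square algebra_simps)
    also have "\<dots> < x\<^sup>2" unfolding xz using z0 by simp
    finally show ?thesis using x by (simp add: dist_norm power_less_imp_less_base)
  qed
  have holG: "G holomorphic_on UNIV"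
    unfolding holomorphic_on_def field_differentiable_def G_def
    using termdiffs_strong_converges_everywhere[OF summ] by auto
  have F: "F holomorphic_on ?D"
    unfolding F_def[abs_def] by (rule laplace_transform_holomorphic[OF _ B x]) simp
  have "(G \<circ> uminus) holomorphic_on ?D"
    by (intro holomorphic_on_compose holomorphic_intros holomorphic_on_subset[OF holG]) auto
  then have G: "(\<lambda>w. G (- w)) holomorphic_on ?D" by (simp add: comp_def)
  have real: "F (complex_of_real r) = G (- complex_of_real r)" if "r \<ge> 0" for r
  proof -
    have "F (complex_of_real r) = expectation (\<lambda>\<omega>. complex_of_real (exp (- (r * B \<omega>))))"
      unfolding F_def by (simp flip: exp_of_real)
    also have "\<dots> = complex_of_real (expectation (\<lambda>\<omega>. exp (- (r * B \<omega>))))" by (rule integral_complex_of_real)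
    also have "expectation (\<lambda>\<omega>. exp (- (r * B \<omega>))) = expectation (\<lambda>\<omega>. exp (- (r * A \<omega>)))"
    proof (rule integral_cong_AE)
      show "AE \<omega> in M. exp (- (r * B \<omega>)) = exp (- (r * A \<omega>))" using AB by eventually_elim simp
    qed auto
    also have "\<dots> = (\<Sum>n. c n * (- r) ^ n)" by (rule laplace[OF that])
    also have "complex_of_real \<dots> = (\<Sum>n. complex_of_real (c n * (- r) ^ n))"
    proof (rule suminf_of_real)
      have "summable (\<lambda>n. complex_of_real (c n * (- r) ^ n))"
        using summ[of "complex_of_real (- r)"] by simp
      then show "summable (\<lambda>n. c n * (- r) ^ n)" by (simp only: summable_of_real_iff)
    qed
    finally show ?thesis by (simp add: G_def)
  qed
  have "F z - G (- z) = 0"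
  proof (rule analytic_continuation[where f="\<lambda>w. F w - G (- w)" and S="?D" and U="complex_of_real ` {0<..<2 * x}" and \<xi>="complex_of_real x"])
    show "(\<lambda>w. F w - G (- w)) holomorphic_on ?D" by (intro holomorphic_intros F G)
    show "complex_of_real ` {0<..<2 * x} \<subseteq> ?D"
      by (auto simp: dist_norm simp flip: of_real_diff)
    show "complex_of_real x islimpt complex_of_real ` {0<..<2 * x}"
      unfolding islimpt_approachable
    proof (intro allI impI)
      fix e :: real assume e: "e > 0"
      define y where "y = x + min (e / 2) (x / 2)"
      have "y \<in> {0<..<2 * x}" "y \<noteq> x" "\<bar>y - x\<bar> < e" using x e by (auto simp: min_def y_def)
      then show "\<exists>x'\<in>complex_of_real ` {0<..<2 * x}. x' \<noteq> complex_of_real x \<and> dist x' (complex_of_real x) < e"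
        by (intro bexI[of _ "complex_of_real y"]) (auto simp: dist_norm simp flip: of_real_diff)
    qed
  qed (use x zD real in auto)
  moreover have "F z = expectation (\<lambda>\<omega>. exp (- (z * complex_of_real (A \<omega>))))"
    unfolding F_def
  proof (rule integral_cong_AE)
    show "AE \<omega> in M. exp (- (z * complex_of_real (B \<omega>))) = exp (- (z * complex_of_real (A \<omega>)))"
      using AB by eventually_elim simp
  qed auto
  ultimately show ?thesis by (simp add: G_def)
qed

end

section \<open>The integral equation for the power series\<close>

locale homogeneous_kernel =
  fixes k :: "real \<Rightarrow> real \<Rightarrow> real" and \<beta> :: real
  assumes beta: "\<beta> > 0"
    and hom: "\<And>t s. t > 0 \<Longrightarrow> s \<in> {0<..<1} \<Longrightarrow> k t (t * s) = t powr (\<beta> - 1) * k 1 s"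
    and k_int: "set_integrable lborel {0<..<1} (k 1)"
begin

text \<open>The complex counterpart of \<open>Phihat\<close>, because a skewed symbol has complex
  values.\<close>

definition Phi :: "complex \<Rightarrow> complex" where
  "Phi z = (\<Sum>n. complex_of_real (chat k \<beta> n) * z ^ n)"

section \<open>Growth of the coefficients\<close>

lemma moment_integrable: "set_integrable lborel {0<..<1} (\<lambda>s. k 1 s * s powr (\<beta> * real n))"
  unfolding set_integrable_def
proof (rule Bochner_Integration.integrable_bound[OF k_int[unfolded set_integrable_def]])
  have "(\<lambda>s. indicator {0<..<1} s *\<^sub>R k 1 s) \<in> borel_measurable borel"
    using k_int by (simp add: set_integrable_def integrable_iff_bounded)
  then have "(\<lambda>s. (indicator {0<..<1} s *\<^sub>R k 1 s) * s powr (\<beta> * real n)) \<in> borel_measurable lborel" by measurable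
  then show "(\<lambda>s. indicator {0<..<1} s *\<^sub>R (k 1 s * s powr (\<beta> * real n))) \<in> borel_measurable lborel"
    by (simp add: mult.assoc)
  show "AE s in lborel. norm (indicator {0<..<1} s *\<^sub>R (k 1 s * s powr (\<beta> * real n))) \<le> norm (indicator {0<..<1} s *\<^sub>R k 1 s)"
    using beta by (intro AE_I2) (auto simp: indicator_def abs_mult intro!: mult_left_le powr_le1)
qed

text \<open>The powers tend to 0 pointwise on the open unit interval and are at most 1 there, so
  \<open>k 1\<close> dominates. The moments are the factors in the recursion for
  \<open>chat\<close>; their decay makes the ratio test succeed at every radius, so
  \<open>Phi\<close> is entire.\<close>

lemma moments_tendsto_0: "(\<lambda>n. \<integral>s\<in>{0<..<1}. k 1 s * s powr (\<beta> * real n) \<partial>lborel) \<longlonglongrightarrow> 0"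
proof -
  have "(\<lambda>n. \<integral>s. indicator {0<..<1} s *\<^sub>R (k 1 s * s powr (\<beta> * real n)) \<partial>lborel) \<longlonglongrightarrow> (\<integral>s. 0 \<partial>(lborel :: real measure))"
  proof (rule integral_dominated_convergence[where w="\<lambda>s. norm (indicator {0<..<1} s *\<^sub>R k 1 s)"])
    show "integrable lborel (\<lambda>s. norm (indicator {0<..<1} s *\<^sub>R k 1 s))"
      using k_int unfolding set_integrable_def by (rule integrable_norm)
    show "(\<lambda>s. indicator {0<..<1} s *\<^sub>R (k 1 s * s powr (\<beta> * real n))) \<in> borel_measurable lborel" for n
      using moment_integrable[of n] unfolding set_integrable_def by (rule borel_measurable_integrable)
    show "AE s in lborel. norm (indicator {0<..<1} s *\<^sub>R (k 1 s * s powr (\<beta> * real n))) \<le> norm (indicator {0<..<1} s *\<^sub>R k 1 s)" for n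
      using beta by (intro AE_I2) (auto simp: indicator_def abs_mult intro!: mult_left_le powr_le1)
    show "AE s in lborel. (\<lambda>n. indicator {0<..<1} s *\<^sub>R (k 1 s * s powr (\<beta> * real n))) \<longlonglongrightarrow> 0"
    proof (rule AE_I2)
      fix s :: real
      show "(\<lambda>n. indicator {0<..<1} s *\<^sub>R (k 1 s * s powr (\<beta> * real n))) \<longlonglongrightarrow> 0"
      proof (cases "s \<in> {0<..<1}")
        case True
        then have "s powr (\<beta> * real n) = (s powr \<beta>) ^ n" for n
          by (simp add: powr_powr[symmetric] powr_realpow)
        moreover have "s powr \<beta> < 1" using True beta powr_less_mono2[of \<beta> s 1] by simp
        then have "(\<lambda>n. k 1 s * (s powr \<beta>) ^ n) \<longlonglongrightarrow> k 1 s * 0"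
          by (intro tendsto_intros LIMSEQ_realpow_zero) auto
        ultimately show ?thesis using True by simp
      qed simp
    qed
  qed simp
  then show ?thesis by (simp add: set_lebesgue_integral_def)
qed

lemma chat_summable: "summable (\<lambda>n. \<bar>chat k \<beta> n\<bar> * r ^ n)"
proof -
  let ?m = "\<lambda>n. \<integral>s\<in>{0<..<1}. k 1 s * s powr (\<beta> * real n) \<partial>lborel"
  have "(\<lambda>n. ?m n * r) \<longlonglongrightarrow> 0 * r" by (intro tendsto_intros moments_tendsto_0)
  then have "(\<lambda>n. norm (?m n * r)) \<longlonglongrightarrow> 0" by (intro tendsto_norm_zero) simp
  then have "eventually (\<lambda>n. norm (?m n * r) < 1 / 2) sequentially"
    by (rule order_tendstoD) simp
  then obtain N where N: "\<And>n. n \<ge> N \<Longrightarrow> norm (?m n * r) < 1 / 2" by (auto simp: eventually_sequentially)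
  show ?thesis
  proof (rule summable_ratio_test[where c="1 / 2" and N=N])
    fix n assume "n \<ge> N"
    have "norm (\<bar>chat k \<beta> (Suc n)\<bar> * r ^ Suc n) = norm (?m n * r) * norm (\<bar>chat k \<beta> n\<bar> * r ^ n)"
      by (simp add: abs_mult)
    also have "\<dots> \<le> 1 / 2 * norm (\<bar>chat k \<beta> n\<bar> * r ^ n)"
      using N[OF \<open>n \<ge> N\<close>] by (intro mult_right_mono) auto
    finally show "norm (\<bar>chat k \<beta> (Suc n)\<bar> * r ^ Suc n) \<le> 1 / 2 * norm (\<bar>chat k \<beta> n\<bar> * r ^ n)" .
  qed simp
qed

lemma Phi_summable: "summable (\<lambda>n. complex_of_real (chat k \<beta> n) * z ^ n)"
proof (rule summable_norm_cancel)
  show "summable (\<lambda>n. norm (complex_of_real (chat k \<beta> n) * z ^ n))"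
    using chat_summable[of "norm z"] by (simp add: norm_mult norm_power)
qed

lemma Phi_of_real: "Phi (complex_of_real x) = complex_of_real (Phihat k \<beta> x)"
proof -
  have "summable (\<lambda>n. chat k \<beta> n * x ^ n)"
  proof (rule summable_norm_cancel)
    show "summable (\<lambda>n. norm (chat k \<beta> n * x ^ n))"
      using chat_summable[of "\<bar>x\<bar>"] by (simp add: abs_mult power_abs)
  qed
  from suminf_of_real[OF this, where 'a=complex] show ?thesis by (simp add: Phi_def Phihat_def)
qed

lemma continuous_Phi: "continuous_on UNIV Phi"
  unfolding Phi_def[abs_def]
  by (intro continuous_at_imp_continuous_on ballI isCont_powser_converges_everywhere Phi_summable)

text \<open>Integrate the series term by term: the moment of order \<open>n\<close> times
  \<open>chat k \<beta> n\<close> is \<open>chat k \<beta> (Suc n)\<close>, so the integral is the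
  shifted series and the outer \<open>z\<close> restores the power. The interchange is dominated by
  the integral of \<open>\<bar>k 1\<bar>\<close> times the absolutely convergent series.\<close>

lemma Phi_equation_unit:
  "Phi z - 1 = z * (\<integral>s\<in>{0<..<1}. k 1 s *\<^sub>R Phi (complex_of_real (s powr \<beta>) * z) \<partial>lborel)"
proof -
  define f where "f n s = (indicator {0<..<1} s * (k 1 s * s powr (\<beta> * real n))) *\<^sub>R (complex_of_real (chat k \<beta> n) * z ^ n)" for n s
  let ?m = "\<lambda>n. \<integral>s\<in>{0<..<1}. k 1 s * s powr (\<beta> * real n) \<partial>lborel"
  have mom: "integrable lborel (\<lambda>s. indicator {0<..<1} s * (k 1 s * s powr (\<beta> * real n)))" for n
    using moment_integrable[of n] by (simp add: set_integrable_def)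
  have k1: "integrable lborel (\<lambda>s. indicator {0<..<1} s * \<bar>k 1 s\<bar>)"
    using integrable_norm[OF k_int[unfolded set_integrable_def]] by (simp add: abs_mult)
  have int: "integrable lborel (f n)" for n
    unfolding f_def[abs_def] by (intro integrable_scaleR_left mom)
  have f_le: "norm (f n s) \<le> (indicator {0<..<1} s * \<bar>k 1 s\<bar>) * (\<bar>chat k \<beta> n\<bar> * norm z ^ n)" for n s
    using beta by (auto simp: f_def norm_mult norm_power abs_mult indicator_def
        intro!: mult_right_mono mult_left_le powr_le1)
  have sm: "summable (\<lambda>n. c * (\<bar>chat k \<beta> n\<bar> * norm z ^ n))" for c
    by (intro summable_mult chat_summable)
  have "(\<lambda>n. \<integral>s. f n s \<partial>lborel) sums (\<integral>s. (\<Sum>n. f n s) \<partial>lborel)"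
  proof (rule sums_integral[OF int])
    show "AE s in lborel. summable (\<lambda>n. norm (f n s))"
      using f_le by (intro AE_I2 summable_comparison_test'[OF sm, where N=0]) simp
    show "summable (\<lambda>n. \<integral>s. norm (f n s) \<partial>lborel)"
    proof (rule summable_comparison_test'[OF sm, where N=0])
      fix n
      have "(\<integral>s. norm (f n s) \<partial>lborel) \<le> (\<integral>s. (indicator {0<..<1} s * \<bar>k 1 s\<bar>) * (\<bar>chat k \<beta> n\<bar> * norm z ^ n) \<partial>lborel)"
        by (intro integral_mono f_le integrable_norm int integrable_mult_left k1)
      then show "norm (\<integral>s. norm (f n s) \<partial>lborel) \<le> (\<integral>s. indicator {0<..<1} s * \<bar>k 1 s\<bar> \<partial>lborel) * (\<bar>chat k \<beta> n\<bar> * norm z ^ n)"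
        by simp
    qed
  qed
  moreover have "(\<integral>s. f n s \<partial>lborel) = complex_of_real (chat k \<beta> (Suc n)) * z ^ n" for n
  proof -
    have "(\<integral>s. f n s \<partial>lborel) = (\<integral>s. indicator {0<..<1} s * (k 1 s * s powr (\<beta> * real n)) \<partial>lborel) *\<^sub>R (complex_of_real (chat k \<beta> n) * z ^ n)"
      unfolding f_def by (intro integral_scaleR_left mom)
    also have "(\<integral>s. indicator {0<..<1} s * (k 1 s * s powr (\<beta> * real n)) \<partial>lborel) = ?m n"
      by (simp add: set_lebesgue_integral_def)
    finally show ?thesis by (simp add: scaleR_conv_of_real)
  qed
  moreover have "(\<lambda>s. \<Sum>n. f n s) = (\<lambda>s. indicator {0<..<1} s *\<^sub>R (k 1 s *\<^sub>R Phi (complex_of_real (s powr \<beta>) * z)))"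
  proof
    fix s :: real
    show "(\<Sum>n. f n s) = indicator {0<..<1} s *\<^sub>R (k 1 s *\<^sub>R Phi (complex_of_real (s powr \<beta>) * z))"
    proof (cases "s \<in> {0<..<1}")
      case True
      have "s powr (\<beta> * real n) = (s powr \<beta>) ^ n" for n
        using True by (simp add: powr_powr[symmetric] powr_realpow)
      then have "f n s = k 1 s *\<^sub>R (complex_of_real (chat k \<beta> n) * (complex_of_real (s powr \<beta>) * z) ^ n)" for n
        using True by (simp add: f_def scaleR_conv_of_real power_mult_distrib)
      then show ?thesis
        using True suminf_scaleR_right[OF Phi_summable, of "k 1 s" "complex_of_real (s powr \<beta>) * z"] by (simp add: Phi_def)
    qed (simp add: f_def)
  qed
  ultimately have "(\<Sum>n. complex_of_real (chat k \<beta> (Suc n)) * z ^ n) = (\<integral>s\<in>{0<..<1}. k 1 s *\<^sub>R Phi (complex_of_real (s powr \<beta>) * z) \<partial>lborel)"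
    and sm': "summable (\<lambda>n. complex_of_real (chat k \<beta> (Suc n)) * z ^ n)"
    by (simp_all only: sums_iff set_lebesgue_integral_def)
  moreover have "Phi z - 1 = (\<Sum>n. complex_of_real (chat k \<beta> (Suc n)) * z ^ Suc n)"
    using suminf_split_head[OF Phi_summable[of z]] by (simp only: Phi_def) simp
  moreover have "(\<Sum>n. complex_of_real (chat k \<beta> (Suc n)) * z ^ Suc n) = z * (\<Sum>n. complex_of_real (chat k \<beta> (Suc n)) * z ^ n)"
    using suminf_mult[OF sm', of z] by (simp only: power_Suc mult.left_commute)
  ultimately show ?thesis by simp
qed

text \<open>With the indicators included, homogeneity holds for every real \<open>r\<close>, the
  form required by affine substitution over the whole line.\<close>

lemma kernel_scale:
  assumes t: "t > 0"
  shows "indicator {0<..<t} (t * r) * k t (t * r) = t powr (\<beta> - 1) * (indicator {0<..<1} r * k 1 r)"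
  using hom[OF t, of r] t by (auto simp: indicator_def mult_less_cancel_left_pos[of t r 1, simplified] zero_less_mult_iff)

lemma integral_kernel_scale:
  fixes G :: "real \<Rightarrow> complex"
  assumes t: "t > 0"
  shows "(\<integral>s\<in>{0<..<t}. k t s *\<^sub>R G s \<partial>lborel) = t powr \<beta> *\<^sub>R (\<integral>r\<in>{0<..<1}. k 1 r *\<^sub>R G (t * r) \<partial>lborel)"
proof -
  have "(\<integral>s. (indicator {0<..<t} s * k t s) *\<^sub>R G s \<partial>lborel)
      = \<bar>t\<bar> *\<^sub>R (\<integral>r. (indicator {0<..<t} (0 + t * r) * k t (0 + t * r)) *\<^sub>R G (0 + t * r) \<partial>lborel)"
    using t by (intro lborel_integral_real_affine) simp
  also have "(\<lambda>r. (indicator {0<..<t} (0 + t * r) * k t (0 + t * r)) *\<^sub>R G (0 + t * r))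
      = (\<lambda>r. t powr (\<beta> - 1) *\<^sub>R ((indicator {0<..<1} r * k 1 r) *\<^sub>R G (t * r)))"
    using kernel_scale[OF t] by simp
  also have "\<bar>t\<bar> *\<^sub>R (\<integral>r. t powr (\<beta> - 1) *\<^sub>R ((indicator {0<..<1} r * k 1 r) *\<^sub>R G (t * r)) \<partial>lborel)
      = (t * t powr (\<beta> - 1)) *\<^sub>R (\<integral>r. (indicator {0<..<1} r * k 1 r) *\<^sub>R G (t * r) \<partial>lborel)"
    using t by (simp only: integral_scaleR_right abs_of_pos) (simp only: scaleR_scaleR)
  also have "t * t powr (\<beta> - 1) = t powr \<beta>"
    using t powr_add[of t 1 "\<beta> - 1"] by simp
  finally show ?thesis by (simp add: set_lebesgue_integral_def)
qed

lemma kernel_integrable: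
  assumes t: "t > 0"
  shows "set_integrable lborel {0<..<t} (k t)"
    and "(\<integral>s\<in>{0<..<t}. \<bar>k t s\<bar> \<partial>lborel) = t powr \<beta> * (\<integral>s\<in>{0<..<1}. \<bar>k 1 s\<bar> \<partial>lborel)"
proof -
  have "integrable lborel (\<lambda>r. indicator {0<..<t} (0 + t * r) * k t (0 + t * r))"
    using kernel_scale[OF t] k_int by (simp add: set_integrable_def)
  then have "integrable lborel (\<lambda>s. indicator {0<..<t} s * k t s)"
    using t by (subst (asm) lborel_integrable_real_affine_iff) simp_all
  then show "set_integrable lborel {0<..<t} (k t)" by (simp add: set_integrable_def)
  have "(\<integral>s. \<bar>indicator {0<..<t} s * k t s\<bar> \<partial>lborel)
      = \<bar>t\<bar> *\<^sub>R (\<integral>r. \<bar>indicator {0<..<t} (0 + t * r) * k t (0 + t * r)\<bar> \<partial>lborel)"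
    using t by (intro lborel_integral_real_affine) simp
  also have "(\<lambda>r. \<bar>indicator {0<..<t} (0 + t * r) * k t (0 + t * r)\<bar>)
      = (\<lambda>r. t powr (\<beta> - 1) * (indicator {0<..<1} r * \<bar>k 1 r\<bar>))"
    using kernel_scale[OF t] by (simp add: abs_mult)
  also have "\<bar>t\<bar> *\<^sub>R (\<integral>r. t powr (\<beta> - 1) * (indicator {0<..<1} r * \<bar>k 1 r\<bar>) \<partial>lborel)
      = (t * t powr (\<beta> - 1)) * (\<integral>r. indicator {0<..<1} r * \<bar>k 1 r\<bar> \<partial>lborel)"
    using t by simp
  also have "t * t powr (\<beta> - 1) = t powr \<beta>"
    using t powr_add[of t 1 "\<beta> - 1"] by simp
  finally show "(\<integral>s\<in>{0<..<t}. \<bar>k t s\<bar> \<partial>lborel) = t powr \<beta> * (\<integral>s\<in>{0<..<1}. \<bar>k 1 s\<bar> \<partial>lborel)"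
    by (simp add: set_lebesgue_integral_def abs_mult)
qed

text \<open>Substituting \<open>s = t * r\<close> splits \<open>s powr \<beta>\<close> into a
  product, so this is the unit equation at \<open>- (t powr \<beta> * w)\<close>; the outer factor
  \<open>t powr \<beta>\<close> comes from scaling the kernel and the measure.\<close>

lemma Phi_equation:
  assumes t: "t > 0"
  shows "Phi (- (complex_of_real (t powr \<beta>) * w)) - 1
    = - w * (\<integral>s\<in>{0<..<t}. k t s *\<^sub>R Phi (- (complex_of_real (s powr \<beta>) * w)) \<partial>lborel)"
proof -
  have "(\<integral>s\<in>{0<..<t}. k t s *\<^sub>R Phi (- (complex_of_real (s powr \<beta>) * w)) \<partial>lborel)
      = t powr \<beta> *\<^sub>R (\<integral>r\<in>{0<..<1}. k 1 r *\<^sub>R Phi (- (complex_of_real ((t * r) powr \<beta>) * w)) \<partial>lborel)"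
    by (rule integral_kernel_scale[OF t])
  also have "(\<integral>r\<in>{0<..<1}. k 1 r *\<^sub>R Phi (- (complex_of_real ((t * r) powr \<beta>) * w)) \<partial>lborel)
      = (\<integral>r\<in>{0<..<1}. k 1 r *\<^sub>R Phi (complex_of_real (r powr \<beta>) * - (complex_of_real (t powr \<beta>) * w)) \<partial>lborel)"
    using t by (intro set_lebesgue_integral_cong) (auto simp: powr_mult mult_ac)
  finally show ?thesis
    using Phi_equation_unit[of "- (complex_of_real (t powr \<beta>) * w)"]
    by (simp add: scaleR_conv_of_real mult_ac)
qed

end

section \<open>From characteristic functions to solutions\<close>

lemma uniform_limit_of_bound:
  fixes f :: "nat \<Rightarrow> 'a \<Rightarrow> complex"
  assumes bound: "\<And>n x. norm (f n x - l x) \<le> a n" and a: "a \<longlonglongrightarrow> 0"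
  shows "uniform_limit UNIV f l sequentially"
proof (rule uniform_limitI)
  fix e :: real assume "e > 0"
  then have "eventually (\<lambda>n. a n < e) sequentially" by (rule order_tendstoD(2)[OF a])
  then show "eventually (\<lambda>n. \<forall>x\<in>UNIV. dist (f n x) (l x) < e) sequentially"
    by eventually_elim (auto simp: dist_norm intro: le_less_trans[OF bound])
qed

text \<open>Large values are replaced by 0. What matters is boundedness and agreement with
  \<open>X\<close> off the tail event.\<close>

definition truncate :: "nat \<Rightarrow> ('a \<Rightarrow> real) \<Rightarrow> 'a \<Rightarrow> real" where
  "truncate n X \<omega> = (if \<bar>X \<omega>\<bar> \<le> real n then X \<omega> else 0)"

lemma abs_truncate_le: "\<bar>truncate n X \<omega>\<bar> \<le> real n"
  by (simp add: truncate_def)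

context prob_space
begin

lemma tail_prob_tendsto_0:
  assumes [measurable]: "X \<in> borel_measurable M"
  shows "(\<lambda>n. prob {\<omega>\<in>space M. real n < \<bar>X \<omega>\<bar>}) \<longlonglongrightarrow> 0"
proof -
  have "(\<lambda>n. expectation (indicator {\<omega>\<in>space M. real n < \<bar>X \<omega>\<bar>} :: _ \<Rightarrow> real)) \<longlonglongrightarrow> expectation (\<lambda>_. 0)"
  proof (rule integral_dominated_convergence[where w="\<lambda>_. 1"])
    show "AE \<omega> in M. (\<lambda>n. indicator {\<omega>\<in>space M. real n < \<bar>X \<omega>\<bar>} \<omega> :: real) \<longlonglongrightarrow> 0"
    proof (rule AE_I2)
      fix \<omega>
      obtain N :: nat where N: "\<bar>X \<omega>\<bar> < real N" using reals_Archimedean2 by blast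
      have "eventually (\<lambda>n. indicator {\<omega>\<in>space M. real n < \<bar>X \<omega>\<bar>} \<omega> = (0::real)) sequentially"
        using eventually_ge_at_top[of N]
      proof eventually_elim
        case (elim n)
        then have "real N \<le> real n" by simp
        with N show ?case by (simp add: indicator_def)
      qed
      then show "(\<lambda>n. indicator {\<omega>\<in>space M. real n < \<bar>X \<omega>\<bar>} \<omega> :: real) \<longlonglongrightarrow> 0"
        by (rule tendsto_eventually)
    qed
  qed (auto simp: indicator_def)
  then show ?thesis by simp
qed

lemma truncate_measurable [measurable]:
  assumes [measurable]: "X \<in> borel_measurable M"
  shows "truncate n X \<in> borel_measurable M"
  unfolding truncate_def[abs_def] by measurable

text \<open>The integrands differ only on the tail event, by at most \<open>2 * B\<close>. The bound
  sees \<open>h\<close> only through its supremum, so it is uniform over the translates of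
  \<open>u\<close> and over all characters.\<close>

lemma expectation_truncate_diff:
  fixes h :: "real \<Rightarrow> complex"
  assumes [measurable]: "X \<in> borel_measurable M" "h \<in> borel_measurable borel"
    and h: "\<And>y. norm (h y) \<le> B"
  shows "norm (expectation (\<lambda>\<omega>. h (truncate n X \<omega>)) - expectation (\<lambda>\<omega>. h (X \<omega>)))
    \<le> 2 * B * prob {\<omega>\<in>space M. real n < \<bar>X \<omega>\<bar>}"
proof -
  let ?T = "{\<omega>\<in>space M. real n < \<bar>X \<omega>\<bar>}"
  have i: "integrable M (\<lambda>\<omega>. h (truncate n X \<omega>))" "integrable M (\<lambda>\<omega>. h (X \<omega>))"
    using h by (auto intro!: integrable_const_bound[where B=B])
  have "norm (expectation (\<lambda>\<omega>. h (truncate n X \<omega>)) - expectation (\<lambda>\<omega>. h (X \<omega>)))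
      = norm (expectation (\<lambda>\<omega>. h (truncate n X \<omega>) - h (X \<omega>)))" using i by simp
  also have "\<dots> \<le> expectation (\<lambda>\<omega>. norm (h (truncate n X \<omega>) - h (X \<omega>)))" by (rule integral_norm_bound)
  also have "\<dots> \<le> expectation (\<lambda>\<omega>. 2 * B * indicator ?T \<omega>)"
  proof (rule integral_mono)
    show "integrable M (\<lambda>\<omega>. norm (h (truncate n X \<omega>) - h (X \<omega>)))" using i by simp
    show "integrable M (\<lambda>\<omega>. 2 * B * indicator ?T \<omega>)" by (auto simp: less_top[symmetric])
    fix \<omega> assume \<omega>: "\<omega> \<in> space M"
    show "norm (h (truncate n X \<omega>) - h (X \<omega>)) \<le> 2 * B * indicator ?T \<omega>"
    proof (cases "\<omega> \<in> ?T")
      case True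
      have "norm (h (truncate n X \<omega>) - h (X \<omega>)) \<le> norm (h (truncate n X \<omega>)) + norm (h (X \<omega>))"
        by (rule norm_triangle_ineq4)
      also have "\<dots> \<le> B + B" by (intro add_mono h)
      finally show ?thesis using True by simp
    next
      case False
      with \<omega> show ?thesis by (simp add: truncate_def)
    qed
  qed
  also have "\<dots> = 2 * B * prob ?T" by simp
  finally show ?thesis .
qed

end

text \<open>For \<delta> at most 2 the symbol grows no faster than \<open>1 + p\<^sup>2\<close>.
  Since the square of \<open>1 + p\<^sup>2\<close> is at most twice
  \<open>1 + \<bar>p\<bar> ^ 4\<close>, fourth-order decay of the transform absorbs the symbol and
  leaves quadratic decay.\<close>

lemma schwartz_symbol_decay:
  assumes u: "schwartz u" and \<delta>: "\<delta> > 0" "\<delta> \<le> 2"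
  obtains D where "\<And>p. norm (- psi \<delta> \<rho> p * fourier u p) \<le> D / (1 + p\<^sup>2)"
proof -
  let ?T = "psi_bound \<delta> \<rho>"
  have T: "?T \<ge> 0" using psi_bound_ge_1[of \<delta> \<rho>] by simp
  obtain C where C: "\<And>p. (1 + \<bar>p\<bar> ^ 4) * norm (fourier u p) \<le> C"
    using schwartz_fourier_decay[OF u, of 4] by blast
  have "norm (- psi \<delta> \<rho> p * fourier u p) \<le> (2 * ?T * C) / (1 + p\<^sup>2)" for p
  proof -
    have p\<delta>: "\<bar>p\<bar> powr \<delta> \<le> 1 + p\<^sup>2"
    proof (cases "\<bar>p\<bar> \<le> 1")
      case True
      then have "\<bar>p\<bar> powr \<delta> \<le> 1" using \<delta> by (intro powr_le1) auto
      then show ?thesis using zero_le_power2[of p] by linarith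
    next
      case False
      then have "\<bar>p\<bar> powr \<delta> \<le> \<bar>p\<bar> powr 2" using \<delta> by (intro powr_mono) auto
      also have "\<dots> = p\<^sup>2" using False by (subst powr_numeral) auto
      finally show ?thesis by simp
    qed
    have sq: "(1 + p\<^sup>2) * (1 + p\<^sup>2) \<le> 2 * (1 + \<bar>p\<bar> ^ 4)"
    proof -
      have "\<bar>p\<bar> ^ 4 = p\<^sup>2 * p\<^sup>2" by (simp add: power4_eq_xxxx power2_eq_square)
      moreover have "0 \<le> (1 - p\<^sup>2) * (1 - p\<^sup>2)" by (rule zero_le_square)
      ultimately show ?thesis by (simp add: algebra_simps)
    qed
    have "(1 + p\<^sup>2) * norm (- psi \<delta> \<rho> p * fourier u p) = (1 + p\<^sup>2) * norm (psi \<delta> \<rho> p) * norm (fourier u p)"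
      by (simp add: norm_mult)
    also have "\<dots> \<le> (1 + p\<^sup>2) * (?T * (1 + p\<^sup>2)) * norm (fourier u p)"
      using norm_psi_le[of \<delta> \<rho> p] mult_left_mono[OF p\<delta> T] by (intro mult_right_mono mult_left_mono) auto
    also have "\<dots> = ?T * norm (fourier u p) * ((1 + p\<^sup>2) * (1 + p\<^sup>2))" by (simp only: mult_ac)
    also have "\<dots> \<le> ?T * norm (fourier u p) * (2 * (1 + \<bar>p\<bar> ^ 4))"
      using T by (intro mult_left_mono sq) auto
    also have "\<dots> = 2 * ?T * ((1 + \<bar>p\<bar> ^ 4) * norm (fourier u p))" by (simp only: mult_ac)
    also have "\<dots> \<le> 2 * ?T * C" using T by (intro mult_left_mono C) auto
    finally show ?thesis by (simp add: pos_le_divide_eq add_pos_nonneg mult.commute)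
  qed
  then show ?thesis by (rule that)
qed

text \<open>Replacing \<open>X\<close> by its truncations gives Schwartz functions, and since truncation changes
  the characteristic function by at most \<open>2 P(\<bar>X\<bar> > n)\<close> uniformly, both the functions and
  their images converge uniformly.\<close>

lemma (in prob_space) Lgraph_expectation_shift:
  assumes \<delta>: "\<delta> > 0" "\<delta> \<le> 2" and X [measurable]: "X \<in> borel_measurable M" and u: "schwartz u"
  shows "Lgraph \<delta> \<rho> (\<lambda>x. expectation (\<lambda>\<omega>. u (x + X \<omega>)))
    (inv_fourier (\<lambda>p. expectation (\<lambda>\<omega>. cis (p * X \<omega>)) * (- psi \<delta> \<rho> p * fourier u p)))"
proof -
  let ?g = "\<lambda>p. - psi \<delta> \<rho> p * fourier u p"
  let ?\<phi> = "\<lambda>p. expectation (\<lambda>\<omega>. cis (p * X \<omega>))"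
  let ?u = "\<lambda>x. expectation (\<lambda>\<omega>. u (x + X \<omega>))"
  obtain D where D: "\<And>p. norm (?g p) \<le> D / (1 + p\<^sup>2)" using schwartz_symbol_decay[OF u \<delta>] by blast
  obtain C where C: "\<And>p. (1 + \<bar>p\<bar> ^ 2) * norm (fourier u p) \<le> C" using schwartz_fourier_decay[OF u] by blast
  have C': "norm (fourier u p) \<le> C / (1 + p\<^sup>2)" for p
    using C[of p] by (simp add: pos_le_divide_eq add_pos_nonneg mult.commute)
  have u_int: "integrable lborel u" using schwartz_integrable[OF u, of 0] by simp
  have [measurable]: "u \<in> borel_measurable borel" using schwartz_measurable[OF u, of 0] by simp
  have contF: "continuous_on UNIV (fourier u)" by (rule continuous_fourier[OF u_int])
  have [measurable]: "fourier u \<in> borel_measurable borel" by (rule borel_measurable_continuous_onI[OF contF])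
  have cont_psi: "continuous_on UNIV (psi \<delta> \<rho>)"
    by (intro continuous_at_imp_continuous_on ballI continuous_psi \<delta>)
  have contg: "continuous_on UNIV ?g" by (intro continuous_intros contF cont_psi)
  have g_int: "integrable lborel ?g"
    by (rule integrable_quadratic_decay[OF borel_measurable_continuous_onI[OF contg] D])
  have \<phi>1: "norm (?\<phi> p * h) \<le> norm h" for p and h :: complex
    using norm_expectation_cis_le[of p X] by (simp add: norm_mult mult_left_le_one_le)
  \<comment> \<open>On the Fourier side both the averaged function and its image come from
    continuous functions with quadratic decay, because a characteristic function has modulus at most
    1. Membership in \<open>C_inf\<close> is then the Riemann-Lebesgue statement.\<close>
  have u_eq: "?u = inv_fourier (\<lambda>p. ?\<phi> p * fourier u p)"
  proof
    fix x
    have "?u x = expectation (\<lambda>\<omega>. inv_fourier (fourier u) (x + X \<omega>))"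
      by (simp add: fourier_inversion[OF u])
    also have "\<dots> = inv_fourier (\<lambda>p. ?\<phi> p * fourier u p) x"
      by (rule expectation_inv_fourier_shift[OF X schwartz_fourier_integrable[OF u]])
    finally show "?u x = inv_fourier (\<lambda>p. ?\<phi> p * fourier u p) x" .
  qed
  obtain B where B: "\<And>x. norm (u x) \<le> B" using schwartz_bounded[OF u, of 0] by auto
  let ?q = "\<lambda>n. prob {\<omega>\<in>space M. real n < \<bar>X \<omega>\<bar>}"
  define w where "w n x = expectation (\<lambda>\<omega>. u (x + truncate n X \<omega>))" for n x
  show ?thesis
    unfolding Lgraph_def
  proof (intro conjI exI[of _ w] allI)
    show "C_inf ?u"
      unfolding u_eq
      by (rule C_inf_inv_fourier[OF _ order_trans[OF \<phi>1 C']]) (intro continuous_intros contF continuous_expectation_cis X)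
    show "C_inf (inv_fourier (\<lambda>p. ?\<phi> p * ?g p))"
      by (rule C_inf_inv_fourier[OF _ order_trans[OF \<phi>1 D]]) (intro continuous_on_mult contg continuous_expectation_cis X)
    show "schwartz (w n)" for n
      unfolding w_def[abs_def] by (rule schwartz_expectation_shift[OF _ u abs_truncate_le]) simp
    show "uniform_limit UNIV w ?u sequentially"
    proof (rule uniform_limit_of_bound)
      show "norm (w n x - ?u x) \<le> 2 * B * ?q n" for n x
        unfolding w_def using B by (intro expectation_truncate_diff) auto
      show "(\<lambda>n. 2 * B * ?q n) \<longlonglongrightarrow> 0"
        using tendsto_mult_right_zero[OF tail_prob_tendsto_0[OF X]] by simp
    qed
    let ?I = "(\<integral>p. norm (?g p) \<partial>lborel)"
    show "uniform_limit UNIV (\<lambda>n. Lpsd \<delta> \<rho> (w n)) (inv_fourier (\<lambda>p. ?\<phi> p * ?g p)) sequentially"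
    proof (rule uniform_limit_of_bound)
      fix n x
      let ?\<phi>n = "\<lambda>p. expectation (\<lambda>\<omega>. cis (p * truncate n X \<omega>))"
      have meas [measurable]: "?\<phi> \<in> borel_measurable borel" "?\<phi>n \<in> borel_measurable borel"
        by (intro borel_measurable_continuous_onI continuous_expectation_cis truncate_measurable X)+
      have \<phi>n1: "norm (?\<phi>n p * h) \<le> norm h" for p and h :: complex
        using norm_expectation_cis_le[of p "truncate n X"] by (simp add: norm_mult mult_left_le_one_le)
      have i: "integrable lborel (\<lambda>p. ?\<phi> p * ?g p)" "integrable lborel (\<lambda>p. ?\<phi>n p * ?g p)"
        by (rule Bochner_Integration.integrable_bound[OF g_int]; use \<phi>1 \<phi>n1 meas in simp)+
      have "Lpsd \<delta> \<rho> (w n) x = inv_fourier (\<lambda>p. ?\<phi>n p * ?g p) x"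
        unfolding Lpsd_def w_def[abs_def] fourier_expectation_shift[OF truncate_measurable[OF X] u_int]
        by (simp add: mult_ac)
      then have "norm (Lpsd \<delta> \<rho> (w n) x - inv_fourier (\<lambda>p. ?\<phi> p * ?g p) x)
          = norm (inv_fourier (\<lambda>p. ?\<phi>n p * ?g p - ?\<phi> p * ?g p) x)"
        using inv_fourier_diff[OF i(2,1)] by simp
      also have "\<dots> \<le> (\<integral>p. norm (?\<phi>n p * ?g p - ?\<phi> p * ?g p) \<partial>lborel) / sqrt (2 * pi)"
        by (rule norm_inv_fourier_le)
      also have "(\<integral>p. norm (?\<phi>n p * ?g p - ?\<phi> p * ?g p) \<partial>lborel) \<le> (\<integral>p. 2 * ?q n * norm (?g p) \<partial>lborel)"
      proof (rule integral_mono)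
        show "integrable lborel (\<lambda>p. norm (?\<phi>n p * ?g p - ?\<phi> p * ?g p))"
          by (intro integrable_norm Bochner_Integration.integrable_diff i)
        show "integrable lborel (\<lambda>p. 2 * ?q n * norm (?g p))"
          by (intro integrable_mult_right integrable_norm g_int)
        fix p
        have "norm (?\<phi>n p - ?\<phi> p) \<le> 2 * 1 * ?q n"
          by (rule expectation_truncate_diff[where h="\<lambda>y. cis (p * y)"]) auto
        then show "norm (?\<phi>n p * ?g p - ?\<phi> p * ?g p) \<le> 2 * ?q n * norm (?g p)"
          unfolding left_diff_distrib[symmetric] norm_mult[of _ "?g p"] by (intro mult_right_mono) auto
      qed
      finally show "norm (Lpsd \<delta> \<rho> (w n) x - inv_fourier (\<lambda>p. ?\<phi> p * ?g p) x) \<le> 2 * ?q n * ?I / sqrt (2 * pi)"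
        by (simp add: divide_right_mono)
    next
      have "(\<lambda>n. 2 * ?q n * ?I / sqrt (2 * pi)) \<longlonglongrightarrow> 2 * 0 * ?I / sqrt (2 * pi)"
        by (intro tendsto_intros tail_prob_tendsto_0 X) auto
      then show "(\<lambda>n. 2 * ?q n * ?I / sqrt (2 * pi)) \<longlonglongrightarrow> 0" by simp
    qed
  qed
qed

text \<open>On the Fourier side the equation is \<open>Phi_equation\<close> with
  \<open>w = psi \<delta> \<rho> p\<close>, one frequency at a time. The modulus of the multiplier
  is at most 1 for positive times because it is a characteristic function, and this alone dominates
  the integrals over \<open>p\<close> and \<open>s\<close>.\<close>

theorem (in homogeneous_kernel) stochastic_solution_of_characteristic_function:
  assumes M: "prob_space M" and \<delta>: "\<delta> > 0" "\<delta> \<le> 2"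
    and X: "\<And>t. t \<ge> 0 \<Longrightarrow> X t \<in> borel_measurable M" and X0: "AE \<omega> in M. X 0 \<omega> = 0"
    and char: "\<And>t p. t > 0 \<Longrightarrow> (\<integral>\<omega>. cis (p * X t \<omega>) \<partial>M) = Phi (- (complex_of_real (t powr \<beta>) * psi \<delta> \<rho> p))"
  shows "provides_stochastic_solution M X k (Lgraph \<delta> \<rho>)"
  unfolding provides_stochastic_solution_def
proof (intro conjI allI impI)
  interpret prob_space M by (rule M)
  show "X t \<in> borel_measurable M" if "t \<ge> 0" for t by (rule X[OF that])
  show "AE \<omega> in M. X 0 \<omega> = 0" by (rule X0)
  fix u assume u: "schwartz u"
  let ?g = "\<lambda>p. - psi \<delta> \<rho> p * fourier u p"
  define \<phi> where "\<phi> t p = Phi (- (complex_of_real (t powr \<beta>) * psi \<delta> \<rho> p))" for t p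
  have \<phi>: "expectation (\<lambda>\<omega>. cis (p * X t \<omega>)) = \<phi> t p" if "t > 0" for t p
    using char[OF that] by (simp add: \<phi>_def)
  have \<phi>_le: "norm (\<phi> t p) \<le> 1" if "t > 0" for t p
    unfolding \<phi>[OF that, symmetric] by (rule norm_expectation_cis_le)
  have [measurable]: "Phi \<in> borel_measurable borel"
    by (rule borel_measurable_continuous_onI[OF continuous_Phi])
  have \<phi>_meas [measurable]: "(\<lambda>(s, p). \<phi> s p) \<in> borel_measurable (borel \<Otimes>\<^sub>M borel)"
    unfolding \<phi>_def by measurable
  obtain D where D: "\<And>p. norm (?g p) \<le> D / (1 + p\<^sup>2)" using schwartz_symbol_decay[OF u \<delta>] by blast
  have u_int: "integrable lborel u" using schwartz_integrable[OF u, of 0] by simp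
  note F_int = schwartz_fourier_integrable[OF u]
  have [measurable]: "fourier u \<in> borel_measurable borel" using F_int by simp
  have g_int: "integrable lborel ?g" by (rule integrable_quadratic_decay[OF _ D]) simp
  \<comment> \<open>The witness for the operator applied to the solution at time
    \<open>s\<close>.\<close>
  define g where "g s = inv_fourier (\<lambda>p. \<phi> s p * ?g p)" for s
  define G where "G = (\<integral>p. norm (?g p) \<partial>lborel)"
  have g_le: "norm (g s x) \<le> G" if s: "s > 0" for s x
  proof -
    have "norm (g s x) \<le> (\<integral>p. norm (\<phi> s p * ?g p) \<partial>lborel) / sqrt (2 * pi)"
      unfolding g_def by (rule norm_inv_fourier_le)
    also have "\<dots> \<le> (\<integral>p. norm (\<phi> s p * ?g p) \<partial>lborel) / 1"
      using pi_ge_two by (intro divide_left_mono) auto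
    also have "\<dots> \<le> G"
      unfolding G_def div_by_1
    proof (rule integral_mono_AE')
      show "integrable lborel (\<lambda>p. norm (?g p))" using g_int by (rule integrable_norm)
      show "AE p in lborel. norm (\<phi> s p * ?g p) \<le> norm (?g p)"
        using \<phi>_le[OF s] by (intro AE_I2) (simp add: norm_mult mult_left_le_one_le)
    qed simp
    finally show ?thesis .
  qed
  let ?u = "\<lambda>t x. expectation (\<lambda>\<omega>. u (x + X t \<omega>))"
  have u_eq: "?u t x - u x = inv_fourier (\<lambda>p. (\<phi> t p - 1) * fourier u p) x" if t: "t > 0" for t x
  proof -
    have "?u t x = expectation (\<lambda>\<omega>. inv_fourier (fourier u) (x + X t \<omega>))"
      by (simp add: fourier_inversion[OF u])
    also have "\<dots> = inv_fourier (\<lambda>p. \<phi> t p * fourier u p) x"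
      using expectation_inv_fourier_shift[OF X F_int, of t x] t by (simp add: \<phi>[OF t])
    finally have "?u t x = inv_fourier (\<lambda>p. \<phi> t p * fourier u p) x" .
    moreover have "u x = inv_fourier (fourier u) x" by (simp add: fourier_inversion[OF u])
    moreover have "integrable lborel (\<lambda>p. \<phi> t p * fourier u p)"
      by (rule Bochner_Integration.integrable_bound[OF F_int])
        (use \<phi>_le[OF t] in \<open>auto simp: norm_mult mult_left_le_one_le \<phi>_def\<close>)
    ultimately show ?thesis using inv_fourier_diff[OF _ F_int] by (simp add: left_diff_distrib)
  qed
  have main: "set_integrable lborel {0<..<t} (\<lambda>s. k t s *\<^sub>R g s x)"
    "?u t x = u x + (\<integral>s\<in>{0<..<t}. k t s *\<^sub>R g s x \<partial>lborel)" if t: "t > 0" for t x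
  proof -
    let ?c = "complex_of_real (1 / sqrt (2 * pi))"
    define \<kappa> where "\<kappa> s = indicator {0<..<t} s * k t s" for s
    have \<kappa>_int: "integrable lborel \<kappa>"
      using kernel_integrable(1)[OF t] by (simp add: \<kappa>_def[abs_def] set_integrable_def)
    have [measurable]: "\<kappa> \<in> borel_measurable borel" using \<kappa>_int by simp
    \<comment> \<open>Up to the normalising constant, integrating \<open>h\<close> over
      \<open>p\<close> and then over \<open>s\<close> gives the memory integral, while integrating
      over \<open>s\<close> first gives the increment \<open>u(t, x) - u(x)\<close> through the
      scalar equation. The equation is thus Fubini for \<open>h\<close>.\<close>
    define h where "h = (\<lambda>(s, p). \<kappa> s *\<^sub>R (cis (p * x) * (\<phi> s p * ?g p)))"
    have h_meas: "h \<in> borel_measurable (lborel \<Otimes>\<^sub>M lborel)"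
      unfolding h_def \<phi>_def by measurable
    have h_int: "integrable (lborel \<Otimes>\<^sub>M lborel) h"
    proof (rule Bochner_Integration.integrable_bound)
      show "integrable (lborel \<Otimes>\<^sub>M lborel) (\<lambda>(s, p). complex_of_real (\<kappa> s) * ?g p)"
        by (rule integrable_product[where f="\<lambda>s. complex_of_real (\<kappa> s)" and g="?g"])
          (use \<kappa>_int g_int in \<open>auto simp: norm_mult\<close>)
      have "norm (h (s, p)) \<le> norm (complex_of_real (\<kappa> s) * ?g p)" for s p
      proof (cases "s > 0")
        case True
        then have "norm (\<phi> s p) * norm (?g p) \<le> norm (?g p)"
          using \<phi>_le[OF True] by (intro mult_left_le_one_le) auto
        then show ?thesis unfolding h_def by (simp add: norm_mult mult_left_mono)
      qed (simp add: h_def \<kappa>_def)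
      then show "AE z in lborel \<Otimes>\<^sub>M lborel. norm (h z) \<le> norm (case z of (s, p) \<Rightarrow> complex_of_real (\<kappa> s) * ?g p)"
        by (intro AE_I2) (auto simp del: norm_mult)
    qed (rule h_meas)
    have inner_p: "?c * (\<integral>p. h (s, p) \<partial>lborel) = \<kappa> s *\<^sub>R g s x" for s
      unfolding g_def inv_fourier_def h_def by (simp add: scaleR_conv_of_real)
    have inner_s: "(\<integral>s. h (s, p) \<partial>lborel) = cis (p * x) * ((\<phi> t p - 1) * fourier u p)" for p
    proof -
      have "(\<integral>s. h (s, p) \<partial>lborel) = (\<integral>s. (\<kappa> s *\<^sub>R \<phi> s p) * (cis (p * x) * ?g p) \<partial>lborel)"
        unfolding h_def by (intro Bochner_Integration.integral_cong) (auto simp: scaleR_conv_of_real)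
      also have "\<dots> = (\<integral>s. \<kappa> s *\<^sub>R \<phi> s p \<partial>lborel) * (cis (p * x) * ?g p)"
        by (rule integral_mult_left_zero)
      also have "(\<integral>s. \<kappa> s *\<^sub>R \<phi> s p \<partial>lborel) = (\<integral>s\<in>{0<..<t}. k t s *\<^sub>R \<phi> s p \<partial>lborel)"
        by (simp add: \<kappa>_def set_lebesgue_integral_def)
      also have "\<dots> * (cis (p * x) * ?g p) = cis (p * x) * ((- psi \<delta> \<rho> p * (\<integral>s\<in>{0<..<t}. k t s *\<^sub>R \<phi> s p \<partial>lborel)) * fourier u p)"
        by (simp add: mult_ac)
      also have "- psi \<delta> \<rho> p * (\<integral>s\<in>{0<..<t}. k t s *\<^sub>R \<phi> s p \<partial>lborel) = \<phi> t p - 1"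
        unfolding \<phi>_def by (rule Phi_equation[OF t, symmetric])
      finally show ?thesis .
    qed
    have "integrable lborel (\<lambda>s. ?c * (\<integral>p. h (s, p) \<partial>lborel))"
      by (intro integrable_mult_right lborel_pair.integrable_fst' h_int)
    then show "set_integrable lborel {0<..<t} (\<lambda>s. k t s *\<^sub>R g s x)"
      unfolding inner_p by (simp add: set_integrable_def \<kappa>_def)
    have "?u t x - u x = ?c * (\<integral>p. (\<integral>s. h (s, p) \<partial>lborel) \<partial>lborel)"
      unfolding u_eq[OF t] inner_s inv_fourier_def ..
    also have "(\<integral>p. (\<integral>s. h (s, p) \<partial>lborel) \<partial>lborel) = (\<integral>s. (\<integral>p. h (s, p) \<partial>lborel) \<partial>lborel)"
      using lborel_pair.Fubini_integral[of "\<lambda>s p. h (s, p)"] h_int by simp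
    also have "?c * (\<integral>s. (\<integral>p. h (s, p) \<partial>lborel) \<partial>lborel) = (\<integral>s. \<kappa> s *\<^sub>R g s x \<partial>lborel)"
      unfolding inner_p[symmetric] by (rule integral_mult_right_zero[symmetric])
    also have "\<dots> = (\<integral>s\<in>{0<..<t}. k t s *\<^sub>R g s x \<partial>lborel)"
      by (simp add: \<kappa>_def set_lebesgue_integral_def)
    finally show "?u t x = u x + (\<integral>s\<in>{0<..<t}. k t s *\<^sub>R g s x \<partial>lborel)" by (simp add: algebra_simps)
  qed
  show "solves_eq k (Lgraph \<delta> \<rho>) u ?u"
    unfolding solves_eq_def
  proof (intro exI[of _ g] conjI allI impI)
    fix s :: real assume s: "s > 0"
    show "Lgraph \<delta> \<rho> (?u s) (g s)"
      using Lgraph_expectation_shift[OF \<delta> X u, of s \<rho>] s by (simp add: \<phi>[OF s] g_def)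
  next
    fix x
    \<comment> \<open>The initial condition is read off from the equation: \<open>g\<close> is
      bounded by \<open>G\<close>, and the kernel has total mass proportional to
      \<open>t powr \<beta>\<close> on \<open>{0<..<t}\<close>, so the convergence is even uniform
      in \<open>x\<close>.\<close>
    let ?K = "\<integral>s\<in>{0<..<1}. \<bar>k 1 s\<bar> \<partial>lborel"
    have bound: "norm (?u t x - u x) \<le> t powr \<beta> * ?K * G" if t: "t > 0" for t
    proof -
      have "norm (?u t x - u x) = norm (\<integral>s. indicator {0<..<t} s *\<^sub>R (k t s *\<^sub>R g s x) \<partial>lborel)"
        unfolding main(2)[OF t, of x] by (simp add: set_lebesgue_integral_def)
      also have "\<dots> \<le> (\<integral>s. norm (indicator {0<..<t} s *\<^sub>R (k t s *\<^sub>R g s x)) \<partial>lborel)"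
        by (rule integral_norm_bound)
      also have "\<dots> \<le> (\<integral>s. (indicator {0<..<t} s *\<^sub>R \<bar>k t s\<bar>) * G \<partial>lborel)"
      proof (rule integral_mono)
        show "integrable lborel (\<lambda>s. norm (indicator {0<..<t} s *\<^sub>R (k t s *\<^sub>R g s x)))"
          using main(1)[OF t, of x] unfolding set_integrable_def by (rule integrable_norm)
        have "integrable lborel (\<lambda>s. norm (indicator {0<..<t} s *\<^sub>R k t s))"
          using kernel_integrable(1)[OF t] unfolding set_integrable_def by (rule integrable_norm)
        then show "integrable lborel (\<lambda>s. (indicator {0<..<t} s *\<^sub>R \<bar>k t s\<bar>) * G)"
          by (intro integrable_mult_left) (simp add: abs_mult)
        show "norm (indicator {0<..<t} s *\<^sub>R (k t s *\<^sub>R g s x)) \<le> (indicator {0<..<t} s *\<^sub>R \<bar>k t s\<bar>) * G" for s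
          using g_le[of s x] by (auto simp: indicator_def mult_left_mono)
      qed
      also have "\<dots> = (\<integral>s\<in>{0<..<t}. \<bar>k t s\<bar> \<partial>lborel) * G"
        unfolding set_lebesgue_integral_def by (rule integral_mult_left_zero)
      also have "\<dots> = t powr \<beta> * ?K * G" unfolding kernel_integrable(2)[OF t] ..
      finally show ?thesis .
    qed
    have "((\<lambda>t. t powr \<beta> * ?K * G) \<longlongrightarrow> 0 powr \<beta> * ?K * G) (at_right 0)"
      using beta by (intro tendsto_intros) (auto simp: eventually_at_right_less intro: eventually_at_rightI[of 0 1])
    then have "((\<lambda>t. t powr \<beta> * ?K * G) \<longlongrightarrow> 0) (at_right 0)" using beta by simp
    then have "((\<lambda>t. ?u t x - u x) \<longlongrightarrow> 0) (at_right 0)"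
    proof (rule Lim_null_comparison[rotated])
      show "eventually (\<lambda>t. norm (?u t x - u x) \<le> t powr \<beta> * ?K * G) (at_right 0)"
        using eventually_at_right_less[of "0::real"] by eventually_elim (rule bound)
    qed
    then show "((\<lambda>t. ?u t x) \<longlongrightarrow> u x) (at_right 0)" by (rule LIM_zero_cancel)
  qed (use main in auto)
qed

section \<open>Randomly scaled linear fractional stable motion\<close>

context prob_space
begin

text \<open>Evaluation at \<open>t\<close> is measurable on the product space, so the sigma-algebra
  of \<open>Y t\<close> is contained in that of the whole path.\<close>

lemma indep_of_process_component:
  assumes "indep_of_process M A Y" "t \<ge> 0"
  shows "indep_var borel A borel (Y t)"
proof -
  let ?P = "Pi\<^sub>M {0..} (\<lambda>_. borel) :: (real \<Rightarrow> real) measure"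
  let ?Y = "\<lambda>\<omega>. \<lambda>t\<in>{0..}. Y t \<omega>"
  let ?SA = "sigma_sets (space M) {A -` C \<inter> space M | C. C \<in> sets borel}"
  let ?SY = "sigma_sets (space M) {?Y -` C \<inter> space M | C. C \<in> sets ?P}"
  let ?SYt = "sigma_sets (space M) {Y t -` C \<inter> space M | C. C \<in> sets borel}"
  have A: "A \<in> borel_measurable M" and Y: "?Y \<in> M \<rightarrow>\<^sub>M ?P" and ind: "indep_set ?SA ?SY"
    using assms(1) unfolding indep_of_process_def by blast+
  have comp: "(\<lambda>f. f t) \<in> ?P \<rightarrow>\<^sub>M borel"
    using assms(2) by (intro measurable_component_singleton) simp
  have Yt: "?Y \<omega> t = Y t \<omega>" for \<omega> using assms(2) by simp
  have "?SYt \<subseteq> ?SY"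
  proof (rule sigma_sets_mono, safe)
    fix C :: "real set" assume C: "C \<in> sets borel"
    have "Y t -` C \<inter> space M = ?Y -` ((\<lambda>f. f t) -` C \<inter> space ?P) \<inter> space M"
      using measurable_space[OF Y] Yt by auto
    moreover have "(\<lambda>f. f t) -` C \<inter> space ?P \<in> sets ?P" by (rule measurable_sets[OF comp C])
    ultimately show "Y t -` C \<inter> space M \<in> ?SY" by (intro sigma_sets.Basic) blast
  qed
  then have "indep_set ?SA ?SYt" using ind unfolding indep_sets2_eq by blast
  moreover have "Y t \<in> borel_measurable M"
    using measurable_compose[OF Y comp] unfolding Yt .
  ultimately show ?thesis using A by (simp add: indep_var_eq)
qed

text \<open>Independence turns the joint law into a product, and the inner integral is taken with
  \<open>a\<close> fixed. Homogeneity of the symbol then converts the scale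
  \<open>a powr (1 / \<delta>)\<close> into the factor \<open>a\<close>, which is valid for
  nonnegative \<open>a\<close> and hence almost surely.\<close>

lemma expectation_cis_scaled_lfsm:
  assumes \<delta>: "\<delta> > 0" and H: "H > 0" and Y: "is_lfsm M \<delta> \<rho> H Y" and t: "t \<ge> 0"
    and skew: "\<rho> = 0 \<or> H \<noteq> 1 / \<delta>"
    and A: "AE \<omega> in M. 0 \<le> A \<omega>" and indep: "indep_of_process M A Y"
  shows "expectation (\<lambda>\<omega>. cis (p * (A \<omega> powr (1 / \<delta>) * Y t \<omega>)))
    = expectation (\<lambda>\<omega>. exp (- (complex_of_real (t powr (\<delta> * H)) * psi \<delta> (\<rho> * lfsm_skew \<delta> H) p * complex_of_real (A \<omega>))))"
proof -
  have iv: "indep_var borel A borel (Y t)" by (rule indep_of_process_component[OF indep t])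
  have [measurable]: "A \<in> borel_measurable M" "Y t \<in> borel_measurable M"
    using iv by (auto dest: indep_var_rv1 indep_var_rv2)
  let ?DA = "distr M borel A" and ?DY = "distr M borel (Y t)"
  interpret DA: prob_space ?DA by (rule prob_space_distr) simp
  interpret DY: prob_space ?DY by (rule prob_space_distr) simp
  interpret P: pair_prob_space ?DA ?DY ..
  let ?f = "\<lambda>(a, y). cis (p * (a powr (1 / \<delta>) * y))"
  have eq: "?DA \<Otimes>\<^sub>M ?DY = distr M (borel \<Otimes>\<^sub>M borel) (\<lambda>\<omega>. (A \<omega>, Y t \<omega>))"
    using iv by (simp add: indep_var_distribution_eq)
  have int: "integrable (?DA \<Otimes>\<^sub>M ?DY) ?f"
    by (rule P.integrable_const_bound[where B=1]) auto
  have "expectation (\<lambda>\<omega>. cis (p * (A \<omega> powr (1 / \<delta>) * Y t \<omega>))) = (\<integral>z. ?f z \<partial>(?DA \<Otimes>\<^sub>M ?DY))"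
    unfolding eq by (subst integral_distr) auto
  also have "\<dots> = (\<integral>a. (\<integral>y. ?f (a, y) \<partial>?DY) \<partial>?DA)"
    by (rule P.integral_fst'[OF int, symmetric])
  also have "(\<lambda>a. \<integral>y. ?f (a, y) \<partial>?DY) = (\<lambda>a. exp (- (complex_of_real (t powr (\<delta> * H)) * psi \<delta> (\<rho> * lfsm_skew \<delta> H) (p * a powr (1 / \<delta>)))))"
  proof
    fix a
    have "(\<integral>y. ?f (a, y) \<partial>?DY) = expectation (\<lambda>\<omega>. cis ((p * a powr (1 / \<delta>)) * Y t \<omega>))"
      by (subst integral_distr) (auto simp: mult.assoc)
    also have "\<dots> = exp (- (complex_of_real (t powr (\<delta> * H)) * psi \<delta> (\<rho> * lfsm_skew \<delta> H) (p * a powr (1 / \<delta>))))"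
      by (rule expectation_cis_lfsm[OF \<delta> H Y t skew])
    finally show "(\<integral>y. ?f (a, y) \<partial>?DY) = \<dots>" .
  qed
  also have "(\<integral>a. exp (- (complex_of_real (t powr (\<delta> * H)) * psi \<delta> (\<rho> * lfsm_skew \<delta> H) (p * a powr (1 / \<delta>)))) \<partial>?DA)
      = expectation (\<lambda>\<omega>. exp (- (complex_of_real (t powr (\<delta> * H)) * psi \<delta> (\<rho> * lfsm_skew \<delta> H) (p * A \<omega> powr (1 / \<delta>)))))"
    by (rule integral_distr) measurable
  also have "\<dots> = expectation (\<lambda>\<omega>. exp (- (complex_of_real (t powr (\<delta> * H)) * psi \<delta> (\<rho> * lfsm_skew \<delta> H) p * complex_of_real (A \<omega>))))"
  proof (rule integral_cong_AE)
    show "AE \<omega> in M. exp (- (complex_of_real (t powr (\<delta> * H)) * psi \<delta> (\<rho> * lfsm_skew \<delta> H) (p * A \<omega> powr (1 / \<delta>))))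
      = exp (- (complex_of_real (t powr (\<delta> * H)) * psi \<delta> (\<rho> * lfsm_skew \<delta> H) p * complex_of_real (A \<omega>)))"
      using A
    proof eventually_elim
      case (elim \<omega>)
      have "psi \<delta> (\<rho> * lfsm_skew \<delta> H) (p * A \<omega> powr (1 / \<delta>)) = complex_of_real ((A \<omega> powr (1 / \<delta>)) powr \<delta>) * psi \<delta> (\<rho> * lfsm_skew \<delta> H) p"
        by (subst mult.commute) (rule psi_mult, simp)
      also have "(A \<omega> powr (1 / \<delta>)) powr \<delta> = A \<omega>" using elim \<delta> by (simp add: powr_powr)
      finally show ?case by (simp only: mult_ac)
    qed
  qed measurable
  finally show ?thesis .
qed

text \<open>The kernel vanishes at time 0, but \<open>Y 0\<close> is pinned down only through a
  limit in probability. Its law is identified instead: the characteristic function is constantly 1,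
  which is that of the point mass at 0.\<close>

lemma lfsm_start:
  assumes \<delta>: "\<delta> > 0" and H: "H > 0" and Y: "is_lfsm M \<delta> \<rho> H Y" and skew: "\<rho> = 0 \<or> H \<noteq> 1 / \<delta>"
  shows "AE \<omega> in M. Y 0 \<omega> = 0"
proof -
  have [measurable]: "Y 0 \<in> borel_measurable M" by (rule lfsm_measurable[OF \<delta> H Y]) simp
  have "char (distr M borel (Y 0)) = char (return borel 0)"
  proof
    fix p
    have "char (distr M borel (Y 0)) p = expectation (\<lambda>\<omega>. cis (p * Y 0 \<omega>))"
      unfolding char_def by (subst integral_distr) (auto simp: cis_conv_exp)
    also have "\<dots> = 1" using expectation_cis_lfsm[OF \<delta> H Y order_refl skew, of p] by simp
    also have "\<dots> = char (return borel 0) p" by (simp add: char_def integral_return)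
    finally show "char (distr M borel (Y 0)) p = char (return borel 0) p" .
  qed
  moreover have "real_distribution (return borel 0)"
    by (simp add: real_distribution_def real_distribution_axioms_def prob_space_return)
  moreover have "real_distribution (distr M borel (Y 0))" by (rule real_distribution_distr) simp
  ultimately have "distr M borel (Y 0) = return borel 0" by (intro Levy_uniqueness)
  moreover have "AE y in return borel (0::real). y = 0" by (subst AE_return) auto
  ultimately have "AE y in distr M borel (Y 0). y = 0" by (simp only:)
  then show ?thesis by (subst (asm) AE_distr_iff) auto
qed

end

text \<open>For \<open>H = \<beta> / \<delta>\<close> the kernel exponent is
  \<open>(\<beta> - 1) / \<delta>\<close>. If \<beta> > 1 the kernel is nonnegative and the skewness
  is kept; if \<beta> < 1 it is negative on the past, whose contribution changes sign in the
  numerator.\<close>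

lemma rho0_eq_lfsm_skew:
  assumes \<beta>: "\<beta> > 0" "\<beta> \<noteq> 1" and \<delta>: "\<delta> > 0"
  shows "\<rho> * lfsm_skew \<delta> (\<beta> / \<delta>) = rho0 \<beta> \<delta> \<rho>"
proof -
  have a: "\<beta> / \<delta> - 1 / \<delta> = (\<beta> - 1) / \<delta>" by (simp add: diff_divide_distrib)
  have b: "1 / (\<delta> * (\<beta> / \<delta>)) = 1 / \<beta>" using \<delta> by simp
  have pos: "1 / \<beta> + lfsm_tail \<delta> (\<beta> / \<delta>) > 0"
    using \<beta> lfsm_tail_nonneg[of \<delta> "\<beta> / \<delta>"] by (intro add_pos_nonneg) auto
  show ?thesis
  proof (cases "1 < \<beta>")
    case True
    then have "sgn ((\<beta> - 1) / \<delta>) = 1" using \<delta> by simp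
    then have "lfsm_skew \<delta> (\<beta> / \<delta>) = 1" unfolding lfsm_skew_def a b using pos by simp
    then show ?thesis using True by (simp add: rho0_def)
  next
    case False
    with \<beta> have neg: "(\<beta> - 1) / \<delta> < 0" using \<delta> by (simp add: divide_neg_pos)
    have "\<bar>(1 + x) powr ((\<beta> - 1) / \<delta>) - x powr ((\<beta> - 1) / \<delta>)\<bar> = x powr ((\<beta> - 1) / \<delta>) - (1 + x) powr ((\<beta> - 1) / \<delta>)"
      if "x \<in> {0<..}" for x
      using powr_less_mono2_neg[OF neg, of x "1 + x"] that by simp
    then have "lfsm_tail \<delta> (\<beta> / \<delta>) = (\<integral>x\<in>{0<..}. (x powr ((\<beta> - 1) / \<delta>) - (1 + x) powr ((\<beta> - 1) / \<delta>)) powr \<delta> \<partial>lborel)"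
      unfolding lfsm_tail_def a by (intro set_lebesgue_integral_cong) auto
    then show ?thesis
      using False neg unfolding lfsm_skew_def a b by (simp add: rho0_def Let_def del: sgn_divide)
  qed
qed

section \<open>From the hypotheses on the kernel to the two statements\<close>

lemma homogeneous_kernelI:
  fixes k :: "real \<Rightarrow> real \<Rightarrow> real"
  assumes beta: "0 < \<beta>"
    and kmeas: "set_borel_measurable borel ({0<..} \<times> {0<..}) (\<lambda>(t, s). k t s)"
    and khom: "\<forall>t>0. \<forall>s\<in>{0<..<1}. k t (t * s) = t powr (\<beta> - 1) * k 1 s"
    and eps: "0 < \<epsilon>"
    and kLp: "set_integrable lborel {0<..<1} (\<lambda>s. \<bar>k 1 s\<bar> powr (1 + \<epsilon>))"
  shows "homogeneous_kernel k \<beta>"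
proof
  show "set_integrable lborel {0<..<1} (k 1)"
    unfolding set_integrable_def
  proof (rule Bochner_Integration.integrable_bound)
    show "integrable lborel (\<lambda>s. indicator {0<..<1} s + indicator {0<..<1} s *\<^sub>R \<bar>k 1 s\<bar> powr (1 + \<epsilon>))"
      using kLp by (auto simp: set_integrable_def intro!: Bochner_Integration.integrable_add)
    have "(\<lambda>x. indicator ({0<..} \<times> {0<..}) x *\<^sub>R (case x of (t, s) \<Rightarrow> k t s)) \<in> borel_measurable (borel :: (real \<times> real) measure)"
      using kmeas by (simp add: set_borel_measurable_def)
    moreover have "(\<lambda>s. (1::real, s::real)) \<in> borel \<rightarrow>\<^sub>M borel"
      by (intro borel_measurable_continuous_onI continuous_intros)
    ultimately have "(\<lambda>s. indicator ({0<..} \<times> {0<..}) (1::real, s) *\<^sub>R (case (1, s) of (t, s) \<Rightarrow> k t s)) \<in> borel_measurable borel"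
      by (rule measurable_compose[rotated])
    then have "(\<lambda>s. indicator {0<..<1} s *\<^sub>R (indicator ({0<..} \<times> {0<..}) (1::real, s) *\<^sub>R (case (1, s) of (t, s) \<Rightarrow> k t s))) \<in> borel_measurable borel"
      by measurable
    also have "(\<lambda>s. indicator {0<..<1} s *\<^sub>R (indicator ({0<..} \<times> {0<..}) (1::real, s) *\<^sub>R (case (1, s) of (t, s) \<Rightarrow> k t s)))
        = (\<lambda>s. indicator {0<..<1} s *\<^sub>R k 1 s)"
      by (auto simp: indicator_def)
    finally show "(\<lambda>s. indicator {0<..<1} s *\<^sub>R k 1 s) \<in> borel_measurable lborel" by simp
    \<comment> \<open>The unit interval has finite measure, so the constant 1 is integrable there
      and the bound in the higher power yields integrability of \<open>k 1\<close>.\<close>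
    have "\<bar>y\<bar> \<le> 1 + \<bar>y\<bar> powr (1 + \<epsilon>)" for y :: real
    proof (cases "\<bar>y\<bar> \<le> 1")
      case False
      then have "\<bar>y\<bar> powr 1 \<le> \<bar>y\<bar> powr (1 + \<epsilon>)" using eps by (intro powr_mono) auto
      then show ?thesis by simp
    qed (simp add: add_increasing2)
    then show "AE s in lborel. norm (indicator {0<..<1} s *\<^sub>R k 1 s)
        \<le> norm (indicator {0<..<1} s + indicator {0<..<1} s *\<^sub>R \<bar>k 1 s\<bar> powr (1 + \<epsilon>))"
      by (intro AE_I2) (auto simp: indicator_def)
  qed
qed (use beta khom in auto)

theorem theorem5p1:
  fixes k :: "real \<Rightarrow> real \<Rightarrow> real" and \<beta> \<epsilon> :: real
  assumes beta: "0 < \<beta>" "\<beta> < 2"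
    and kmeas: "set_borel_measurable borel ({0<..} \<times> {0<..}) (\<lambda>(t, s). k t s)"
    and khom: "\<forall>t>0. \<forall>s\<in>{0<..<1}. k t (t * s) = t powr (\<beta> - 1) * k 1 s"
    and eps: "0 < \<epsilon>"
    and kLp: "set_integrable lborel {0<..<1} (\<lambda>s. \<bar>k 1 s\<bar> powr (1 + \<epsilon>))"
    and cm: "completely_monotone_on {0<..} (\<lambda>x. Phihat k \<beta> (- x))"
  shows
    "(\<forall>(M :: 'a measure) (A :: 'a \<Rightarrow> real) (Y :: real \<Rightarrow> 'a \<Rightarrow> real) \<gamma> \<delta>.
        prob_space M \<and> \<beta> < \<gamma> \<and> \<gamma> \<le> 2 \<and> \<gamma> \<le> \<delta> \<and> \<delta> \<le> 2 \<and> \<delta> \<noteq> \<gamma> / \<beta> \<and>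
        A \<in> borel_measurable M \<and> (AE \<omega> in M. 0 \<le> A \<omega>) \<and>
        (\<forall>x\<ge>0. (\<integral>\<omega>. exp (- (x * A \<omega>)) \<partial>M) = Phihat k \<beta> (- (x powr (\<gamma> / \<delta>)))) \<and>
        is_lfsm M \<delta> 0 (\<beta> / \<gamma>) Y \<and> indep_of_process M A Y
        \<longrightarrow> provides_stochastic_solution M (\<lambda>t \<omega>. A \<omega> powr (1 / \<delta>) * Y t \<omega>) k
              (Lgraph \<gamma> 0))
   \<and>
     (\<forall>(M :: 'a measure) (A :: 'a \<Rightarrow> real) (Y :: real \<Rightarrow> 'a \<Rightarrow> real) \<delta> \<rho>.
        prob_space M \<and> \<beta> \<noteq> 1 \<and> \<beta> < \<delta> \<and> \<delta> \<le> 2 \<and> \<delta> \<noteq> 1 \<and> -1 \<le> \<rho> \<and> \<rho> \<le> 1 \<and>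
        A \<in> borel_measurable M \<and> (AE \<omega> in M. 0 \<le> A \<omega>) \<and>
        (\<forall>x\<ge>0. (\<integral>\<omega>. exp (- (x * A \<omega>)) \<partial>M) = Phihat k \<beta> (- x)) \<and>
        is_lfsm M \<delta> \<rho> (\<beta> / \<delta>) Y \<and> indep_of_process M A Y
        \<longrightarrow> provides_stochastic_solution M (\<lambda>t \<omega>. A \<omega> powr (1 / \<delta>) * Y t \<omega>) k
              (Lgraph \<delta> (rho0 \<beta> \<delta> \<rho>)))"
proof -
  interpret homogeneous_kernel k \<beta> by (rule homogeneous_kernelI[OF beta(1) kmeas khom eps kLp])
  show ?thesis
  proof (intro conjI allI impI; elim conjE)
    fix M :: "'a measure" and A :: "'a \<Rightarrow> real" and Y :: "real \<Rightarrow> 'a \<Rightarrow> real" and \<gamma> \<delta> :: real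
    assume M: "prob_space M" and \<gamma>: "\<beta> < \<gamma>" "\<gamma> \<le> 2" and \<delta>: "\<gamma> \<le> \<delta>"
      and A: "A \<in> borel_measurable M" "AE \<omega> in M. 0 \<le> A \<omega>"
      and laplace: "\<forall>x\<ge>0. (\<integral>\<omega>. exp (- (x * A \<omega>)) \<partial>M) = Phihat k \<beta> (- (x powr (\<gamma> / \<delta>)))"
      and Y: "is_lfsm M \<delta> 0 (\<beta> / \<gamma>) Y" and indep: "indep_of_process M A Y"
    interpret prob_space M by (rule M)
    have pos: "\<gamma> > 0" "\<delta> > 0" "\<beta> / \<gamma> > 0" using beta \<gamma> \<delta> by auto
    show "provides_stochastic_solution M (\<lambda>t \<omega>. A \<omega> powr (1 / \<delta>) * Y t \<omega>) k (Lgraph \<gamma> 0)"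
    proof (rule stochastic_solution_of_characteristic_function[OF M pos(1) \<gamma>(2)])
      show "(\<lambda>\<omega>. A \<omega> powr (1 / \<delta>) * Y t \<omega>) \<in> borel_measurable M" if "t \<ge> 0" for t
        using A(1) lfsm_measurable[OF pos(2,3) Y that] by measurable
      show "AE \<omega> in M. A \<omega> powr (1 / \<delta>) * Y 0 \<omega> = 0"
        using lfsm_start[OF pos(2,3) Y] by (auto elim: eventually_mono)
      fix t p :: real assume t: "t > 0"
      \<comment> \<open>The real exponent of the symmetric motion. Raised to
        \<open>\<gamma> / \<delta>\<close> it becomes \<open>t powr \<beta>\<close> times the symbol
        of order \<gamma>, which is how the prescribed Laplace transform exchanges \<delta> for
        \<gamma>.\<close>
      define x where "x = t powr (\<delta> * (\<beta> / \<gamma>)) * \<bar>p\<bar> powr \<delta>"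
      have x: "x powr (\<gamma> / \<delta>) = t powr \<beta> * \<bar>p\<bar> powr \<gamma>"
        using pos by (simp add: x_def powr_mult powr_powr)
      have "(\<integral>\<omega>. cis (p * (A \<omega> powr (1 / \<delta>) * Y t \<omega>)) \<partial>M) = expectation (\<lambda>\<omega>. complex_of_real (exp (- (x * A \<omega>))))"
        using expectation_cis_scaled_lfsm[OF pos(2,3) Y less_imp_le[OF t] _ A(2) indep, of p]
        by (simp add: psi_symmetric x_def flip: exp_of_real)
      also have "\<dots> = complex_of_real (expectation (\<lambda>\<omega>. exp (- (x * A \<omega>))))"
        by (rule integral_complex_of_real)
      also have "expectation (\<lambda>\<omega>. exp (- (x * A \<omega>))) = Phihat k \<beta> (- (t powr \<beta> * \<bar>p\<bar> powr \<gamma>))"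
        using laplace by (simp add: x[symmetric]) (simp add: x_def)
      finally show "(\<integral>\<omega>. cis (p * (A \<omega> powr (1 / \<delta>) * Y t \<omega>)) \<partial>M) = Phi (- (complex_of_real (t powr \<beta>) * psi \<gamma> 0 p))"
        by (simp add: psi_symmetric flip: Phi_of_real)
    qed
  next
    fix M :: "'a measure" and A :: "'a \<Rightarrow> real" and Y :: "real \<Rightarrow> 'a \<Rightarrow> real" and \<delta> \<rho> :: real
    assume M: "prob_space M" and \<beta>1: "\<beta> \<noteq> 1" and \<delta>: "\<beta> < \<delta>" "\<delta> \<le> 2"
      and A: "A \<in> borel_measurable M" "AE \<omega> in M. 0 \<le> A \<omega>"
      and laplace: "\<forall>x\<ge>0. (\<integral>\<omega>. exp (- (x * A \<omega>)) \<partial>M) = Phihat k \<beta> (- x)"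
      and Y: "is_lfsm M \<delta> \<rho> (\<beta> / \<delta>) Y" and indep: "indep_of_process M A Y"
    interpret prob_space M by (rule M)
    have pos: "\<delta> > 0" "\<beta> / \<delta> > 0" using beta \<delta> by auto
    have skew: "\<rho> = 0 \<or> \<beta> / \<delta> \<noteq> 1 / \<delta>" using \<beta>1 pos by simp
    show "provides_stochastic_solution M (\<lambda>t \<omega>. A \<omega> powr (1 / \<delta>) * Y t \<omega>) k (Lgraph \<delta> (rho0 \<beta> \<delta> \<rho>))"
    proof (rule stochastic_solution_of_characteristic_function[OF M pos(1) \<delta>(2)])
      show "(\<lambda>\<omega>. A \<omega> powr (1 / \<delta>) * Y t \<omega>) \<in> borel_measurable M" if "t \<ge> 0" for t
        using A(1) lfsm_measurable[OF pos Y that] by measurable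
      show "AE \<omega> in M. A \<omega> powr (1 / \<delta>) * Y 0 \<omega> = 0"
        using lfsm_start[OF pos Y skew] by (auto elim: eventually_mono)
      fix t p :: real assume t: "t > 0"
      define z where "z = complex_of_real (t powr \<beta>) * psi \<delta> (rho0 \<beta> \<delta> \<rho>) p"
      have "(\<integral>\<omega>. cis (p * (A \<omega> powr (1 / \<delta>) * Y t \<omega>)) \<partial>M) = expectation (\<lambda>\<omega>. exp (- (z * complex_of_real (A \<omega>))))"
        using expectation_cis_scaled_lfsm[OF pos Y less_imp_le[OF t] skew A(2) indep, of p] pos
        unfolding rho0_eq_lfsm_skew[OF beta(1) \<beta>1 pos(1)] by (simp add: z_def)
      also have "\<dots> = Phi (- z)"
      \<comment> \<open>At \<open>p = 0\<close> the argument \<open>z\<close> is 0, on the boundary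
        of the half-plane where the continuation holds. There the Laplace transform at 0 gives the
        value 1 on both sides.\<close>
      proof (cases "p = 0")
        case True
        then have "z = 0" by (simp add: z_def)
        moreover have "Phihat k \<beta> 0 = 1" using laplace[rule_format, of 0] by (simp add: prob_space)
        ultimately show ?thesis using Phi_of_real[of 0] by (simp add: prob_space)
      next
        case False
        then have "Re z > 0" using t by (simp add: z_def)
        then show ?thesis
          unfolding Phi_def using laplace
          by (intro laplace_transform_entire[OF A Phi_summable]) (auto simp: Phihat_def)
      qed
      finally show "(\<integral>\<omega>. cis (p * (A \<omega> powr (1 / \<delta>) * Y t \<omega>)) \<partial>M) = Phi (- (complex_of_real (t powr \<beta>) * psi \<delta> (rho0 \<beta> \<delta> \<rho>) p))"
        by (simp add: z_def)
    qed
  qed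
qed

end
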